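(* Let $\mathfrak g$ be the Lie algebra of $G=Sp_4(\mathbf C)$ (so $\dim\mathfrak g=10$), and for an integer $d$ let $\mathfrak g^d$ be the set of all $\xi\in\mathfrak g$ such that the centralizer of $\xi$ has dimension $10-d$. Then $\mathfrak g^6\cup\mathfrak g^4$ is locally closed in $\mathfrak g$, and any irreducible component of $\mathfrak g^6\cup\mathfrak g^4$ is a rational homology manifold.
   Context: The centralizer of $\xi$ is taken in $\mathfrak g$ (equivalently, one may use the dimension of its centralizer in $G$ under the adjoint action). "Locally closed" refers to the Zariski topology, and $\mathfrak g^6\cup\mathfrak g^4$ is regarded as a (reduced) complex algebraic variety. An irreducible complex algebraic variety $X$ of dimension $n$ is a rational homology manifold if for every point $x\in X$ (in the classical topology) one has $H_i(X,X-\{x\};\mathbf Q)=0$ for $i\ne 2n$ and $H_{2n}(X,X-\{x\};\mathbf Q)\cong\mathbf Q$. *)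

theory Defs
  imports "HOL-Analysis.Analysis" "HOL-Homology.Homology"
begin

section \<open>The Lie algebra of \<open>Sp\<^sub>4\<close> and its strata\<close>

definition symplectic_form :: "complex^4^4"
  where "symplectic_form =
    (\<chi> i j. if (i, j) \<in> {(1, 3), (2, 4)} then 1
            else if (i, j) \<in> {(3, 1), (4, 2)} then -1 else 0)"

definition Sp4 :: "(complex^4^4) set"
  where "Sp4 = {g. transpose g ** symplectic_form ** g = symplectic_form}"

text \<open>The Lie algebra of a closed matrix group, as its tangent space at the identity.\<close>

definition lie_algebra_of :: "(complex^'n^'n) set \<Rightarrow> (complex^'n^'n) set"
  where "lie_algebra_of G =
    {X. \<exists>\<gamma>::real \<Rightarrow> complex^'n^'n.
          (\<forall>t. \<gamma> t \<in> G) \<and> \<gamma> 0 = mat 1 \<and> (\<gamma> has_vector_derivative X) (at 0)}"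

definition sp4 :: "(complex^4^4) set"
  where "sp4 = lie_algebra_of Sp4"

lemma bounded_bilinear_matrix_mult:
  "bounded_bilinear ((**) :: complex^'n^'m \<Rightarrow> complex^'k^'n \<Rightarrow> complex^'k^'m)"
proof -
  have "bilinear ((**) :: complex^'n^'m \<Rightarrow> complex^'k^'n \<Rightarrow> complex^'k^'m)"
    unfolding bilinear_def
    by (auto intro!: linearI simp: matrix_matrix_mult_def vec_eq_iff sum.distrib
        algebra_simps scaleR_sum_right)
  then show ?thesis
    by (simp add: bilinear_conv_bounded_bilinear)
qed

lemma linear_transpose: "linear (transpose :: complex^'n^'m \<Rightarrow> complex^'m^'n)"
  by (auto intro!: linearI simp: transpose_def vec_eq_iff)

lemma transpose_diff: "transpose (A - B :: complex^'n^'m) = transpose A - transpose B"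
  by (simp add: transpose_def vec_eq_iff)

lemma transpose_add: "transpose (A + B :: complex^'n^'m) = transpose A + transpose B"
  by (simp add: transpose_def vec_eq_iff)

lemma matrix_mult_scaleR_left: "(t *\<^sub>R A) ** B = t *\<^sub>R (A ** (B :: complex^'k^'n))"
  by (rule bounded_bilinear.scaleR_left [OF bounded_bilinear_matrix_mult])

lemma matrix_mult_scaleR_right: "(A :: complex^'n^'m) ** (t *\<^sub>R B) = t *\<^sub>R (A ** (B :: complex^'k^'n))"
  by (rule bounded_bilinear.scaleR_right [OF bounded_bilinear_matrix_mult])

lemmas matrix_mult_distribs =
  bounded_bilinear.add_left [OF bounded_bilinear_matrix_mult]
  bounded_bilinear.add_right [OF bounded_bilinear_matrix_mult]
  bounded_bilinear.diff_left [OF bounded_bilinear_matrix_mult]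
  bounded_bilinear.diff_right [OF bounded_bilinear_matrix_mult]

text \<open>The Cayley transform.\<close>

lemma cayley_curve:
  fixes X :: "complex^'n^'n"
  obtains \<gamma> e where "e > 0" "\<gamma> 0 = mat 1" "(\<gamma> has_vector_derivative X) (at 0)"
    "\<And>t. \<bar>t\<bar> < e \<Longrightarrow> \<exists>R. R ** (mat 1 - (t/2) *\<^sub>R X) = mat 1 \<and> (mat 1 - (t/2) *\<^sub>R X) ** R = mat 1
              \<and> \<gamma> t = (mat 1 + (t/2) *\<^sub>R X) ** R"
    "\<And>t. \<not> \<bar>t\<bar> < e \<Longrightarrow> \<gamma> t = mat 1"
proof -
  define A where "A t = mat 1 - (t/2) *\<^sub>R X" for t
  define B where "B t = mat 1 + (t/2) *\<^sub>R X" for t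
  obtain K where K: "K > 0" "\<And>(P :: complex^'n^'n) (Q :: complex^'n^'n). norm (P ** Q) \<le> norm P * norm Q * K"
    using bounded_bilinear.pos_bounded [OF bounded_bilinear_matrix_mult] by blast
  define c where "c = K * norm X + 1"
  have c: "c > 0" using K by (simp add: c_def add_nonneg_pos)
  define e where "e = 1 / c"
  have e: "e > 0" using c by (simp add: e_def)
  have half: "norm (((t/2) *\<^sub>R X) ** P) \<le> norm P / 2" if "\<bar>t\<bar> < e" for t and P :: "complex^'n^'n"
  proof -
    have "\<bar>t\<bar> * (K * norm X) \<le> \<bar>t\<bar> * c"
      unfolding c_def by (intro mult_left_mono) auto
    also have "\<dots> \<le> 1"
      using that c by (simp add: e_def field_simps)
    finally have 1: "\<bar>t\<bar> * (K * norm X) \<le> 1" .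
    have "norm (((t/2) *\<^sub>R X) ** P) \<le> norm ((t/2) *\<^sub>R X) * norm P * K" by (rule K(2))
    also have "\<dots> = (\<bar>t\<bar> * (K * norm X)) * (norm P / 2)" by simp
    also have "\<dots> \<le> 1 * (norm P / 2)" by (intro mult_right_mono 1) auto
    finally show ?thesis by simp
  qed
  have ex: "\<exists>R. R ** A t = mat 1 \<and> A t ** R = mat 1" if t: "\<bar>t\<bar> < e" for t
  proof -
    have "v = 0" if v: "A t *v v = 0" for v
    proof -
      define P :: "complex^'n^'n" where "P = (\<chi> i j. v $ i)"
      have "A t ** P = 0"
        using v by (simp add: P_def matrix_matrix_mult_def matrix_vector_mult_def vec_eq_iff)
      then have "P = ((t/2) *\<^sub>R X) ** P"
        by (simp add: A_def matrix_mult_distribs)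
      then have "norm P \<le> norm P / 2" using half [OF t, of P] by simp
      then have "P = 0" by simp
      then show "v = 0" by (simp add: P_def vec_eq_iff)
    qed
    then have "\<exists>R. R ** A t = mat 1"
      by (simp add: matrix_left_invertible_ker)
    then show ?thesis
      by (metis matrix_left_right_inverse)
  qed
  then obtain R where R: "\<And>t. \<bar>t\<bar> < e \<Longrightarrow> R t ** A t = mat 1 \<and> A t ** R t = mat 1"
    by metis
  define \<gamma> where "\<gamma> t = (if \<bar>t\<bar> < e then B t ** R t else mat 1)" for t
  have "R 0 = mat 1"
    using R [of 0] e by (simp add: A_def)
  then have \<gamma>0: "\<gamma> 0 = mat 1"
    using e by (simp add: \<gamma>_def B_def)
  define M where "M = norm (X ** X) * (2 * norm (mat 1 :: complex^'n^'n)) * K / 2"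
  have M: "M \<ge> 0" using K by (simp add: M_def)
  have est: "norm (\<gamma> t - mat 1 - t *\<^sub>R X) \<le> M * t\<^sup>2" if t: "\<bar>t\<bar> < e" for t
  proof -
    have "R t = mat 1 + ((t/2) *\<^sub>R X) ** R t"
      using R [OF t] by (simp add: A_def matrix_mult_distribs algebra_simps)
    then have "norm (R t) \<le> norm (mat 1 :: complex^'n^'n) + norm (R t) / 2"
      using half [OF t, of "R t"] norm_triangle_ineq [of "mat 1" "((t/2) *\<^sub>R X) ** R t"] by simp
    then have NR: "norm (R t) \<le> 2 * norm (mat 1 :: complex^'n^'n)" by simp
    have "\<gamma> t - mat 1 - t *\<^sub>R X = (B t - (mat 1 + t *\<^sub>R X) ** A t) ** R t"
      using R [OF t] t by (simp add: \<gamma>_def matrix_mult_distribs flip: matrix_mul_assoc)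
    also have "B t - (mat 1 + t *\<^sub>R X) ** A t = (t\<^sup>2 / 2) *\<^sub>R (X ** X)"
    proof -
      have "(mat 1 + t *\<^sub>R X) ** A t
          = mat 1 + (t *\<^sub>R X - (t/2) *\<^sub>R X) - (t\<^sup>2 / 2) *\<^sub>R (X ** X)"
        by (simp add: A_def matrix_mult_distribs matrix_mult_scaleR_left
            matrix_mult_scaleR_right power2_eq_square scaleR_right_distrib)
      also have "t *\<^sub>R X - (t/2) *\<^sub>R X = (t/2) *\<^sub>R X"
        by (simp flip: scaleR_diff_left)
      finally show ?thesis by (simp add: B_def)
    qed
    finally have "norm (\<gamma> t - mat 1 - t *\<^sub>R X) \<le> norm ((t\<^sup>2 / 2) *\<^sub>R (X ** X)) * norm (R t) * K"
      by (simp only: K(2))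
    also have "\<dots> \<le> norm ((t\<^sup>2 / 2) *\<^sub>R (X ** X)) * (2 * norm (mat 1 :: complex^'n^'n)) * K"
      using NR K by (intro mult_right_mono mult_left_mono) auto
    also have "\<dots> = M * t\<^sup>2" by (simp add: M_def)
    finally show ?thesis .
  qed
  have "(\<gamma> has_vector_derivative X) (at 0)"
    unfolding has_vector_derivative_def has_derivative_at_alt
  proof (intro conjI allI impI)
    show "bounded_linear (\<lambda>x. x *\<^sub>R X)" by (rule bounded_linear_scaleR_left)
    fix d :: real assume d: "d > 0"
    define s where "s = min e (d / (M + 1))"
    have s: "s > 0" using e d M by (simp add: s_def)
    have "norm (\<gamma> y - \<gamma> 0 - (y - 0) *\<^sub>R X) \<le> d * norm (y - 0)" if y: "norm (y - 0) < s" for y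
    proof -
      have "norm (\<gamma> y - mat 1 - y *\<^sub>R X) \<le> M * y\<^sup>2"
        using y by (intro est) (simp add: s_def)
      also have "\<dots> = (M * \<bar>y\<bar>) * \<bar>y\<bar>" by (simp add: power2_eq_square)
      also have "\<dots> \<le> d * \<bar>y\<bar>"
      proof (rule mult_right_mono)
        have "M * \<bar>y\<bar> \<le> (M + 1) * (d / (M + 1))"
          using y M d by (intro mult_mono) (auto simp: s_def)
        then show "M * \<bar>y\<bar> \<le> d" using M by simp
      qed simp
      finally show ?thesis by (simp add: \<gamma>0)
    qed
    then show "\<exists>s>0. \<forall>y. norm (y - 0) < s \<longrightarrow> norm (\<gamma> y - \<gamma> 0 - (y - 0) *\<^sub>R X) \<le> d * norm (y - 0)"
      using s by blast
  qed
  show thesis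
  proof (rule that [of e \<gamma>])
    fix t assume t: "\<bar>t\<bar> < e"
    show "\<exists>R. R ** (mat 1 - (t/2) *\<^sub>R X) = mat 1 \<and> (mat 1 - (t/2) *\<^sub>R X) ** R = mat 1
            \<and> \<gamma> t = (mat 1 + (t/2) *\<^sub>R X) ** R"
      using R [OF t] t by (intro exI [of _ "R t"]) (simp add: \<gamma>_def A_def B_def)
  next
    fix t assume "\<not> \<bar>t\<bar> < e"
    then show "\<gamma> t = mat 1" by (simp add: \<gamma>_def)
  qed fact+
qed

lemma sp4_eq:
  "sp4 = {X. transpose X ** symplectic_form + symplectic_form ** X = 0}"
proof (intro equalityI subsetI)
  let ?J = symplectic_form
  fix X assume "X \<in> sp4"
  then obtain \<gamma> where \<gamma>: "\<And>t::real. \<gamma> t \<in> Sp4" "\<gamma> 0 = mat 1" "(\<gamma> has_vector_derivative X) (at 0)"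
    unfolding sp4_def lie_algebra_of_def by blast
  note mult = bounded_bilinear.has_vector_derivative [OF bounded_bilinear_matrix_mult]
  have "((\<lambda>t. transpose (\<gamma> t)) has_vector_derivative transpose X) (at 0)"
    using bounded_linear.has_vector_derivative [OF _ \<gamma>(3)] linear_transpose
    by (simp add: linear_conv_bounded_linear)
  from mult [OF mult [OF this has_vector_derivative_const [of ?J]] \<gamma>(3)]
  have "((\<lambda>t. transpose (\<gamma> t) ** ?J ** \<gamma> t) has_vector_derivative
      transpose X ** ?J + ?J ** X) (at 0)"
    by (simp add: \<gamma>(2) transpose_mat add.commute)
  moreover have "(\<lambda>t. transpose (\<gamma> t) ** ?J ** \<gamma> t) = (\<lambda>t. ?J)"
    using \<gamma>(1) by (auto simp: Sp4_def)
  ultimately have "((\<lambda>t::real. ?J) has_vector_derivative transpose X ** ?J + ?J ** X) (at 0)"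
    by simp
  then show "X \<in> {X. transpose X ** ?J + ?J ** X = 0}"
    using vector_derivative_unique_at [OF _ has_vector_derivative_const] by simp
next
  let ?J = symplectic_form
  fix X assume "X \<in> {X. transpose X ** ?J + ?J ** X = 0}"
  then have X: "transpose X ** ?J = - (?J ** X)"
    by (simp add: eq_neg_iff_add_eq_0)
  obtain \<gamma> e where \<gamma>: "e > 0" "\<gamma> 0 = mat 1" "(\<gamma> has_vector_derivative X) (at 0)"
    "\<And>t. \<bar>t\<bar> < e \<Longrightarrow> \<exists>R. R ** (mat 1 - (t/2) *\<^sub>R X) = mat 1 \<and> (mat 1 - (t/2) *\<^sub>R X) ** R = mat 1
              \<and> \<gamma> t = (mat 1 + (t/2) *\<^sub>R X) ** R"
    "\<And>t. \<not> \<bar>t\<bar> < e \<Longrightarrow> \<gamma> t = mat 1"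
    using cayley_curve [of X] by metis
  have "\<gamma> t \<in> Sp4" for t
  proof (cases "\<bar>t\<bar> < e")
    case True
    define A where "A = mat 1 - (t/2) *\<^sub>R X"
    define B where "B = mat 1 + (t/2) *\<^sub>R X"
    obtain R where R: "R ** A = mat 1" "A ** R = mat 1" "\<gamma> t = B ** R"
      using \<gamma>(4) [OF True] unfolding A_def B_def by blast
    have tr: "transpose ((t/2) *\<^sub>R X) = (t/2) *\<^sub>R transpose X"
      by (simp add: transpose_def vec_eq_iff)
    have BJ: "transpose B ** ?J = ?J ** A"
      by (simp add: A_def B_def transpose_add transpose_mat tr matrix_mult_distribs
          matrix_mult_scaleR_left matrix_mult_scaleR_right X)
    have AJ: "transpose A ** ?J = ?J ** B"
      by (simp add: A_def B_def transpose_diff transpose_mat tr matrix_mult_distribs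
          matrix_mult_scaleR_left matrix_mult_scaleR_right X)
    have AB: "A ** B = B ** A"
      by (simp add: A_def B_def matrix_mult_distribs)
    have "transpose (\<gamma> t) ** ?J ** \<gamma> t = transpose R ** (transpose B ** ?J) ** B ** R"
      by (simp add: R(3) matrix_transpose_mul matrix_mul_assoc)
    also have "\<dots> = transpose R ** ?J ** (A ** B) ** R"
      by (simp add: BJ matrix_mul_assoc)
    also have "\<dots> = transpose R ** (?J ** B) ** (A ** R)"
      by (simp add: AB matrix_mul_assoc)
    also have "\<dots> = transpose R ** (transpose A ** ?J)"
      by (simp add: R(2) AJ)
    also have "\<dots> = transpose (A ** R) ** ?J"
      by (simp add: matrix_transpose_mul matrix_mul_assoc)
    also have "\<dots> = ?J" by (simp add: R(2) transpose_mat)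
    finally show ?thesis by (simp add: Sp4_def)
  next
    case False
    then show ?thesis by (simp add: \<gamma>(5) Sp4_def transpose_mat)
  qed
  then show "X \<in> sp4"
    unfolding sp4_def lie_algebra_of_def using \<gamma>(2,3) by blast
qed

text \<open>
  Scalar multiplication of matrices by complex numbers; the operator \<open>*s\<close> is not usable
  here, since on a nested vector type it does not take complex scalars.
\<close>

definition cmat_scale :: "complex \<Rightarrow> complex^'n^'m \<Rightarrow> complex^'n^'m"
  where "cmat_scale c = map_matrix ((*) c)"

interpretation cmat: vector_space "cmat_scale :: complex \<Rightarrow> complex^'n^'m \<Rightarrow> complex^'n^'m"
  by unfold_locales (auto simp: cmat_scale_def vec_eq_iff algebra_simps)

definition centralizer_in :: "(complex^'n^'n) set \<Rightarrow> complex^'n^'n \<Rightarrow> (complex^'n^'n) set"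
  where "centralizer_in \<gg> \<xi> = {Y \<in> \<gg>. \<xi> ** Y - Y ** \<xi> = 0}"

definition sp4_stratum :: "int \<Rightarrow> (complex^4^4) set"
  where "sp4_stratum d = {\<xi> \<in> sp4. int (cmat.dim (centralizer_in sp4 \<xi>)) = 10 - d}"


section \<open>Zariski topology, irreducible components, dimension\<close>

inductive_set polynomial_functions :: "(complex^'n^'m \<Rightarrow> complex) set"
  where
    const: "(\<lambda>_. c) \<in> polynomial_functions"
  | entry: "(\<lambda>A. A $ i $ j) \<in> polynomial_functions"
  | add: "f \<in> polynomial_functions \<Longrightarrow> g \<in> polynomial_functions \<Longrightarrow>
            (\<lambda>A. f A + g A) \<in> polynomial_functions"
  | mult: "f \<in> polynomial_functions \<Longrightarrow> g \<in> polynomial_functions \<Longrightarrow>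
            (\<lambda>A. f A * g A) \<in> polynomial_functions"

definition zero_locus :: "(complex^'n^'m \<Rightarrow> complex) set \<Rightarrow> (complex^'n^'m) set"
  where "zero_locus P = {A. \<forall>f\<in>P. f A = 0}"

text \<open>
  The Zariski topology on the affine space of all matrices. A linear subspace, or more generally
  any subset, carries the induced topology.
\<close>

definition zariski :: "(complex^'n^'m) topology"
  where "zariski = topology (\<lambda>U. \<exists>P\<subseteq>polynomial_functions. U = - zero_locus P)"

lemma zero_locus_products:
  "zero_locus ((\<lambda>(f, g) A. f A * g A) ` (P \<times> Q)) = zero_locus P \<union> zero_locus Q"
proof (rule Set.set_eqI)
  fix A
  have "A \<in> zero_locus ((\<lambda>(f, g) A. f A * g A) ` (P \<times> Q)) \<longleftrightarrow> (\<forall>f\<in>P. \<forall>g\<in>Q. f A * g A = 0)"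
    by (simp add: zero_locus_def)
  also have "\<dots> \<longleftrightarrow> (\<forall>f\<in>P. f A = 0) \<or> (\<forall>g\<in>Q. g A = 0)"
    unfolding mult_eq_0_iff by blast
  finally show "A \<in> zero_locus ((\<lambda>(f, g) A. f A * g A) ` (P \<times> Q)) \<longleftrightarrow> A \<in> zero_locus P \<union> zero_locus Q"
    by (simp add: zero_locus_def)
qed

lemma zero_locus_UN: "zero_locus (\<Union>i\<in>I. F i) = (\<Inter>i\<in>I. zero_locus (F i))"
  by (auto simp add: zero_locus_def)

lemma istopology_zariski:
  "istopology (\<lambda>U. \<exists>P\<subseteq>polynomial_functions. U = - zero_locus (P :: (complex^'n^'m \<Rightarrow> complex) set))"
  unfolding istopology_def
proof (intro conjI allI impI)
  fix S T :: "(complex^'n^'m) set"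
  assume "\<exists>P\<subseteq>polynomial_functions. S = - zero_locus P"
    and "\<exists>P\<subseteq>polynomial_functions. T = - zero_locus P"
  then obtain P Q where PQ: "P \<subseteq> polynomial_functions" "Q \<subseteq> polynomial_functions"
    and ST: "S = - zero_locus P" "T = - zero_locus Q"
    by (elim exE conjE)
  let ?R = "(\<lambda>(f, g) A. f A * g A) ` (P \<times> Q)"
  have "?R \<subseteq> polynomial_functions"
  proof (rule image_subsetI)
    fix x assume "x \<in> P \<times> Q"
    then have "fst x \<in> polynomial_functions" "snd x \<in> polynomial_functions"
      using PQ by (auto simp: subset_iff)
    then have "(\<lambda>A. fst x A * snd x A) \<in> polynomial_functions"
      by (rule polynomial_functions.mult)
    then show "(case x of (f, g) \<Rightarrow> \<lambda>A. f A * g A) \<in> polynomial_functions"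
      by (simp add: split_beta)
  qed
  moreover have "S \<inter> T = - zero_locus ?R"
    by (simp only: ST zero_locus_products Compl_Un)
  ultimately show "\<exists>P\<subseteq>polynomial_functions. S \<inter> T = - zero_locus P"
    by (intro exI [of _ ?R] conjI)
next
  fix \<K> :: "(complex^'n^'m) set set"
  assume "\<forall>K\<in>\<K>. \<exists>P\<subseteq>polynomial_functions. K = - zero_locus P"
  then obtain F where F: "\<forall>K\<in>\<K>. F K \<subseteq> polynomial_functions \<and> K = - zero_locus (F K)"
    by (rule bchoice [THEN exE])
  have "(\<Union>K\<in>\<K>. F K) \<subseteq> polynomial_functions"
    using F by (intro UN_least) simp
  moreover have "\<Union>\<K> = (\<Union>K\<in>\<K>. - zero_locus (F K))"
    using F by (metis (no_types, lifting) SUP_cong image_ident)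
  then have "\<Union>\<K> = - zero_locus (\<Union>K\<in>\<K>. F K)"
    by (simp only: zero_locus_UN Compl_INT)
  ultimately show "\<exists>P\<subseteq>polynomial_functions. \<Union>\<K> = - zero_locus P"
    by (intro exI [of _ "\<Union>K\<in>\<K>. F K"] conjI)
qed

lemma openin_zariski:
  "openin zariski U \<longleftrightarrow> (\<exists>P\<subseteq>polynomial_functions. U = - zero_locus P)"
  unfolding zariski_def by (simp add: topology_inverse' [OF istopology_zariski])

lemma topspace_zariski [simp]: "topspace zariski = UNIV"
proof -
  have "UNIV = - zero_locus {\<lambda>_. 1}"
    by (simp add: zero_locus_def)
  then have "openin zariski UNIV"
    unfolding openin_zariski using polynomial_functions.const by blast
  then show ?thesis
    using openin_subset by blast
qed

lemma closedin_zariski: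
  "closedin zariski C \<longleftrightarrow> (\<exists>P\<subseteq>polynomial_functions. C = zero_locus P)"
  by (simp add: closedin_def openin_zariski flip: Compl_eq_Diff_UNIV)

definition locally_closedin :: "'a topology \<Rightarrow> 'a set \<Rightarrow> bool"
  where "locally_closedin T S \<longleftrightarrow> (\<exists>U C. openin T U \<and> closedin T C \<and> S = U \<inter> C)"

definition irreducible_space :: "'a topology \<Rightarrow> bool"
  where "irreducible_space T \<longleftrightarrow> topspace T \<noteq> {} \<and>
    (\<forall>A B. closedin T A \<and> closedin T B \<and> A \<union> B = topspace T \<longrightarrow>
           A = topspace T \<or> B = topspace T)"

definition irreducible_components_of :: "'a topology \<Rightarrow> 'a set set"
  where "irreducible_components_of T =
    {C. C \<subseteq> topspace T \<and> irreducible_space (subtopology T C) \<and>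
        (\<forall>D. C \<subseteq> D \<and> D \<subseteq> topspace T \<and> irreducible_space (subtopology T D) \<longrightarrow> D = C)}"

text \<open>Krull dimension: the supremum of the lengths of chains of irreducible closed subsets.\<close>

definition krull_dim :: "'a topology \<Rightarrow> enat"
  where "krull_dim T =
    Sup {enat n |n. \<exists>Z::nat \<Rightarrow> 'a set.
            (\<forall>i\<le>n. closedin T (Z i) \<and> irreducible_space (subtopology T (Z i))) \<and>
            (\<forall>i<n. Z i \<subset> Z (Suc i))}"


section \<open>Singular homology with rational coefficients\<close>

text \<open>
  The constructions of \<^theory>\<open>HOL-Homology.Simplices\<close> and
  \<^theory>\<open>HOL-Homology.Homology_Groups\<close>, which have integer coefficients, are repeated here
  for chains with rational coefficients.
\<close>

type_synonym 'a rat_chain = "((nat \<Rightarrow> real) \<Rightarrow> 'a) \<Rightarrow>\<^sub>0 rat"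

definition rat_singular_chain :: "nat \<Rightarrow> 'a topology \<Rightarrow> 'a rat_chain \<Rightarrow> bool"
  where "rat_singular_chain p X c \<longleftrightarrow> Poly_Mapping.keys c \<subseteq> singular_simplex_set p X"

definition rat_chain_boundary :: "nat \<Rightarrow> 'a rat_chain \<Rightarrow> 'a rat_chain"
  where "rat_chain_boundary p c =
    (if p = 0 then 0
     else \<Sum>f\<in>Poly_Mapping.keys c. \<Sum>k\<le>p.
            Poly_Mapping.single (singular_face p k f) ((-1) ^ k * Poly_Mapping.lookup c f))"

definition rat_singular_relcycle :: "nat \<Rightarrow> 'a topology \<Rightarrow> 'a set \<Rightarrow> 'a rat_chain \<Rightarrow> bool"
  where "rat_singular_relcycle p X S c \<longleftrightarrow>
    rat_singular_chain p X c \<and>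
    rat_singular_chain (p - 1) (subtopology X S) (rat_chain_boundary p c)"

definition rat_singular_relboundary :: "nat \<Rightarrow> 'a topology \<Rightarrow> 'a set \<Rightarrow> 'a rat_chain \<Rightarrow> bool"
  where "rat_singular_relboundary p X S c \<longleftrightarrow>
    (\<exists>d. rat_singular_chain (Suc p) X d \<and>
         rat_singular_chain p (subtopology X S) (rat_chain_boundary (Suc p) d - c))"

definition rat_relcycle_group :: "nat \<Rightarrow> 'a topology \<Rightarrow> 'a set \<Rightarrow> 'a rat_chain monoid"
  where "rat_relcycle_group p X S =
    \<lparr>carrier = Collect (rat_singular_relcycle p X S), monoid.mult = (+), one = 0\<rparr>"

definition rat_relative_homology_group ::
    "nat \<Rightarrow> 'a topology \<Rightarrow> 'a set \<Rightarrow> 'a rat_chain set monoid"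
  where "rat_relative_homology_group p X S =
    rat_relcycle_group p X S Mod Collect (rat_singular_relboundary p X S)"

definition rat_additive_group :: "rat monoid"
  where "rat_additive_group = \<lparr>carrier = UNIV, monoid.mult = (+), one = 0\<rparr>"


section \<open>Rational homology manifolds\<close>

text \<open>
  For an irreducible locally closed subvariety of affine space. The dimension is taken in the
  Zariski topology, homology in the classical one. Isomorphy is that of abelian groups, which
  is no weaker than \<open>\<rat>\<close>-linear isomorphy: additive maps between rational vector spaces are
  \<open>\<rat>\<close>-linear.
\<close>

definition rational_homology_manifold :: "(complex^'n^'m) set \<Rightarrow> bool"
  where "rational_homology_manifold X \<longleftrightarrow>
    locally_closedin zariski X \<and> irreducible_space (subtopology zariski X) \<and>
    (\<exists>n. krull_dim (subtopology zariski X) = enat n \<and>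
      (\<forall>x\<in>X. \<forall>i.
        if i = 2 * n
        then rat_relative_homology_group i (top_of_set X) (X - {x}) \<cong> rat_additive_group
        else trivial_group (rat_relative_homology_group i (top_of_set X) (X - {x}))))"

end

theory Submission
  imports Defs "HOL-Computational_Algebra.Fundamental_Theorem_Algebra"
begin

text \<open>
  An \<open>X \<in> sp\<^sub>4\<close> has an even characteristic polynomial \<open>(t\<^sup>2 - m)\<^sup>2 - q\<close>, and \<open>(X\<^sup>2 - m)\<^sup>2 = q\<close>. It is
  regular, with centralizer of dimension 2, unless \<open>X\<^sup>2 = m\<close> or \<open>X\<^sup>3 = 2 m X\<close>; so the two strata
  together are the union of the following two cones without their vertex.

  \<open>X\<^sup>3 = 2 m X\<close> says that all \<open>3 \<times> 3\<close> minors of the symmetric matrix \<open>J X\<close> vanish, that is,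
  \<open>J X\<close> is a product \<open>u v\<close> of two linear forms. Splitting off a square, this cone is locally a product of an affine
  space and the cone of squares \<open>w\<^sup>2\<close>, which is \<open>\<complex>\<^sup>3 / \<plusminus>1\<close>. The transfer of the double covering shows
  that this quotient has the rational homology of \<open>\<complex>\<^sup>3\<close> at its vertex.

  \<open>X\<^sup>2 = m\<close> becomes, under the isomorphism of \<open>sp\<^sub>4\<close> with \<open>so\<^sub>5\<close>, the condition that a bivector of \<open>\<complex>\<^sup>5\<close> is
  decomposable, and the nonzero decomposable bivectors are a complex manifold.

  Both cones are irreducible, since any two points are joined by a rational curve, and
  have dimension 7.
\<close>

section \<open>Local homology up to torsion\<close>

text \<open>The transfer of a double covering inverts the projection only up to multiplication by 2.
  Local homology is therefore followed in integral homology up to torsion, through two invariants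
  that survive such maps, torsion and rank one; rational coefficients enter once, by clearing the
  denominators of finite chains. The definition of a rational homology manifold ties the degree
  \<open>2 * n\<close> of the nonzero local homology to the Krull dimension \<open>n\<close>, so the
  number 7 has to be found twice and independently: topologically from charts, of real dimensions
  \<open>4 * 4 - 2\<close> and \<open>4 * 5 - 6\<close>, and algebraically from an explicit chain of
  irreducible sets and a count of monomials in a parametrization by seven coordinates. For the
  strata, a centralizer is moved to the symmetric matrices, where its dimension depends only on the
  Jordan form of \<open>X\<close>. Each element of the cones has one of four normal forms, with
  dimension 4 or 6; the other elements have dimension at most 2 or, for \<open>0\<close>, 10. As
  each cone is irreducible and closed in the union, every irreducible component is one of
  them.\<close>

definition torsion_group :: "('a,'b) monoid_scheme \<Rightarrow> bool" where
  "torsion_group G \<longleftrightarrow> (\<forall>x\<in>carrier G. \<exists>n>0. x [^]\<^bsub>G\<^esub> (n::nat) = \<one>\<^bsub>G\<^esub>)"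

text \<open>The image of \<open>\<phi>\<close> is a nonzero subgroup of the integers and its kernel
  is torsion, so that tensoring an abelian \<open>G\<close> with the rationals leaves a single copy
  of them. This asks for more than rank one: the rationals themselves have no nonzero homomorphism
  to the integers.\<close>

definition rank_one_group :: "('a,'b) monoid_scheme \<Rightarrow> bool" where
  "rank_one_group G \<longleftrightarrow> (\<exists>\<phi>\<in>hom G integer_group. (\<exists>x\<in>carrier G. \<phi> x \<noteq> 0) \<and>
     (\<forall>x\<in>carrier G. \<phi> x = 0 \<longrightarrow> (\<exists>n>0. x [^]\<^bsub>G\<^esub> (n::nat) = \<one>\<^bsub>G\<^esub>)))"

lemma hom_nat_pow_integer:
  assumes "\<phi> \<in> hom G integer_group" "group G" "x \<in> carrier G"
  shows "\<phi> (x [^]\<^bsub>G\<^esub> (n::nat)) = int n * \<phi> x"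
proof -
  interpret group_hom G integer_group \<phi>
    using assms by (simp add: group_hom_def group_hom_axioms_def)
  show ?thesis using hom_nat_pow[OF assms(3), of n] by (simp add: mult.commute)
qed

text \<open>Kernel and cokernel are killed by 2, so \<open>f\<close> becomes an isomorphism once 2
  is inverted. This is exactly what the transfer of a double covering provides.\<close>

locale quasi_iso =
  fixes G :: "('a,'b) monoid_scheme" and H :: "('c,'d) monoid_scheme" and f
  assumes G: "comm_group G" and H: "comm_group H" and f: "f \<in> hom G H"
    and ker: "\<And>a. a \<in> carrier G \<Longrightarrow> f a = \<one>\<^bsub>H\<^esub> \<Longrightarrow> a [^]\<^bsub>G\<^esub> (2::nat) = \<one>\<^bsub>G\<^esub>"
    and coker: "\<And>b. b \<in> carrier H \<Longrightarrow> \<exists>a\<in>carrier G. f a = b [^]\<^bsub>H\<^esub> (2::nat)"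
begin

interpretation G: comm_group G by (rule G)
interpretation H: comm_group H by (rule H)
interpretation group_hom G H f by unfold_locales (rule f)

lemma torsion_group: assumes "torsion_group G" shows "torsion_group H"
  unfolding torsion_group_def
proof
  fix b assume b: "b \<in> carrier H"
  obtain a where a: "a \<in> carrier G" "f a = b [^]\<^bsub>H\<^esub> (2::nat)" using coker[OF b] by blast
  obtain n where n: "n > 0" "a [^]\<^bsub>G\<^esub> (n::nat) = \<one>\<^bsub>G\<^esub>"
    using assms a unfolding torsion_group_def by blast
  have "b [^]\<^bsub>H\<^esub> (2*n) = f (a [^]\<^bsub>G\<^esub> n)"
    using a b by (simp add: hom_nat_pow H.nat_pow_pow)
  with n show "\<exists>n>0. b [^]\<^bsub>H\<^esub> (n::nat) = \<one>\<^bsub>H\<^esub>"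
    by (intro exI[of _ "2*n"]) auto
qed

text \<open>As \<open>f\<close> need not be invertible, \<open>\<phi>\<close> is carried over by
  sending \<open>b\<close> to \<open>\<phi> a\<close> for any \<open>a\<close> over the double of
  \<open>b\<close>. The choice of \<open>a\<close> does not matter, because the kernel of
  \<open>f\<close> is 2-torsion and the integers are torsion-free. On the image of \<open>f\<close>
  the new map is twice \<open>\<phi>\<close>, so it is nonzero.\<close>

lemma rank_one_group: assumes "rank_one_group G" shows "rank_one_group H"
proof -
  obtain \<phi> where \<phi>: "\<phi> \<in> hom G integer_group" and nz: "\<exists>x\<in>carrier G. \<phi> x \<noteq> 0"
    and tor: "\<And>x. x \<in> carrier G \<Longrightarrow> \<phi> x = 0 \<Longrightarrow> (\<exists>n>0. x [^]\<^bsub>G\<^esub> (n::nat) = \<one>\<^bsub>G\<^esub>)"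
    using assms unfolding rank_one_group_def by blast
  interpret phi: group_hom G integer_group \<phi>
    using \<phi> by (simp add: group_hom_def group_hom_axioms_def)
  have ker0: "\<phi> a = 0" if "a \<in> carrier G" "f a = \<one>\<^bsub>H\<^esub>" for a
    using hom_nat_pow_integer[OF \<phi> G.is_group that(1), of 2] ker[OF that] phi.hom_one by simp
  have same: "\<phi> a = \<phi> a'" if "a \<in> carrier G" "a' \<in> carrier G" "f a = f a'" for a a'
  proof -
    have "\<phi> (a \<otimes>\<^bsub>G\<^esub> inv\<^bsub>G\<^esub> a') = 0" by (rule ker0) (use that in auto)
    then show ?thesis using that by simp
  qed
  define s where "s b = (SOME a. a \<in> carrier G \<and> f a = b [^]\<^bsub>H\<^esub> (2::nat))" for b
  have s: "s b \<in> carrier G" "f (s b) = b [^]\<^bsub>H\<^esub> (2::nat)" if "b \<in> carrier H" for b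
    using someI_ex[of "\<lambda>a. a \<in> carrier G \<and> f a = b [^]\<^bsub>H\<^esub> (2::nat)"] coker[OF that]
    unfolding s_def by blast+
  define \<psi> where "\<psi> b = \<phi> (s b)" for b
  have \<psi>: "\<psi> b = \<phi> a" if "b \<in> carrier H" "a \<in> carrier G" "f a = b [^]\<^bsub>H\<^esub> (2::nat)" for a b
    unfolding \<psi>_def using s[OF that(1)] that by (intro same) auto
  have "\<psi> \<in> hom H integer_group"
  proof (rule homI)
    fix x y assume xy: "x \<in> carrier H" "y \<in> carrier H"
    have "\<psi> (x \<otimes>\<^bsub>H\<^esub> y) = \<phi> (s x \<otimes>\<^bsub>G\<^esub> s y)"
      using xy s by (intro \<psi>) (auto simp: H.nat_pow_distrib)
    then show "\<psi> (x \<otimes>\<^bsub>H\<^esub> y) = \<psi> x \<otimes>\<^bsub>integer_group\<^esub> \<psi> y"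
      using s xy by (simp add: \<psi>_def)
  qed auto
  moreover have "\<exists>x\<in>carrier H. \<psi> x \<noteq> 0"
  proof -
    obtain a where a: "a \<in> carrier G" "\<phi> a \<noteq> 0" using nz by blast
    have "\<psi> (f a) = \<phi> (a [^]\<^bsub>G\<^esub> (2::nat))"
      using a by (intro \<psi>) (auto simp: hom_nat_pow)
    with a hom_nat_pow_integer[OF \<phi> G.is_group a(1), of 2] show ?thesis
      by (intro bexI[of _ "f a"]) auto
  qed
  moreover have "\<exists>n>0. b [^]\<^bsub>H\<^esub> (n::nat) = \<one>\<^bsub>H\<^esub>" if b: "b \<in> carrier H" "\<psi> b = 0" for b
  proof -
    obtain n where n: "n > 0" "s b [^]\<^bsub>G\<^esub> (n::nat) = \<one>\<^bsub>G\<^esub>"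
      using tor[of "s b"] s b by (auto simp: \<psi>_def)
    have "b [^]\<^bsub>H\<^esub> (2*n) = f (s b [^]\<^bsub>G\<^esub> n)"
      using s b by (simp add: hom_nat_pow H.nat_pow_pow)
    with n show ?thesis by (intro exI[of _ "2*n"]) auto
  qed
  ultimately show ?thesis unfolding rank_one_group_def by blast
qed

end

lemma iso_quasi_iso:
  assumes "comm_group G" "comm_group H" "f \<in> iso G H"
  shows "quasi_iso G H f"
proof -
  interpret G: comm_group G by fact
  interpret H: comm_group H by fact
  interpret group_hom G H f
    using assms(3) by unfold_locales (auto simp: iso_def)
  show ?thesis
  proof
    show "f \<in> hom G H" using assms by (auto simp: iso_def)
    fix a assume "a \<in> carrier G" "f a = \<one>\<^bsub>H\<^esub>"
    then show "a [^]\<^bsub>G\<^esub> (2::nat) = \<one>\<^bsub>G\<^esub>"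
      using assms(3) hom_one by (auto simp: iso_def bij_betw_def dest: inj_onD[where y = "\<one>\<^bsub>G\<^esub>"])
  next
    fix b assume "b \<in> carrier H"
    then have "b [^]\<^bsub>H\<^esub> (2::nat) \<in> f ` carrier G"
      using assms(3) by (simp add: iso_def bij_betw_def)
    then show "\<exists>a\<in>carrier G. f a = b [^]\<^bsub>H\<^esub> (2::nat)" by fastforce
  qed
qed

text \<open>The local homology of a rational homology manifold, stated in terms of the integral homology of the library;
  \<open>rat_homology_trivial\<close> and \<open>rat_homology_rank_one\<close> pass to rational coefficients.\<close>

definition local_rank :: "'a::topological_space set \<Rightarrow> 'a \<Rightarrow> nat \<Rightarrow> bool" where
  "local_rank S x n \<longleftrightarrow> (\<forall>i::nat.
     if i = n then rank_one_group (relative_homology_group (int i) (top_of_set S) (S - {x}))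
     else torsion_group (relative_homology_group (int i) (top_of_set S) (S - {x})))"

section \<open>Invariance of the local homology\<close>

lemma rank_transport:
  assumes "comm_group G" "comm_group H" "G \<cong> H"
  shows torsion_group_iso: "torsion_group G \<Longrightarrow> torsion_group H"
    and rank_one_group_iso: "rank_one_group G \<Longrightarrow> rank_one_group H"
proof -
  obtain f where f: "f \<in> iso G H" using assms(3) unfolding is_iso_def by blast
  note q = iso_quasi_iso[OF assms(1,2) f]
  show "torsion_group H" if "torsion_group G" using quasi_iso.torsion_group[OF q that] .
  show "rank_one_group H" if "rank_one_group G" using quasi_iso.rank_one_group[OF q that] .
qed

text \<open>The case \<open>k = 0\<close> serves changes of space, \<open>k = 1\<close> serves
  products with a line. For \<open>i < k\<close> the degree on the left is negative, and the group
  there is trivial, hence torsion.\<close>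

lemma local_rank_shift:
  assumes "local_rank S x n"
    and "\<And>i. relative_homology_group (int i - int k) (top_of_set S) (S - {x}) \<cong>
           relative_homology_group (int i) (top_of_set T) (T - {y})"
  shows "local_rank T y (n + k)"
  unfolding local_rank_def
proof (intro allI)
  fix i :: nat
  let ?G = "relative_homology_group (int i - int k) (top_of_set S) (S - {x})"
  let ?H = "relative_homology_group (int i) (top_of_set T) (T - {y})"
  note tr = rank_transport[OF abelian_relative_homology_group abelian_relative_homology_group assms(2)[of i]]
  show "if i = n + k then rank_one_group ?H else torsion_group ?H"
  proof (cases "i < k")
    case True
    then have "trivial_group ?G" by simp
    then have "torsion_group ?G"
      unfolding torsion_group_def trivial_group_def by (metis group.is_monoid monoid.nat_pow_one singletonD zero_less_one)
    with tr True show ?thesis by auto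
  next
    case False
    then obtain j where j: "i = j + k" by (metis le_Suc_ex add.commute not_less)
    with assms(1) have "if i = n + k then rank_one_group ?G else torsion_group ?G"
      by (auto simp: local_rank_def)
    with tr show ?thesis by auto
  qed
qed

lemma local_rank_homeomorphism:
  assumes "local_rank S x n" "homeomorphism S T f g" "x \<in> S" "f x = y"
  shows "local_rank T y n"
proof -
  have "homeomorphic_map (top_of_set S) (top_of_set T) f"
    unfolding homeomorphic_map_maps homeomorphic_maps_def
    using assms(2) by (intro exI[of _ g]) (auto simp: homeomorphism_def)
  moreover have "f ` (S - {x}) = T - {y}"
  proof -
    have "inj_on f S" "f ` S = T" using assms(2) by (auto simp: homeomorphism_def intro: inj_on_inverseI)
    then show ?thesis using assms(3,4) by (simp add: inj_on_image_set_diff)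
  qed
  ultimately have "hom_induced i (top_of_set S) (S - {x}) (top_of_set T) (T - {y}) f \<in>
     iso (relative_homology_group i (top_of_set S) (S - {x})) (relative_homology_group i (top_of_set T) (T - {y}))" for i
    by (intro homeomorphic_map_relative_homology_iso) auto
  then have "\<And>i. relative_homology_group (int i - int 0) (top_of_set S) (S - {x}) \<cong>
           relative_homology_group (int i) (top_of_set T) (T - {y})"
    by (auto simp: is_iso_def)
  from local_rank_shift[OF assms(1) this] show ?thesis by simp
qed

text \<open>Excision of \<open>S - U\<close>: this set is closed and lies in \<open>S - {x}\<close>,
  which is open because points are closed.\<close>

lemma local_homology_openin:
  fixes S :: "'a::t1_space set"
  assumes "openin (top_of_set S) U" "x \<in> U"
  shows "relative_homology_group i (top_of_set U) (U - {x}) \<cong> relative_homology_group i (top_of_set S) (S - {x})"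
proof -
  have US: "U \<subseteq> S" using assms(1) openin_imp_subset by blast
  have cl: "top_of_set S closure_of (S - U) = S - U"
    using assms(1) by (intro closure_of_closedin) (simp add: closedin_diff)
  have "openin (top_of_set S) (S - {x})"
    by (simp add: openin_delete)
  then have int: "top_of_set S interior_of (S - {x}) = S - {x}"
    by (simp add: interior_of_openin)
  have e: "S - (S - U) = U" "S - {x} - (S - U) = U - {x}" "S \<inter> U = U" using US by auto
  show ?thesis
  proof (rule is_isoI)
    have "hom_induced i (subtopology (top_of_set S) (S - (S - U))) ((S - {x}) - (S - U)) (subtopology (top_of_set S) S) (S - {x}) id
      \<in> iso (relative_homology_group i (subtopology (top_of_set S) (S - (S - U))) ((S - {x}) - (S - U)))
          (relative_homology_group i (subtopology (top_of_set S) S) (S - {x}))"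
      by (rule homology_excision_axiom) (use assms(2) cl int in auto)
    then show "hom_induced i (top_of_set U) (U - {x}) (top_of_set S) (S - {x}) id
      \<in> iso (relative_homology_group i (top_of_set U) (U - {x})) (relative_homology_group i (top_of_set S) (S - {x}))"
      by (simp add: e subtopology_subtopology)
  qed
qed

lemma local_rank_openin_iff:
  fixes S :: "'a::t1_space set"
  assumes "openin (top_of_set S) U" "x \<in> U"
  shows "local_rank U x n \<longleftrightarrow> local_rank S x n"
  using local_homology_openin[OF assms] local_rank_shift[of U x n 0 S x] local_rank_shift[of S x n 0 U x]
    group.iso_sym[OF group_relative_homology_group local_homology_openin[OF assms]] by auto

section \<open>Products with a line\<close>

text \<open>The straight-line homotopy; the conditions on segments replace convexity, and the one on
  \<open>S'\<close> and \<open>T'\<close> makes it a homotopy of pairs.\<close>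

lemma homotopic_with_segment:
  fixes f g :: "'a::real_normed_vector \<Rightarrow> 'b::real_normed_vector"
  assumes "continuous_on S f" "continuous_on S g"
    and "\<And>x. x \<in> S \<Longrightarrow> closed_segment (f x) (g x) \<subseteq> T"
    and "\<And>x. x \<in> S' \<Longrightarrow> closed_segment (f x) (g x) \<subseteq> T'"
  shows "homotopic_with (\<lambda>h. h \<in> S' \<rightarrow> T') (top_of_set S) (top_of_set T) f g"
proof -
  define h where "h = (\<lambda>(t::real, x). (1 - t) *\<^sub>R f x + t *\<^sub>R g x)"
  have seg: "h (t, x) \<in> closed_segment (f x) (g x)" if "t \<in> {0..1}" for t x
    using that by (auto simp: h_def in_segment)
  have f': "continuous_on ({0..1} \<times> S) (\<lambda>p::real \<times> 'a. f (snd p))"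
    by (rule continuous_on_compose2[OF assms(1)]) (auto intro: continuous_intros)
  have g': "continuous_on ({0..1} \<times> S) (\<lambda>p::real \<times> 'a. g (snd p))"
    by (rule continuous_on_compose2[OF assms(2)]) (auto intro: continuous_intros)
  have "continuous_on ({0..1} \<times> S) h"
    unfolding h_def case_prod_beta by (intro continuous_intros f' g')
  moreover have "h ` ({0..1} \<times> S) \<subseteq> T" using seg assms(3) by fastforce
  ultimately have "continuous_map (prod_topology (top_of_set {0..1}) (top_of_set S)) (top_of_set T) h"
    by (auto simp: prod_topology_subtopology_eu)
  moreover have "(\<lambda>x. h (t, x)) \<in> S' \<rightarrow> T'" if "t \<in> {0..1}" for t
    using seg[OF that] assms(4) by fastforce
  moreover have "h (0, x) = f x" "h (1, x) = g x" for x by (auto simp: h_def)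
  ultimately show ?thesis unfolding homotopic_with_def by blast
qed

lemma local_rank_real_product:
  fixes P :: "'p::real_normed_vector set"
  assumes "local_rank P p n" "p \<in> P"
  shows "local_rank (UNIV \<times> P) (0::real, p) (Suc n)"
proof -
  define X where "X = (UNIV :: real set) \<times> P"
  define W where "W = X - {(0, p)}"
  define U where "U = X - {..0} \<times> {p}"
  have U_alt: "U = {(t, x) \<in> X. x = p \<longrightarrow> t > 0}" using assms by (auto simp: U_def X_def)
  define Z where "Z = W \<inter> {0..} \<times> UNIV"
  have UW: "U \<subseteq> W" "U \<subseteq> X" "W \<subseteq> X" by (auto simp: U_alt W_def)
  \<comment> \<open>Moving the real coordinate to 1 deforms \<open>X\<close> into \<open>U\<close>;
    over \<open>p\<close> a positive coordinate stays positive on the way.\<close>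
  have triv: "trivial_group (relative_homology_group i (top_of_set X) U)" for i
  proof (rule trivial_relative_homology_group_alt)
    define f where "f = (\<lambda>(t::real, x::'p). (1::real, x))"
    have cf: "continuous_on A f" for A unfolding f_def case_prod_beta by (intro continuous_intros)
    have "f ` X \<subseteq> U" by (auto simp: f_def X_def U_alt)
    then show "continuous_map (top_of_set X) (subtopology (top_of_set X) U) f"
      using cf UW by (auto simp: continuous_map_in_subtopology)
    have "homotopic_with (\<lambda>k. k \<in> U \<rightarrow> U) (top_of_set X) (top_of_set X) f id"
    proof (rule homotopic_with_segment)
      show "continuous_on X id" by (rule continuous_on_id')
      fix x assume x: "x \<in> X"
      have "closed_segment (f x) (id x) \<subseteq> UNIV \<times> {snd x}"
        by (intro closed_segment_subset convex_Times) (auto simp: f_def case_prod_beta mem_Times_iff)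
      with x show "closed_segment (f x) (id x) \<subseteq> X" by (auto simp: X_def)
    next
      fix x assume x: "x \<in> U"
      obtain t y where ty: "x = (t, y)" by force
      show "closed_segment (f x) (id x) \<subseteq> U"
      proof
        fix z assume "z \<in> closed_segment (f x) (id x)"
        then obtain s where s: "0 \<le> s" "s \<le> 1" "z = (1 - s) *\<^sub>R (1, y) + s *\<^sub>R (t, y)"
          by (auto simp: closed_segment_def f_def ty)
        have zy: "z = ((1 - s) + s * t, y)" using s by (simp add: algebra_simps)
        have "(1 - s) + s * t > 0" if "t > 0"
          using s that by (cases "s = 1") (auto intro: add_pos_nonneg)
        then show "z \<in> U" using x by (auto simp: zy U_alt ty X_def)
      qed
    qed (rule cf)
    then show "homotopic_with (\<lambda>k. k ` U \<subseteq> U) (top_of_set X) (top_of_set X) f id"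
      by (simp add: image_subset_iff_funcset)
  qed
  have 1: "relative_homology_group i (top_of_set X) W \<cong> relative_homology_group (i - 1) (top_of_set W) U" for i
  proof -
    have W': "subtopology (top_of_set X) W = top_of_set W"
      using UW by (simp add: subtopology_subtopology Int_absorb1)
    have e: "exact_seq ([relative_homology_group (i-1) (top_of_set X) U, relative_homology_group (i-1) (top_of_set W) U,
        relative_homology_group i (top_of_set X) W, relative_homology_group i (top_of_set X) U],
      [hom_induced (i-1) (top_of_set W) U (top_of_set X) U id, hom_relboundary i (top_of_set X) W U,
       hom_induced i (top_of_set X) U (top_of_set X) W id])"
      using homology_exactness_triple_1[OF UW(1), of i "top_of_set X"]
        homology_exactness_triple_2[OF UW(1), of i "top_of_set X"] by (simp add: W')
    have "hom_relboundary i (top_of_set X) W U \<in> iso (relative_homology_group i (top_of_set X) W) (relative_homology_group (i - 1) (top_of_set W) U)"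
      using very_short_exact_sequence[OF e triv triv] .
    then show ?thesis by (rule Group.is_isoI)
  qed
  have 2: "relative_homology_group i (top_of_set ({..<0::real} \<times> P)) ({..<0} \<times> (P - {p})) \<cong> relative_homology_group i (top_of_set W) U" for i
  proof -
    \<comment> \<open>\<open>Z\<close> is closed and \<open>U\<close> is open in \<open>W\<close>,
      and \<open>Z\<close> lies in \<open>U\<close>: a point of \<open>W\<close> over
      \<open>p\<close> with nonnegative real coordinate has a positive one.\<close>
    have "closedin (top_of_set W) Z"
      unfolding Z_def by (intro closedin_closed_Int closed_Times) auto
    then have cl: "top_of_set W closure_of Z = Z" by (simp add: closure_of_closedin)
    have "U = W \<inter> - ({..0} \<times> {p})" by (auto simp: U_alt W_def X_def)
    then have "openin (top_of_set W) U"
      by (simp add: openin_open_Int closed_Times open_Compl)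
    then have int: "top_of_set W interior_of U = U" by (simp add: interior_of_openin)
    have "hom_induced i (subtopology (top_of_set W) (W - Z)) (U - Z) (subtopology (top_of_set W) W) U id
    \<in> iso (relative_homology_group i (subtopology (top_of_set W) (W - Z)) (U - Z))
          (relative_homology_group i (subtopology (top_of_set W) W) U)"
      by (rule homology_excision_axiom) (use cl int UW in \<open>auto simp: Z_def W_def U_alt X_def\<close>)
    moreover have "W - Z = {..<0} \<times> P" by (auto simp: W_def Z_def X_def)
    moreover have "U - Z = {..<0} \<times> (P - {p})" by (auto simp: W_def Z_def X_def U_alt)
    moreover have "W \<inter> {..<0} \<times> P = {..<0} \<times> P" by (auto simp: W_def X_def)
    ultimately have "hom_induced i (top_of_set ({..<0} \<times> P)) ({..<0} \<times> (P - {p})) (top_of_set W) U id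
      \<in> iso (relative_homology_group i (top_of_set ({..<0} \<times> P)) ({..<0} \<times> (P - {p})))
          (relative_homology_group i (top_of_set W) U)"
      by (simp add: subtopology_subtopology)
    then show ?thesis by (rule Group.is_isoI)
  qed
  have 3: "relative_homology_group i (top_of_set P) (P - {p}) \<cong> relative_homology_group i (top_of_set ({..<0::real} \<times> P)) ({..<0} \<times> (P - {p}))" for i
  proof (rule homotopy_equivalent_space_imp_isomorphic_relative_homology_groups[where f = "\<lambda>x. (-1, x)" and g = snd])
    show "continuous_map (top_of_set P) (top_of_set ({..<0} \<times> P)) (Pair (-1::real))"
      by (auto intro!: continuous_intros)
    show "continuous_map (top_of_set ({..<0::real} \<times> P)) (top_of_set P) snd"
      by (auto intro!: continuous_intros)
    show "homotopic_with (\<lambda>h. h \<in> P - {p} \<rightarrow> P - {p}) (top_of_set P) (top_of_set P) (snd \<circ> Pair (-1)) id"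
      by (rule homotopic_with_equal) auto
    show "homotopic_with (\<lambda>k. k \<in> {..<0} \<times> (P - {p}) \<rightarrow> {..<0} \<times> (P - {p})) (top_of_set ({..<0::real} \<times> P))
      (top_of_set ({..<0} \<times> P)) (Pair (- 1) \<circ> snd) id"
    proof (rule homotopic_with_segment)
      fix x :: "real \<times> 'p" assume x: "x \<in> {..<0} \<times> P"
      then have "closed_segment ((Pair (-1) \<circ> snd) x) (id x) \<subseteq> {..<0} \<times> {snd x}"
        by (intro closed_segment_subset convex_Times) auto
      with x show "closed_segment ((Pair (-1) \<circ> snd) x) (id x) \<subseteq> {..<0} \<times> P" by auto
    next
      fix x :: "real \<times> 'p" assume x: "x \<in> {..<0} \<times> (P - {p})"
      then have "closed_segment ((Pair (-1) \<circ> snd) x) (id x) \<subseteq> {..<0} \<times> {snd x}"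
        by (intro closed_segment_subset convex_Times) auto
      with x show "closed_segment ((Pair (-1) \<circ> snd) x) (id x) \<subseteq> {..<0} \<times> (P - {p})" by auto
    qed (auto intro!: continuous_intros simp: o_def)
  qed auto
  have "relative_homology_group (int i - int 1) (top_of_set P) (P - {p}) \<cong>
     relative_homology_group (int i) (top_of_set X) (X - {(0, p)})" for i
    using iso_trans[OF iso_trans[OF 3 2] group.iso_sym[OF group_relative_homology_group 1]]
    by (simp add: W_def)
  from local_rank_shift[OF assms(1) this] show ?thesis by (simp add: X_def)
qed

lemma local_rank_complex_product:
  fixes P :: "'p::real_normed_vector set"
  assumes "local_rank P p n" "p \<in> P"
  shows "local_rank (UNIV \<times> P) (z::complex, p) (n + 2)"
proof -
  have 1: "local_rank (UNIV \<times> UNIV \<times> P) (0::real, 0::real, p) (Suc (Suc n))"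
    using assms by (intro local_rank_real_product) auto
  have "homeomorphism (UNIV \<times> UNIV \<times> P) (UNIV \<times> P) (\<lambda>(a, b, x). (z + Complex a b, x)) (\<lambda>(w, x). (Re (w - z), Im (w - z), x))"
    unfolding homeomorphism_def
  proof (intro conjI ballI)
    show "continuous_on (UNIV \<times> UNIV \<times> P) (\<lambda>(a, b, x). (z + Complex a b, x))"
      unfolding case_prod_beta Complex_eq by (intro continuous_intros)
    show "continuous_on (UNIV \<times> P) (\<lambda>(w, x). (Re (w - z), Im (w - z), x))"
      unfolding case_prod_beta by (intro continuous_intros)
    show "(\<lambda>(a, b, x). (z + Complex a b, x)) ` (UNIV \<times> UNIV \<times> P) = UNIV \<times> P"
    proof (intro equalityI subsetI)
      fix q assume "q \<in> (UNIV :: complex set) \<times> P"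
      then obtain w x where q: "q = (w, x)" "x \<in> P" by auto
      have "q = (\<lambda>(a, b, x). (z + Complex a b, x)) (Re (w - z), Im (w - z), x)"
        by (simp add: q complex_eq_iff)
      then show "q \<in> (\<lambda>(a, b, x). (z + Complex a b, x)) ` (UNIV \<times> UNIV \<times> P)"
        using q by blast
    qed auto
    show "(\<lambda>(w, x). (Re (w - z), Im (w - z), x)) ` (UNIV \<times> P) = UNIV \<times> UNIV \<times> P"
    proof (intro equalityI subsetI)
      fix q assume "q \<in> (UNIV :: real set) \<times> (UNIV :: real set) \<times> P"
      then obtain a b x where q: "q = (a, b, x)" "x \<in> P" by auto
      have "q = (\<lambda>(w, x). (Re (w - z), Im (w - z), x)) (z + Complex a b, x)"
        by (simp add: q complex_eq_iff)
      then show "q \<in> (\<lambda>(w, x). (Re (w - z), Im (w - z), x)) ` (UNIV \<times> P)"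
        using q by blast
    qed auto
  qed (auto simp: complex_eq_iff)
  from local_rank_homeomorphism[OF 1 this, of "(z, p)"] show ?thesis using assms by (auto simp: complex_eq_iff)
qed

lemma local_rank_singleton: "local_rank {a} a 0"
  unfolding local_rank_def
proof (intro allI)
  fix i :: nat
  let ?G = "relative_homology_group (int i) (top_of_set {a}) ({a} - {a})"
  show "if i = 0 then rank_one_group ?G else torsion_group ?G"
  proof (cases "i = 0")
    case True
    have "integer_group \<cong> ?G"
      using group.iso_sym[OF group_relative_homology_group homology_coefficients[of "top_of_set {a}" a]]
      by (simp add: True)
    moreover have "rank_one_group integer_group"
    proof -
      have "id \<in> hom integer_group integer_group" by (auto intro: homI)
      moreover have "\<forall>x\<in>carrier integer_group. id x = 0 \<longrightarrow> (\<exists>n>0. x [^]\<^bsub>integer_group\<^esub> (n::nat) = \<one>\<^bsub>integer_group\<^esub>)"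
        by (intro ballI impI exI[of _ 1]) simp
      moreover have "id (1::int) \<noteq> 0" by simp
      ultimately show ?thesis unfolding rank_one_group_def by (metis carrier_integer_group UNIV_I)
    qed
    ultimately have "rank_one_group ?G"
      using rank_one_group_iso[OF abelian_integer_group abelian_relative_homology_group] by blast
    with True show ?thesis by simp
  next
    case False
    then have "trivial_group ?G" using homology_dimension_axiom[of "top_of_set {a}" a "int i"] by simp
    then have "torsion_group ?G"
      unfolding torsion_group_def trivial_group_def by (metis group.is_monoid monoid.nat_pow_one singletonD zero_less_one)
    with False show ?thesis by simp
  qed
qed

section \<open>Integral and rational homology\<close>

definition rat_of_chain :: "'a chain \<Rightarrow> 'a rat_chain" where
  "rat_of_chain = Poly_Mapping.map rat_of_int"

definition rat_scale :: "rat \<Rightarrow> 'a rat_chain \<Rightarrow> 'a rat_chain" where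
  "rat_scale q = Poly_Mapping.map ((*) q)"

lemma lookup_rat_of_chain [simp]: "Poly_Mapping.lookup (rat_of_chain c) f = of_int (Poly_Mapping.lookup c f)"
  by (simp add: rat_of_chain_def Poly_Mapping.map.rep_eq when_def)

lemma lookup_rat_scale [simp]: "Poly_Mapping.lookup (rat_scale q c) f = q * Poly_Mapping.lookup c f"
  by (simp add: rat_scale_def Poly_Mapping.map.rep_eq when_def)

lemma keys_rat_of_chain [simp]: "Poly_Mapping.keys (rat_of_chain c) = Poly_Mapping.keys c"
  by (auto simp: in_keys_iff)

lemma keys_rat_scale: "q \<noteq> 0 \<Longrightarrow> Poly_Mapping.keys (rat_scale q c) = Poly_Mapping.keys c"
  by (auto simp: in_keys_iff)

lemma rat_of_chain_add: "rat_of_chain (a + b) = rat_of_chain a + rat_of_chain b"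
  by (rule poly_mapping_eqI) (simp add: lookup_add)

lemma rat_of_chain_diff: "rat_of_chain (a - b) = rat_of_chain a - rat_of_chain b"
  by (rule poly_mapping_eqI) (simp add: lookup_minus)

lemma rat_of_chain_cmul: "rat_of_chain (frag_cmul k c) = rat_scale (of_int k) (rat_of_chain c)"
  by (rule poly_mapping_eqI) simp

lemma rat_of_chain_inject: "rat_of_chain a = rat_of_chain b \<longleftrightarrow> a = b"
  by (metis lookup_rat_of_chain of_int_eq_iff poly_mapping_eqI)

lemma rat_scale_scale: "rat_scale q (rat_scale r c) = rat_scale (q * r) c"
  by (rule poly_mapping_eqI) simp

lemma rat_scale_one: "rat_scale 1 c = c"
  by (rule poly_mapping_eqI) simp

lemma rat_scale_add: "rat_scale q (a + b) = rat_scale q a + rat_scale q b"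
  by (rule poly_mapping_eqI) (simp add: lookup_add algebra_simps)

lemma rat_scale_diff: "rat_scale q (a - b) = rat_scale q a - rat_scale q b"
  by (rule poly_mapping_eqI) (simp add: lookup_minus algebra_simps)

text \<open>A chain has finitely many coefficients, so the product of their denominators serves. It
  turns questions about rational cycles and boundaries into questions about integral ones up to a
  positive multiple.\<close>

lemma rat_chain_clear_denominators:
  obtains N :: int and c' where "N > 0" "rat_scale (of_int N) c = rat_of_chain c'"
proof -
  define N where "N = (\<Prod>f\<in>Poly_Mapping.keys c. snd (quotient_of (Poly_Mapping.lookup c f)))"
  have N: "N > 0" unfolding N_def by (intro prod_pos) (simp add: quotient_of_denom_pos')
  have int: "of_int N * Poly_Mapping.lookup c f \<in> \<int>" for f
  proof (cases "f \<in> Poly_Mapping.keys c")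
    case True
    let ?q = "quotient_of (Poly_Mapping.lookup c f)"
    obtain M where M: "N = snd ?q * M"
      using dvd_prodI[OF finite_keys True, of "\<lambda>f. snd (quotient_of (Poly_Mapping.lookup c f))"]
      unfolding N_def by (elim dvdE)
    have "Poly_Mapping.lookup c f = of_int (fst ?q) / of_int (snd ?q)"
      by (metis prod.collapse quotient_of_div)
    moreover have "snd ?q > 0" by (simp add: quotient_of_denom_pos')
    ultimately have "of_int (snd ?q) * Poly_Mapping.lookup c f = of_int (fst ?q)"
      by (metis nonzero_mult_div_cancel_left of_int_eq_0_iff less_irrefl times_divide_eq_right)
    then have "of_int N * Poly_Mapping.lookup c f = of_int (M * fst ?q)"
      unfolding M of_int_mult by (metis mult.assoc mult.commute)
    then show ?thesis by (metis Ints_of_int)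
  next
    case False
    then show ?thesis by (simp add: in_keys_iff)
  qed
  define c' where "c' = Poly_Mapping.map (\<lambda>x. \<lfloor>of_int N * x\<rfloor>) c"
  have "rat_scale (of_int N) c = rat_of_chain c'"
  proof (rule poly_mapping_eqI)
    fix f
    show "Poly_Mapping.lookup (rat_scale (of_int N) c) f = Poly_Mapping.lookup (rat_of_chain c') f"
      using int[of f] by (auto simp: c'_def Poly_Mapping.map.rep_eq when_def elim: Ints_cases)
  qed
  with N that show thesis by blast
qed

text \<open>Additivity of the boundary is read off over a common support of \<open>a\<close>,
  \<open>b\<close> and \<open>a + b\<close>; coefficients that cancel contribute zero.\<close>

lemma rat_chain_boundary_superset:
  assumes "finite A" "Poly_Mapping.keys c \<subseteq> A" "p \<noteq> 0"
  shows "rat_chain_boundary p c = (\<Sum>f\<in>A. \<Sum>k\<le>p.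
     Poly_Mapping.single (singular_face p k f) ((-1) ^ k * Poly_Mapping.lookup c f))"
  unfolding rat_chain_boundary_def using assms
  by (auto simp: in_keys_iff intro!: sum.mono_neutral_left)

lemma rat_chain_boundary_add: "rat_chain_boundary p (a + b) = rat_chain_boundary p a + rat_chain_boundary p b"
proof (cases "p = 0")
  case False
  let ?A = "Poly_Mapping.keys a \<union> Poly_Mapping.keys b"
  have A: "finite ?A" "Poly_Mapping.keys (a + b) \<subseteq> ?A" using keys_add[of a b] by auto
  show ?thesis
    unfolding rat_chain_boundary_superset[OF A False]
      rat_chain_boundary_superset[OF A(1) Un_upper1 False] rat_chain_boundary_superset[OF A(1) Un_upper2 False]
    by (simp add: lookup_add algebra_simps single_add flip: sum.distrib)
qed (simp add: rat_chain_boundary_def)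

lemma rat_chain_boundary_scale: "rat_chain_boundary p (rat_scale q c) = rat_scale q (rat_chain_boundary p c)"
proof (cases "p = 0")
  case False
  have "Poly_Mapping.keys (rat_scale q c) \<subseteq> Poly_Mapping.keys c" by (auto simp: in_keys_iff)
  from rat_chain_boundary_superset[OF finite_keys this False] show ?thesis
    by (intro poly_mapping_eqI)
      (auto simp: rat_chain_boundary_def False lookup_sum lookup_single when_def sum_distrib_left intro!: sum.cong)
qed (auto simp: rat_chain_boundary_def intro: poly_mapping_eqI)

lemma rat_chain_boundary_of_chain: "rat_chain_boundary p (rat_of_chain c) = rat_of_chain (chain_boundary p c)"
proof (cases "p = 0")
  case False
  show ?thesis
    by (rule poly_mapping_eqI)
      (auto simp: rat_chain_boundary_def chain_boundary_def frag_extend_def False lookup_sum lookup_single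
        when_def sum_distrib_left intro!: sum.cong)
qed (auto simp: rat_chain_boundary_def chain_boundary_def intro: poly_mapping_eqI)

lemma rat_singular_chain_scale: "q \<noteq> 0 \<Longrightarrow> rat_singular_chain p X (rat_scale q c) = rat_singular_chain p X c"
  by (simp add: rat_singular_chain_def keys_rat_scale)

lemma rat_singular_chain_of_chain: "rat_singular_chain p X (rat_of_chain c) = singular_chain p X c"
  by (simp add: rat_singular_chain_def singular_chain_def)

lemma rat_singular_relcycle_scale:
  "q \<noteq> 0 \<Longrightarrow> rat_singular_relcycle p X S (rat_scale q c) = rat_singular_relcycle p X S c"
  by (simp add: rat_singular_relcycle_def rat_chain_boundary_scale rat_singular_chain_scale)

lemma rat_singular_relcycle_of_chain:
  "rat_singular_relcycle p X S (rat_of_chain c) = singular_relcycle p X S c"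
  by (simp add: rat_singular_relcycle_def rat_chain_boundary_of_chain rat_singular_chain_of_chain singular_relcycle)

lemma rat_singular_relboundary_scale_imp:
  assumes "rat_singular_relboundary p X S c" "q \<noteq> 0"
  shows "rat_singular_relboundary p X S (rat_scale q c)"
proof -
  obtain d where d: "rat_singular_chain (Suc p) X d"
    "rat_singular_chain p (subtopology X S) (rat_chain_boundary (Suc p) d - c)"
    using assms by (auto simp: rat_singular_relboundary_def)
  have "rat_singular_chain (Suc p) X (rat_scale q d)" using d assms by (simp add: rat_singular_chain_scale)
  moreover have "rat_chain_boundary (Suc p) (rat_scale q d) - rat_scale q c
      = rat_scale q (rat_chain_boundary (Suc p) d - c)"
    by (simp add: rat_chain_boundary_scale rat_scale_diff)
  then have "rat_singular_chain p (subtopology X S) (rat_chain_boundary (Suc p) (rat_scale q d) - rat_scale q c)"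
    using d assms by (simp add: rat_singular_chain_scale)
  ultimately show ?thesis by (auto simp: rat_singular_relboundary_def)
qed

lemma rat_singular_relboundary_scale:
  assumes "q \<noteq> 0"
  shows "rat_singular_relboundary p X S (rat_scale q c) = rat_singular_relboundary p X S c"
  using rat_singular_relboundary_scale_imp[OF _ assms, of p X S c]
    rat_singular_relboundary_scale_imp[of p X S "rat_scale q c" "1 / q"] assms
  by (auto simp: rat_scale_scale rat_scale_one)

text \<open>The multiple \<open>n\<close> clears the denominators of the bounding chain. Hence an
  integral cycle bounds rationally precisely when its class is torsion.\<close>

lemma rat_singular_relboundary_of_chain:
  "rat_singular_relboundary p X S (rat_of_chain c) \<longleftrightarrow> (\<exists>n>0. singular_relboundary p X S (frag_cmul n c))"
proof
  assume "rat_singular_relboundary p X S (rat_of_chain c)"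
  then obtain d where d: "rat_singular_chain (Suc p) X d"
    "rat_singular_chain p (subtopology X S) (rat_chain_boundary (Suc p) d - rat_of_chain c)"
    by (auto simp: rat_singular_relboundary_def)
  obtain n d' where n: "n > 0" "rat_scale (of_int n) d = rat_of_chain d'"
    using rat_chain_clear_denominators .
  have "rat_of_chain (chain_boundary (Suc p) d' - frag_cmul n c)
      = rat_scale (of_int n) (rat_chain_boundary (Suc p) d - rat_of_chain c)"
    by (simp add: rat_of_chain_diff rat_scale_diff rat_of_chain_cmul n(2)[symmetric]
        flip: rat_chain_boundary_of_chain rat_chain_boundary_scale)
  then have "singular_chain p (subtopology X S) (chain_boundary (Suc p) d' - frag_cmul n c)"
    using d n(1) by (metis rat_singular_chain_of_chain rat_singular_chain_scale of_int_eq_0_iff less_irrefl)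
  moreover have "singular_chain (Suc p) X d'"
    using d n by (metis rat_singular_chain_of_chain rat_singular_chain_scale of_int_eq_0_iff less_irrefl)
  ultimately show "\<exists>n>0. singular_relboundary p X S (frag_cmul n c)"
    using n(1) by (auto simp: singular_relboundary_def mod_subset_def)
next
  assume "\<exists>n>0. singular_relboundary p X S (frag_cmul n c)"
  then obtain n d where n: "n > 0" "singular_chain (Suc p) X d"
      "singular_chain p (subtopology X S) (chain_boundary (Suc p) d - frag_cmul n c)"
    by (auto simp: singular_relboundary_def mod_subset_def)
  have "rat_singular_relboundary p X S (rat_scale (of_int n) (rat_of_chain c))"
    unfolding rat_singular_relboundary_def
  proof (intro exI conjI)
    show "rat_singular_chain (Suc p) X (rat_of_chain d)" using n by (simp add: rat_singular_chain_of_chain)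
    have "rat_chain_boundary (Suc p) (rat_of_chain d) - rat_scale (of_int n) (rat_of_chain c)
        = rat_of_chain (chain_boundary (Suc p) d - frag_cmul n c)"
      by (simp add: rat_chain_boundary_of_chain rat_of_chain_diff rat_of_chain_cmul)
    then show "rat_singular_chain p (subtopology X S)
       (rat_chain_boundary (Suc p) (rat_of_chain d) - rat_scale (of_int n) (rat_of_chain c))"
      using n by (simp add: rat_singular_chain_of_chain)
  qed
  with n(1) show "rat_singular_relboundary p X S (rat_of_chain c)"
    by (simp add: rat_singular_relboundary_scale)
qed

lemma rat_singular_relcycle_add:
  assumes "rat_singular_relcycle p X S a" "rat_singular_relcycle p X S b"
  shows "rat_singular_relcycle p X S (a + b)"
  using assms keys_add[of a b] keys_add[of "rat_chain_boundary p a" "rat_chain_boundary p b"]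
  unfolding rat_singular_relcycle_def rat_singular_chain_def rat_chain_boundary_add by blast

lemma comm_group_rat_relcycle_group: "comm_group (rat_relcycle_group p X S)"
proof (rule comm_groupI)
  fix x assume "x \<in> carrier (rat_relcycle_group p X S)"
  then have "rat_scale (-1) x \<in> carrier (rat_relcycle_group p X S)"
    by (simp add: rat_relcycle_group_def rat_singular_relcycle_scale)
  moreover have "rat_scale (-1) x + x = 0" by (rule poly_mapping_eqI) (simp add: lookup_add)
  ultimately show "\<exists>y\<in>carrier (rat_relcycle_group p X S). y \<otimes>\<^bsub>rat_relcycle_group p X S\<^esub> x = \<one>\<^bsub>rat_relcycle_group p X S\<^esub>"
    by (intro bexI[of _ "rat_scale (-1) x"]) (auto simp: rat_relcycle_group_def)
next
  show "\<one>\<^bsub>rat_relcycle_group p X S\<^esub> \<in> carrier (rat_relcycle_group p X S)"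
    by (simp add: rat_relcycle_group_def rat_singular_relcycle_def rat_singular_chain_def rat_chain_boundary_def)
qed (auto simp: rat_relcycle_group_def rat_singular_relcycle_add add_ac)

lemma homologous_rel_set_hom:
  "homologous_rel_set p X S \<in> hom (relcycle_group p X S) (relative_homology_group (int p) X S)"
  using normal.r_coset_hom_Mod[OF normal_subgroup_singular_relboundary_relcycle[of p X S]]
  by (simp add: right_coset_singular_relboundary relative_homology_group_def)

lemma homologous_rel_set_pow:
  assumes "singular_relcycle p X S c"
  shows "homologous_rel_set p X S c [^]\<^bsub>relative_homology_group (int p) X S\<^esub> (n::nat)
    = homologous_rel_set p X S (frag_cmul (int n) c)"
proof (induction n)
  case 0
  have "homologous_rel_set p X S 0 = singular_relboundary_set p X S"
    by (simp add: homologous_rel_set_eq_relboundary)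
  then show ?case by simp
next
  case (Suc n)
  have "frag_cmul (int (Suc n)) c = frag_cmul (int n) c + c"
    by (rule poly_mapping_eqI) (simp add: lookup_add algebra_simps)
  moreover have "homologous_rel_set p X S (frag_cmul (int n) c + c) =
     homologous_rel_set p X S (frag_cmul (int n) c) \<otimes>\<^bsub>relative_homology_group (int p) X S\<^esub> homologous_rel_set p X S c"
    using hom_mult[OF homologous_rel_set_hom, of "frag_cmul (int n) c" p X S c] assms
    by (simp add: singular_relcycle_cmul)
  ultimately show ?case using Suc by simp
qed

lemma homologous_rel_set_torsion_iff:
  assumes "singular_relcycle p X S c"
  shows "(\<exists>n>0. homologous_rel_set p X S c [^]\<^bsub>relative_homology_group (int p) X S\<^esub> (n::nat)
      = \<one>\<^bsub>relative_homology_group (int p) X S\<^esub>) \<longleftrightarrow> rat_singular_relboundary p X S (rat_of_chain c)"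
proof -
  have "(\<exists>n>0. singular_relboundary p X S (frag_cmul (int n) c)) \<longleftrightarrow> (\<exists>n>0. singular_relboundary p X S (frag_cmul n c))"
    by (metis of_nat_0_less_iff pos_int_cases)
  then show ?thesis
    by (simp add: homologous_rel_set_pow[OF assms] homologous_rel_set_eq_relboundary rat_singular_relboundary_of_chain)
qed

text \<open>A multiple of each rational cycle is integral, and its class is torsion, so the cycle
  bounds rationally. Cycles and boundaries then coincide, and the quotient has a single
  element.\<close>

lemma rat_homology_trivial:
  assumes "torsion_group (relative_homology_group (int p) X S)"
  shows "trivial_group (rat_relative_homology_group p X S)"
proof -
  let ?G = "rat_relcycle_group p X S"
  interpret G: comm_group ?G by (rule comm_group_rat_relcycle_group)
  have 1: "rat_singular_relboundary p X S c" if c: "rat_singular_relcycle p X S c" for c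
  proof -
    obtain N c' where N: "N > 0" "rat_scale (of_int N) c = rat_of_chain c'"
      using rat_chain_clear_denominators .
    then have c': "singular_relcycle p X S c'"
      using c by (metis less_irrefl of_int_eq_0_iff rat_singular_relcycle_of_chain rat_singular_relcycle_scale)
    then have "homologous_rel_set p X S c' \<in> carrier (relative_homology_group (int p) X S)"
      by (auto simp: carrier_relative_homology_group)
    then have "rat_singular_relboundary p X S (rat_of_chain c')"
      using assms homologous_rel_set_torsion_iff[OF c'] unfolding torsion_group_def by blast
    then show ?thesis using N by (metis less_irrefl of_int_eq_0_iff rat_singular_relboundary_scale)
  qed
  \<comment> \<open>That boundaries are cycles is inherited from integral chains, after the
    denominators have been cleared.\<close>
  have 2: "rat_singular_relcycle p X S c" if "rat_singular_relboundary p X S c" for c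
  proof -
    obtain N c' where N: "N > 0" "rat_scale (of_int N) c = rat_of_chain c'"
      using rat_chain_clear_denominators .
    then have "rat_singular_relboundary p X S (rat_of_chain c')"
      using that by (metis less_irrefl of_int_eq_0_iff rat_singular_relboundary_scale)
    then obtain n where n: "n > 0" "singular_relboundary p X S (frag_cmul n c')"
      by (auto simp: rat_singular_relboundary_of_chain)
    then have "rat_singular_relcycle p X S (rat_of_chain (frag_cmul n c'))"
      by (simp add: rat_singular_relcycle_of_chain singular_relboundary_imp_relcycle)
    then show ?thesis using N n(1)
      by (metis less_irrefl of_int_eq_0_iff rat_singular_relcycle_scale rat_of_chain_cmul)
  qed
  have "Collect (rat_singular_relboundary p X S) = carrier ?G"
    using 1 2 by (auto simp: rat_relcycle_group_def)
  then have eq: "rat_relative_homology_group p X S = ?G Mod carrier ?G"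
    by (simp add: rat_relative_homology_group_def)
  have "carrier ?G \<lhd> ?G"
    by (simp add: G.normal_iff_subgroup G.subgroup_self)
  then have "group (?G Mod carrier ?G)" by (rule normal.factorgroup_is_group)
  moreover have "carrier (?G Mod carrier ?G) = {carrier ?G}"
    unfolding FactGroup_def RCOSETS_def
    using G.coset_join2[OF _ G.subgroup_self] G.one_closed by auto
  ultimately show ?thesis
    by (simp add: eq trivial_group_def)
qed

text \<open>The homomorphism \<open>\<phi>\<close> extends to rational cycles by
  \<open>\<theta> c' / N\<close> whenever \<open>N\<close> times \<open>c\<close> is the integral
  chain \<open>c'\<close>. Its kernel consists of the boundaries, because the kernel of
  \<open>\<phi>\<close> is torsion, and it is onto, because rational multiples are available; the
  isomorphism theorem concludes.\<close>

lemma rat_homology_rank_one: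
  assumes "rank_one_group (relative_homology_group (int p) X S)"
  shows "rat_relative_homology_group p X S \<cong> rat_additive_group"
proof -
  let ?G = "rat_relcycle_group p X S" and ?H = "relative_homology_group (int p) X S"
  let ?cl = "homologous_rel_set p X S"
  interpret G: comm_group ?G by (rule comm_group_rat_relcycle_group)
  obtain \<phi> where \<phi>: "\<phi> \<in> hom ?H integer_group" and nz: "\<exists>x\<in>carrier ?H. \<phi> x \<noteq> 0"
    and tor: "\<And>x. x \<in> carrier ?H \<Longrightarrow> \<phi> x = 0 \<Longrightarrow> (\<exists>n>0. x [^]\<^bsub>?H\<^esub> (n::nat) = \<one>\<^bsub>?H\<^esub>)"
    using assms unfolding rank_one_group_def by blast
  define \<theta> where "\<theta> c = \<phi> (?cl c)" for c
  have \<theta>hom: "\<theta> \<in> hom (relcycle_group p X S) integer_group"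
    unfolding \<theta>_def using hom_compose[OF homologous_rel_set_hom \<phi>] by (simp add: o_def)
  have cl: "?cl c \<in> carrier ?H" if "singular_relcycle p X S c" for c
    using that by (auto simp: carrier_relative_homology_group)
  have \<theta>_add: "\<theta> (a + b) = \<theta> a + \<theta> b" if "singular_relcycle p X S a" "singular_relcycle p X S b" for a b
    using hom_mult[OF \<theta>hom, of a b] that by simp
  have \<theta>_nat: "\<theta> (frag_cmul (int n) c) = int n * \<theta> c" if "singular_relcycle p X S c" for n c
    using hom_nat_pow_integer[OF \<phi> group_relative_homology_group cl[OF that], of n]
    by (simp add: \<theta>_def homologous_rel_set_pow[OF that])
  have \<theta>_int: "\<theta> (frag_cmul n c) = n * \<theta> c" if c: "singular_relcycle p X S c" for n c
  proof (cases "n \<ge> 0")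
    case True
    then show ?thesis using \<theta>_nat[OF c, of "nat n"] by simp
  next
    case False
    have "frag_cmul n c + frag_cmul (int (nat (-n))) c = 0"
      using False by (intro poly_mapping_eqI) (simp add: lookup_add)
    then have "\<theta> (frag_cmul n c) + \<theta> (frag_cmul (int (nat (-n))) c) = \<theta> 0"
      using \<theta>_add[of "frag_cmul n c" "frag_cmul (int (nat (-n))) c"] c by (simp add: singular_relcycle_cmul)
    moreover have "\<theta> 0 = 0" using \<theta>_add[of 0 0] by simp
    ultimately show ?thesis using \<theta>_nat[OF c, of "nat (-n)"] False by simp
  qed
  define R where "R c N c' \<longleftrightarrow> N > 0 \<and> rat_scale (of_int N) c = rat_of_chain c'" for c :: "'a rat_chain" and N and c' :: "'a chain"
  have Rcyc: "singular_relcycle p X S c'" if "R c N c'" "rat_singular_relcycle p X S c" for c N c'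
    using that unfolding R_def
    by (metis less_irrefl of_int_eq_0_iff rat_singular_relcycle_of_chain rat_singular_relcycle_scale)
  have Rex: "\<exists>N c'. R c N c'" for c
    using rat_chain_clear_denominators[of c] unfolding R_def by metis
  define \<psi> where "\<psi> c = (SOME q. \<exists>N c'. R c N c' \<and> q = of_int (\<theta> c') / of_int N :: rat)" for c
  have \<psi>: "\<psi> c = of_int (\<theta> c') / of_int N" if R: "R c N c'" and c: "rat_singular_relcycle p X S c" for c N c'
  proof -
    have "\<exists>N c'. R c N c' \<and> \<psi> c = of_int (\<theta> c') / of_int N"
      unfolding \<psi>_def by (rule someI_ex) (use R in blast)
    then obtain M c'' where M: "R c M c''" "\<psi> c = of_int (\<theta> c'') / of_int M" by blast
    \<comment> \<open>Both sides are \<open>c\<close> multiplied by \<open>M * N\<close>, so the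
      quotient is independent of the denominator that was cleared.\<close>
    have "rat_of_chain (frag_cmul M c') = rat_of_chain (frag_cmul N c'')"
      using R M(1) unfolding R_def rat_of_chain_cmul by (metis rat_scale_scale mult.commute)
    then have "M * \<theta> c' = N * \<theta> c''"
      using \<theta>_int[OF Rcyc[OF R c], of M] \<theta>_int[OF Rcyc[OF M(1) c], of N] by (simp add: rat_of_chain_inject)
    then have "of_int M * of_int (\<theta> c') = (of_int N * of_int (\<theta> c'') :: rat)"
      by (metis of_int_mult)
    then have "of_int (\<theta> c') / of_int N = (of_int (\<theta> c'') / of_int M :: rat)"
      using R M(1) by (simp add: R_def frac_eq_eq mult.commute)
    with M(2) show ?thesis by simp
  qed
  have hom: "\<psi> \<in> hom ?G rat_additive_group"
  proof (rule homI)
    fix x y assume "x \<in> carrier ?G" "y \<in> carrier ?G"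
    then have xy: "rat_singular_relcycle p X S x" "rat_singular_relcycle p X S y"
      by (auto simp: rat_relcycle_group_def)
    obtain N x' M y' where R: "R x N x'" "R y M y'" using Rex by meson
    have "rat_scale (of_int (N * M)) (x + y) = rat_scale (of_int M) (rat_scale (of_int N) x) + rat_scale (of_int N) (rat_scale (of_int M) y)"
      by (simp add: rat_scale_scale rat_scale_add mult.commute)
    also have "\<dots> = rat_of_chain (frag_cmul M x' + frag_cmul N y')"
      using R by (simp add: R_def rat_of_chain_add rat_of_chain_cmul)
    finally have "R (x + y) (N * M) (frag_cmul M x' + frag_cmul N y')"
      using R by (simp add: R_def)
    note s = \<psi>[OF this rat_singular_relcycle_add[OF xy]]
    have "\<psi> (x + y) = \<psi> x + \<psi> y"
      unfolding s \<psi>[OF R(1) xy(1)] \<psi>[OF R(2) xy(2)]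
      using Rcyc[OF R(1) xy(1)] Rcyc[OF R(2) xy(2)] R
      by (simp add: \<theta>_add \<theta>_int singular_relcycle_cmul R_def field_simps)
    then show "\<psi> (x \<otimes>\<^bsub>?G\<^esub> y) = \<psi> x \<otimes>\<^bsub>rat_additive_group\<^esub> \<psi> y"
      by (simp add: rat_relcycle_group_def rat_additive_group_def)
  qed (simp add: rat_additive_group_def)
  have grp: "group rat_additive_group"
    by (rule groupI) (auto simp: rat_additive_group_def intro: exI[of _ "- _"])
  interpret group_hom ?G rat_additive_group \<psi>
    using hom grp by (simp add: group_hom_def group_hom_axioms_def)
  have bd: "rat_singular_relboundary p X S c \<longleftrightarrow> \<psi> c = 0" if c: "rat_singular_relcycle p X S c" for c
  proof -
    obtain N c' where R: "R c N c'" using Rex by meson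
    note c' = Rcyc[OF R c]
    have "rat_singular_relboundary p X S c \<longleftrightarrow> rat_singular_relboundary p X S (rat_of_chain c')"
      using R unfolding R_def by (metis less_irrefl of_int_eq_0_iff rat_singular_relboundary_scale)
    also have "\<dots> \<longleftrightarrow> \<theta> c' = 0"
    proof
      assume "rat_singular_relboundary p X S (rat_of_chain c')"
      then obtain n where n: "n > 0" "?cl c' [^]\<^bsub>?H\<^esub> (n::nat) = \<one>\<^bsub>?H\<^esub>"
        using homologous_rel_set_torsion_iff[OF c'] by blast
      have "int n * \<theta> c' = \<phi> (\<one>\<^bsub>?H\<^esub>)"
        using hom_nat_pow_integer[OF \<phi> group_relative_homology_group cl[OF c'], of n] n(2) by (simp add: \<theta>_def)
      also have "\<dots> = 0" using Group.hom_one[OF \<phi> group_relative_homology_group group_integer_group] by simp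
      finally show "\<theta> c' = 0" using n(1) by simp
    next
      assume "\<theta> c' = 0"
      then show "rat_singular_relboundary p X S (rat_of_chain c')"
        using tor[OF cl[OF c']] homologous_rel_set_torsion_iff[OF c'] by (simp add: \<theta>_def)
    qed
    also have "\<dots> \<longleftrightarrow> \<psi> c = 0" using \<psi>[OF R c] R by (simp add: R_def)
    finally show ?thesis .
  qed
  have 2: "rat_singular_relcycle p X S c" if "rat_singular_relboundary p X S c" for c
  proof -
    obtain N c' where N: "N > 0" "rat_scale (of_int N) c = rat_of_chain c'"
      using rat_chain_clear_denominators .
    then have "rat_singular_relboundary p X S (rat_of_chain c')"
      using that by (metis less_irrefl of_int_eq_0_iff rat_singular_relboundary_scale)
    then obtain n where n: "n > 0" "singular_relboundary p X S (frag_cmul n c')"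
      by (auto simp: rat_singular_relboundary_of_chain)
    then have "rat_singular_relcycle p X S (rat_of_chain (frag_cmul n c'))"
      by (simp add: rat_singular_relcycle_of_chain singular_relboundary_imp_relcycle)
    then show ?thesis using N n(1)
      by (metis less_irrefl of_int_eq_0_iff rat_singular_relcycle_scale rat_of_chain_cmul)
  qed
  have ker: "kernel ?G rat_additive_group \<psi> = Collect (rat_singular_relboundary p X S)"
    using bd 2 by (auto simp: kernel_def rat_relcycle_group_def rat_additive_group_def)
  have surj: "\<psi> ` carrier ?G = carrier rat_additive_group"
  proof (intro equalityI subsetI)
    fix q :: rat assume "q \<in> carrier rat_additive_group"
    obtain a where a: "singular_relcycle p X S a" "\<theta> a \<noteq> 0"
      using nz by (auto simp: carrier_relative_homology_group \<theta>_def)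
    obtain u v where uv: "q / of_int (\<theta> a) = of_int u / of_int v" "v > 0"
      by (metis quotient_of_denom_pos quotient_of_div surj_pair)
    \<comment> \<open>This is \<open>a\<close> multiplied by \<open>q / \<theta> a\<close>, hence a
      cycle with value \<open>q\<close>.\<close>
    define c where "c = rat_scale (1 / of_int v) (rat_of_chain (frag_cmul u a))"
    have R: "R c v (frag_cmul u a)" using uv by (simp add: R_def c_def rat_scale_scale rat_scale_one)
    have c: "rat_singular_relcycle p X S c"
      using uv a by (simp add: c_def rat_singular_relcycle_scale rat_singular_relcycle_of_chain singular_relcycle_cmul)
    have "\<psi> c = of_int u / of_int v * of_int (\<theta> a)"
      by (simp add: \<psi>[OF R c] \<theta>_int[OF a(1)])
    then have "\<psi> c = q" using a(2) by (simp flip: uv(1))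
    with c show "q \<in> \<psi> ` carrier ?G" by (auto simp: rat_relcycle_group_def)
  qed (simp add: rat_additive_group_def)
  show ?thesis
    using FactGroup_iso[OF surj] by (simp add: ker rat_relative_homology_group_def)
qed

section \<open>Transfer for antipodal double coverings\<close>

text \<open>The lifting theorem of the library needs a domain in a normed space, so the simplex is moved
  from \<open>nat \<Rightarrow> real\<close> into bounded functions.\<close>

lemma standard_simplex_bcontfun:
  obtains e :: "(nat \<Rightarrow> real) \<Rightarrow> (nat \<Rightarrow>\<^sub>C real)"
  where "continuous_on (standard_simplex p) e" "convex (e ` standard_simplex p)"
    "continuous_on (e ` standard_simplex p) apply_bcontfun"
    "\<And>x. x \<in> standard_simplex p \<Longrightarrow> apply_bcontfun (e x) = x"
proof -
  \<comment> \<open>The unit sequences are bounded; a point of the simplex becomes a finite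
    combination of them with the same coordinates.\<close>
  define b where "b i = Bcontfun (\<lambda>j. if j = i then 1 else 0 :: real)" for i :: nat
  have b: "apply_bcontfun (b i) j = (if j = i then 1 else 0)" for i j
  proof -
    have "bounded (range (\<lambda>j. if j = i then 1 else 0 :: real))"
      by (rule finite_imp_bounded, rule finite_subset[of _ "{0, 1}"]) auto
    then have "(\<lambda>j. if j = i then 1 else 0 :: real) \<in> bcontfun"
      by (simp add: bcontfun_def)
    then show ?thesis by (simp add: b_def Bcontfun_inverse)
  qed
  define e where "e x = (\<Sum>i\<le>p. x i *\<^sub>R b i)" for x
  have app_sum: "apply_bcontfun (\<Sum>i\<in>I. c i *\<^sub>R b i) j = (\<Sum>i\<in>I. c i * apply_bcontfun (b i) j)" for I c j
    by (induction I rule: infinite_finite_induct) auto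
  have e: "apply_bcontfun (e x) = x" if "x \<in> standard_simplex p" for x
  proof
    fix j
    have "apply_bcontfun (e x) j = (if j \<le> p then x j else 0)"
      unfolding e_def app_sum b by (simp add: if_distrib cong: if_cong)
    then show "apply_bcontfun (e x) j = x j" using that by (auto simp: standard_simplex_def)
  qed
  have "continuous_on (standard_simplex p) e"
    unfolding e_def
    by (intro continuous_intros continuous_on_subset[OF continuous_on_product_coordinates]) auto
  moreover have "convex (e ` standard_simplex p)"
  proof (rule convexI)
    fix x y and u v :: real
    assume x: "x \<in> e ` standard_simplex p" and y: "y \<in> e ` standard_simplex p" and uv: "0 \<le> u" "0 \<le> v" "u + v = 1"
    then obtain x' y' where xy: "x = e x'" "y = e y'" "x' \<in> standard_simplex p" "y' \<in> standard_simplex p" by blast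
    have u: "u = 1 - v" using uv by simp
    have "u *\<^sub>R x + v *\<^sub>R y = e (\<lambda>i. (1 - v) * x' i + v * y' i)"
      by (simp add: xy e_def scaleR_sum_right u scaleR_add_left sum.distrib)
    moreover have "(\<lambda>i. (1 - v) * x' i + v * y' i) \<in> standard_simplex p"
      using xy uv by (intro convex_standard_simplex) auto
    ultimately show "u *\<^sub>R x + v *\<^sub>R y \<in> e ` standard_simplex p" by blast
  qed
  moreover have "continuous_on A (\<lambda>z :: nat \<Rightarrow>\<^sub>C real. apply_bcontfun z j)" for A j
    by (intro continuous_on_subset[OF linear_continuous_on[of "\<lambda>z. apply_bcontfun z j"]]
        bounded_linear_intro[where K = 1]) (use norm_bounded[where 'b = real] in auto)
  then have "continuous_on (e ` standard_simplex p) apply_bcontfun"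
    by (intro continuous_on_coordinatewise_then_product)
  ultimately show thesis using e that by blast
qed

lemma singular_simplex_top_of_set:
  "singular_simplex p (top_of_set S) f \<longleftrightarrow>
     continuous_on (standard_simplex p) f \<and> f ` standard_simplex p \<subseteq> S \<and> f \<in> extensional (standard_simplex p)"
  by (auto simp: singular_simplex_def euclidean_product_topology)

text \<open>The copy of the simplex is convex, hence simply connected and locally path connected,
  which the lifting theorem asks for. The lift is restricted at the end because singular simplices
  are extensional functions.\<close>

lemma covering_space_lift_simplex:
  fixes \<pi> :: "'a::real_normed_vector \<Rightarrow> 'b::real_normed_vector"
  assumes cov: "covering_space C \<pi> S" and f: "singular_simplex p (top_of_set S) f"
  obtains g where "singular_simplex p (top_of_set C) g" "simplex_map p \<pi> g = f"
proof -
  obtain e :: "(nat \<Rightarrow> real) \<Rightarrow> (nat \<Rightarrow>\<^sub>C real)"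
  where e: "continuous_on (standard_simplex p) e" "convex (e ` standard_simplex p)"
    "continuous_on (e ` standard_simplex p) apply_bcontfun"
    "\<And>x. x \<in> standard_simplex p \<Longrightarrow> apply_bcontfun (e x) = x"
    by (rule standard_simplex_bcontfun[of p]) blast
  let ?U = "e ` standard_simplex p"
  have f': "continuous_on (standard_simplex p) f" "f ` standard_simplex p \<subseteq> S" "f \<in> extensional (standard_simplex p)"
    using f by (auto simp: singular_simplex_top_of_set)
  have "continuous_on ?U (f \<circ> apply_bcontfun)"
    by (rule continuous_on_compose[OF e(3)]) (use e(4) f'(1) in \<open>simp add: image_image\<close>)
  moreover have "f \<circ> apply_bcontfun \<in> ?U \<rightarrow> S" using e(4) f'(2) by auto
  ultimately obtain g where g: "continuous_on ?U g" "g \<in> ?U \<rightarrow> C" "\<And>y. y \<in> ?U \<Longrightarrow> \<pi> (g y) = (f \<circ> apply_bcontfun) y"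
    using covering_space_lift[OF cov convex_imp_simply_connected[OF e(2)] convex_imp_locally_path_connected[OF e(2)]]
    by metis
  define h where "h = restrict (g \<circ> e) (standard_simplex p)"
  have "continuous_on (standard_simplex p) (g \<circ> e)"
    by (rule continuous_on_compose[OF e(1) g(1)])
  then have "continuous_on (standard_simplex p) h"
    by (rule continuous_on_eq) (simp add: h_def)
  then have "singular_simplex p (top_of_set C) h"
    using g(2) by (auto simp: singular_simplex_top_of_set h_def)
  moreover have "simplex_map p \<pi> h = f"
  proof
    fix x show "simplex_map p \<pi> h x = f x"
      using g(3) e(4) f'(3) by (cases "x \<in> standard_simplex p") (auto simp: simplex_map_def h_def extensional_def)
  qed
  ultimately show thesis by (rule that)
qed

text \<open>The deck transformation of the double covering is \<open>uminus\<close>, and its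
  homotopy to the identity makes it act trivially on the homology of \<open>C\<close>. For a general
  double covering only the invariant part of the rational homology passes to the quotient.\<close>

locale antipodal_covering =
  fixes C :: "'a::real_normed_vector set" and \<pi> :: "'a \<Rightarrow> 'b::real_normed_vector" and S :: "'b set"
  assumes cov: "covering_space C \<pi> S"
    and uminus_closed: "\<And>x. x \<in> C \<Longrightarrow> - x \<in> C"
    and zero_notin: "0 \<notin> C"
    and fibre: "\<And>x y. x \<in> C \<Longrightarrow> y \<in> C \<Longrightarrow> \<pi> x = \<pi> y \<longleftrightarrow> x = y \<or> x = - y"
    and homotopic_uminus: "homotopic_with (\<lambda>h. True) (top_of_set C) (top_of_set C) uminus id"
begin

lemma continuous_map_uminus: "continuous_map (top_of_set C) (top_of_set C) uminus"
  using uminus_closed by (auto intro!: continuous_intros)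

lemma continuous_map_proj: "continuous_map (top_of_set C) (top_of_set S) \<pi>"
  using cov by (auto simp: covering_space_def)

definition lifts :: "nat \<Rightarrow> ((nat \<Rightarrow> real) \<Rightarrow> 'b) \<Rightarrow> ((nat \<Rightarrow> real) \<Rightarrow> 'a) set" where
  "lifts p f = {g. singular_simplex p (top_of_set C) g \<and> simplex_map p \<pi> g = f}"

definition transfer :: "nat \<Rightarrow> 'b chain \<Rightarrow> 'a chain" where
  "transfer p = frag_extend (\<lambda>f. \<Sum>g\<in>lifts p f. frag_of g)"

text \<open>The simplex is connected, so a lift is determined by its value at one point
  \<open>x0\<close>, where the fibre consists of \<open>g x0\<close> and \<open>- g x0\<close>.
  These differ since \<open>0\<close> is not in \<open>C\<close>.\<close>

lemma lifts_simplex_map: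
  assumes g: "singular_simplex p (top_of_set C) g"
  shows "lifts p (simplex_map p \<pi> g) = {g, simplex_map p uminus g}" "simplex_map p uminus g \<noteq> g"
proof -
  let ?D = "standard_simplex p"
  obtain x0 where x0: "x0 \<in> ?D" using nonempty_standard_simplex by blast
  have gC: "g x \<in> C" if "x \<in> ?D" for x using g that by (auto simp: singular_simplex_top_of_set)
  have gc: "continuous_on ?D g" and ge: "g \<in> extensional ?D" using g by (auto simp: singular_simplex_top_of_set)
  have conn: "connected ?D"
    using connectedin_standard_simplex[of p] by (simp add: euclidean_product_topology)
  have mg: "singular_simplex p (top_of_set C) (simplex_map p uminus g)"
    using g continuous_map_uminus by (rule singular_simplex_simplex_map)
  show ne: "simplex_map p uminus g \<noteq> g"
  proof
    assume "simplex_map p uminus g = g"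
    then have "- g x0 = g x0" using x0 by (metis comp_apply restrict_apply' simplex_map_def)
    then have "2 *\<^sub>R g x0 = 0" by (simp add: scaleR_2) (metis add.right_inverse)
    then have "g x0 = 0" by simp
    with gC[OF x0] zero_notin show False by simp
  qed
  show "lifts p (simplex_map p \<pi> g) = {g, simplex_map p uminus g}"
  proof (intro equalityI subsetI)
    fix h assume "h \<in> lifts p (simplex_map p \<pi> g)"
    then have h: "singular_simplex p (top_of_set C) h" "simplex_map p \<pi> h = simplex_map p \<pi> g" by (auto simp: lifts_def)
    then have hC: "h x \<in> C" if "x \<in> ?D" for x using that by (auto simp: singular_simplex_top_of_set)
    have hc: "continuous_on ?D h" and he: "h \<in> extensional ?D" using h(1) by (auto simp: singular_simplex_top_of_set)
    have eq: "\<pi> (h x) = \<pi> (g x)" if "x \<in> ?D" for x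
      using fun_cong[OF h(2), of x] that by (simp add: simplex_map_def)
    have pc: "continuous_on ?D (\<lambda>x. \<pi> (g x))"
      using gc gC cov by (intro continuous_on_compose2[of C \<pi> _ g]) (auto simp: covering_space_def)
    have pS: "(\<lambda>x. \<pi> (g x)) \<in> ?D \<rightarrow> S" using gC cov by (auto simp: covering_space_def)
    have "h x0 = g x0 \<or> h x0 = - g x0" using fibre[OF hC[OF x0] gC[OF x0]] eq[OF x0] by simp
    then show "h \<in> {g, simplex_map p uminus g}"
    proof
      assume a: "h x0 = g x0"
      have "h x = g x" if "x \<in> ?D" for x
        by (rule covering_space_lift_unique[OF cov a pc pS hc _ _ gc _ _ conn x0 that]) (use hC gC eq in auto)
      then have "h = g" using he ge by (intro extensionalityI)
      then show ?thesis by simp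
    next
      assume a: "h x0 = - g x0"
      have "h x = - g x" if "x \<in> ?D" for x
      proof -
        have mgc: "continuous_on ?D (\<lambda>x. - g x)" by (intro continuous_intros gc)
        have "\<pi> (g y) = \<pi> (- g y)" if "y \<in> ?D" for y
          using gC[OF that] uminus_closed[OF gC[OF that]] fibre by auto
        then show ?thesis
          using covering_space_lift_unique[of C \<pi> S h x0 "\<lambda>x. - g x", OF cov a pc pS hc _ _ mgc _ _ conn x0 that]
            hC gC eq uminus_closed by (simp add: Pi_iff)
      qed
      then have "h = simplex_map p uminus g"
        using he by (intro extensionalityI[of _ ?D]) (simp_all add: simplex_map_def)
      then show ?thesis by simp
    qed
  next
    fix h assume "h \<in> {g, simplex_map p uminus g}"
    moreover have "simplex_map p \<pi> (simplex_map p uminus g) = simplex_map p \<pi> g"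
      using gC fibre uminus_closed by (auto simp: simplex_map_def fun_eq_iff restrict_def)
    ultimately show "h \<in> lifts p (simplex_map p \<pi> g)" using g mg by (auto simp: lifts_def)
  qed
qed

lemma transfer_chain_map:
  assumes "singular_chain p (top_of_set C) c"
  shows "transfer p (chain_map p \<pi> c) = c + chain_map p uminus c"
  using assms unfolding singular_chain_def
proof (induction c rule: frag_induction)
  case (one g)
  then show ?case
    using lifts_simplex_map[of p g] by (simp add: transfer_def)
next
  case (diff a b)
  then show ?case by (simp add: chain_map_diff transfer_def frag_extend_diff)
qed (simp add: transfer_def)

lemma chain_lift:
  assumes "singular_chain p (top_of_set S) c"
  shows "\<exists>c'. singular_chain p (top_of_set C) c' \<and> chain_map p \<pi> c' = c"
  using assms unfolding singular_chain_def
proof (induction c rule: frag_induction)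
  case (one f)
  then obtain g where "singular_simplex p (top_of_set C) g" "simplex_map p \<pi> g = f"
    using covering_space_lift_simplex[OF cov] by blast
  then show ?case by (intro exI[of _ "frag_of g"]) auto
next
  case (diff a b)
  then obtain a' b' where "singular_chain p (top_of_set C) a'" "singular_chain p (top_of_set C) b'"
    "chain_map p \<pi> a' = a" "chain_map p \<pi> b' = b" by (auto simp: singular_chain_def)
  then show ?case
    by (intro exI[of _ "a' - b'"]) (auto simp: chain_map_diff simp flip: singular_chain_def intro: singular_chain_diff)
qed auto

text \<open>Every chain \<open>c\<close> of \<open>S\<close> is the image of a chain
  \<open>c'\<close> of \<open>C\<close>, and its transfer is then \<open>c'\<close> plus the
  antipode of \<open>c'\<close>. All three claims follow from naturality of chain maps, without
  tracking the faces of single lifts.\<close>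

lemma transfer_boundary:
  assumes "singular_chain p (top_of_set S) c"
  shows "chain_boundary p (transfer p c) = transfer (p - Suc 0) (chain_boundary p c)"
    and "singular_chain p (top_of_set C) (transfer p c)"
    and "chain_map p \<pi> (transfer p c) = frag_cmul 2 c"
proof -
  obtain c' where c': "singular_chain p (top_of_set C) c'" "chain_map p \<pi> c' = c"
    using chain_lift[OF assms] by blast
  have t: "transfer p c = c' + chain_map p uminus c'" using transfer_chain_map[OF c'(1)] c'(2) by simp
  have "chain_boundary p (transfer p c) = chain_boundary p c' + chain_map (p - Suc 0) uminus (chain_boundary p c')"
    by (simp add: t chain_boundary_add chain_boundary_chain_map[OF c'(1)])
  also have "\<dots> = transfer (p - Suc 0) (chain_map (p - Suc 0) \<pi> (chain_boundary p c'))"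
    using transfer_chain_map[OF singular_chain_boundary[OF c'(1)]] by simp
  also have "chain_map (p - Suc 0) \<pi> (chain_boundary p c') = chain_boundary p c"
    using chain_boundary_chain_map[OF c'(1), of \<pi>] c'(2) by simp
  finally show "chain_boundary p (transfer p c) = transfer (p - Suc 0) (chain_boundary p c)" .
  show "singular_chain p (top_of_set C) (transfer p c)"
    unfolding t by (intro singular_chain_add c' singular_chain_chain_map[OF c'(1) continuous_map_uminus])
  have "chain_map p \<pi> (chain_map p uminus c') = chain_map p (\<pi> \<circ> uminus) c'"
    by (simp add: chain_map_compose)
  also have "\<dots> = chain_map p \<pi> c'"
    using uminus_closed fibre by (intro chain_map_eq[OF c'(1)]) auto
  finally show "chain_map p \<pi> (transfer p c) = frag_cmul 2 c"
    by (simp add: t chain_map_add c'(2)) (rule poly_mapping_eqI, simp add: lookup_add)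
qed

lemma pow2_homologous_rel_set:
  assumes "singular_relcycle p X T c"
  shows "homologous_rel_set p X T c [^]\<^bsub>relative_homology_group (int p) X T\<^esub> (2::nat)
    = homologous_rel_set p X T (c + c)"
proof -
  have "frag_cmul (int 2) c = c + c" by (rule poly_mapping_eqI) (simp add: lookup_add)
  then show ?thesis using homologous_rel_set_pow[OF assms, of 2] by simp
qed

text \<open>The projection maps the transfer of \<open>c\<close> to \<open>2 c\<close>; the transfer of the projection of \<open>c\<close> is \<open>c\<close> plus its image under
  \<open>uminus\<close>, which is homologous to \<open>2 c\<close> because \<open>uminus\<close> is homotopic to the identity.\<close>

lemma quasi_iso_homology:
  "quasi_iso (homology_group q (top_of_set C)) (homology_group q (top_of_set S))
     (hom_induced q (top_of_set C) {} (top_of_set S) {} \<pi>)"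
proof (cases "q < 0")
  case True
  show ?thesis
  proof (rule quasi_iso.intro)
    fix a assume "a \<in> carrier (homology_group q (top_of_set C))"
    then show "a [^]\<^bsub>homology_group q (top_of_set C)\<^esub> (2::nat) = \<one>\<^bsub>homology_group q (top_of_set C)\<^esub>"
      using trivial_relative_homology_group[OF True, of "top_of_set C" "{}"]
      by (metis group.is_monoid group_relative_homology_group monoid.nat_pow_one singletonD trivial_group_def)
  next
    fix b assume "b \<in> carrier (homology_group q (top_of_set S))"
    then have "b [^]\<^bsub>homology_group q (top_of_set S)\<^esub> (2::nat) = \<one>\<^bsub>homology_group q (top_of_set S)\<^esub>"
      using trivial_relative_homology_group[OF True, of "top_of_set S" "{}"]
      by (metis group.is_monoid group_relative_homology_group monoid.nat_pow_one singletonD trivial_group_def)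
    then show "\<exists>a\<in>carrier (homology_group q (top_of_set C)). hom_induced q (top_of_set C) {} (top_of_set S) {} \<pi> a
        = b [^]\<^bsub>homology_group q (top_of_set S)\<^esub> (2::nat)"
      using Group.hom_one[OF hom_induced_hom group_relative_homology_group group_relative_homology_group]
      by (metis group.is_monoid group_relative_homology_group monoid.one_closed)
  qed (auto intro: hom_induced_hom)
next
  case False
  then obtain p where q: "q = int p" by (metis nonneg_int_cases not_less)
  let ?C = "top_of_set C" and ?S = "top_of_set S"
  let ?h = "hom_induced q ?C {} ?S {} \<pi>"
  have ind: "?h (homologous_rel_set p ?C {} c) = homologous_rel_set p ?S {} (chain_map p \<pi> c)"
    if "singular_relcycle p ?C {} c" for c
    using that continuous_map_proj by (simp add: q hom_induced_chain_map)
  show ?thesis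
  proof (rule quasi_iso.intro)
    fix a assume a: "a \<in> carrier (homology_group q ?C)" "?h a = \<one>\<^bsub>homology_group q ?S\<^esub>"
    obtain c where c: "a = homologous_rel_set p ?C {} c" "singular_relcycle p ?C {} c"
      using a(1) by (auto simp: q carrier_relative_homology_group)
    have cc: "singular_chain p ?C c" using c by (simp add: singular_cycle)
    have "singular_relboundary p ?S {} (chain_map p \<pi> c)"
      using a(2) c ind by (simp add: q homologous_rel_set_eq_relboundary)
    then obtain d where d: "singular_chain (Suc p) ?S d" "chain_boundary (Suc p) d = chain_map p \<pi> c"
      by (auto simp: singular_boundary)
    have "chain_boundary (Suc p) (transfer (Suc p) d) = c + chain_map p uminus c"
      using transfer_boundary(1)[OF d(1)] d(2) transfer_chain_map[OF cc] by simp
    then have bd: "singular_relboundary p ?C {} (c + chain_map p uminus c)"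
      using transfer_boundary(2)[OF d(1)] by (auto simp: singular_boundary)
    have "homologous_rel_set p ?C {} (chain_map p uminus c) = hom_induced q ?C {} ?C {} uminus a"
      using c continuous_map_uminus by (simp add: q hom_induced_chain_map)
    also have "\<dots> = a"
      using homology_homotopy_empty[OF homotopic_uminus, of q] hom_induced_id[OF a(1)] by simp
    finally have "homologous_rel p ?C {} (chain_map p uminus c) c"
      by (simp add: c(1) homologous_rel_set_eq)
    then have "homologous_rel p ?C {} (c + chain_map p uminus c) (c + c)"
      by (intro homologous_rel_add homologous_rel_refl)
    then have "singular_relboundary p ?C {} (c + c)"
      using bd by (metis homologous_rel_eq homologous_rel_eq_relboundary)
    then show "a [^]\<^bsub>homology_group q ?C\<^esub> (2::nat) = \<one>\<^bsub>homology_group q ?C\<^esub>"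
      using pow2_homologous_rel_set[OF c(2)] by (simp add: c(1) q homologous_rel_set_eq_relboundary)
  next
    fix b assume "b \<in> carrier (homology_group q ?S)"
    then obtain c where c: "b = homologous_rel_set p ?S {} c" "singular_relcycle p ?S {} c"
      by (auto simp: q carrier_relative_homology_group)
    have cc: "singular_chain p ?S c" using c by (simp add: singular_cycle)
    have "chain_boundary p (transfer p c) = 0"
      using transfer_boundary(1)[OF cc] c(2) by (simp add: singular_cycle transfer_def)
    then have t: "singular_relcycle p ?C {} (transfer p c)"
      using transfer_boundary(2)[OF cc] by (simp add: singular_cycle)
    have "frag_cmul 2 c = c + c" by (rule poly_mapping_eqI) (simp add: lookup_add)
    then have "?h (homologous_rel_set p ?C {} (transfer p c)) = b [^]\<^bsub>homology_group q ?S\<^esub> (2::nat)"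
      using ind[OF t] transfer_boundary(3)[OF cc] pow2_homologous_rel_set[OF c(2)] by (simp add: c(1) q)
    moreover have "homologous_rel_set p ?C {} (transfer p c) \<in> carrier (homology_group q ?C)"
      using t by (auto simp: q carrier_relative_homology_group)
    ultimately show "\<exists>a\<in>carrier (homology_group q ?C). ?h a = b [^]\<^bsub>homology_group q ?S\<^esub> (2::nat)" by blast
  qed (auto intro: hom_induced_hom)
qed

end

text \<open>The reduced group is the kernel of the map to the homology of a point. A preimage of a
  double lies in that kernel too, because the maps to the point commute with
  \<open>f\<close>.\<close>

lemma quasi_iso_reduced_homology:
  assumes "quasi_iso (homology_group p X) (homology_group p Y) (hom_induced p X {} Y {} f)" "continuous_map X Y f"
  shows "quasi_iso (reduced_homology_group p X) (reduced_homology_group p Y) (hom_induced p X {} Y {} f)"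
proof -
  interpret q: quasi_iso "homology_group p X" "homology_group p Y" "hom_induced p X {} Y {} f" by fact
  let ?D = "discrete_topology {()}"
  let ?aX = "hom_induced p X {} ?D {} (\<lambda>x. ())" and ?aY = "hom_induced p Y {} ?D {} (\<lambda>x. ())"
  have pow: "x [^]\<^bsub>reduced_homology_group p Z\<^esub> (n::nat) = x [^]\<^bsub>homology_group p Z\<^esub> n" for x n and Z :: "'z topology"
    by (simp add: reduced_homology_group_def pow_subgroup_generated)
  have comp: "?aY (hom_induced p X {} Y {} f a) = ?aX a" for a
    using hom_induced_compose_empty[OF assms(2), of ?D "\<lambda>x. ()" p] by (simp add: o_def fun_eq_iff)
  have comm: "comm_group (reduced_homology_group p Z)" for Z :: "'z topology"
    unfolding reduced_homology_group_def
    by (intro group.abelian_subgroup_generated) auto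
  show ?thesis
  proof (rule quasi_iso.intro)
    fix a assume "a \<in> carrier (reduced_homology_group p X)" "hom_induced p X {} Y {} f a = \<one>\<^bsub>reduced_homology_group p Y\<^esub>"
    then show "a [^]\<^bsub>reduced_homology_group p X\<^esub> (2::nat) = \<one>\<^bsub>reduced_homology_group p X\<^esub>"
      using q.ker carrier_reduced_homology_group_subset[of p X] by (auto simp: pow one_reduced_homology_group)
  next
    fix b assume b: "b \<in> carrier (reduced_homology_group p Y)"
    then have b': "b \<in> carrier (homology_group p Y)" using carrier_reduced_homology_group_subset by blast
    obtain a where a: "a \<in> carrier (homology_group p X)"
        "hom_induced p X {} Y {} f a = b [^]\<^bsub>homology_group p Y\<^esub> (2::nat)"
      using q.coker[OF b'] by blast
    have "b [^]\<^bsub>reduced_homology_group p Y\<^esub> (2::nat) \<in> carrier (reduced_homology_group p Y)"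
      using b by (simp add: group.is_monoid monoid.nat_pow_closed)
    then have "?aY (b [^]\<^bsub>homology_group p Y\<^esub> (2::nat)) = \<one>\<^bsub>homology_group p ?D\<^esub>"
      by (simp add: pow carrier_reduced_homology_group kernel_def)
    then have "?aX a = \<one>\<^bsub>homology_group p ?D\<^esub>" using comp[of a] a(2) by simp
    then have "a \<in> carrier (reduced_homology_group p X)"
      using a(1) by (simp add: carrier_reduced_homology_group kernel_def)
    with a(2) show "\<exists>a\<in>carrier (reduced_homology_group p X). hom_induced p X {} Y {} f a
       = b [^]\<^bsub>reduced_homology_group p Y\<^esub> (2::nat)"
      by (auto simp: pow)
  qed (use comm hom_induced_reduced_hom in auto)
qed

text \<open>For contractible \<open>A\<close> the local homology at \<open>a\<close> is the reduced
  homology of \<open>A - {a}\<close> one degree lower, and likewise for \<open>B\<close>; the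
  covering compares the two punctured spaces. The condition \<open>A \<noteq> {a}\<close> keeps them
  nonempty.\<close>

lemma local_rank_antipodal_quotient:
  fixes \<pi> :: "'a::real_normed_vector \<Rightarrow> 'b::real_normed_vector"
  assumes "antipodal_covering (A - {a}) \<pi> (B - {b})" "contractible A" "contractible B" "a \<in> A" "b \<in> B"
    and "A \<noteq> {a}" and "local_rank A a n"
  shows "local_rank B b n"
  unfolding local_rank_def
proof (intro allI)
  fix i :: nat
  interpret antipodal_covering "A - {a}" \<pi> "B - {b}" by fact
  have ne: "B - {b} \<noteq> {}" using cov assms(4,6) by (auto simp: covering_space_def)
  have 1: "relative_homology_group (int i) (top_of_set A) (A - {a}) \<cong> reduced_homology_group (int i - 1) (top_of_set (A - {a}))"
    using isomorphic_group_relative_homology_of_contractible[of "top_of_set A" "A - {a}" "int i"] assms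
    by (auto simp: subtopology_subtopology Int_absorb1)
  have 2: "relative_homology_group (int i) (top_of_set B) (B - {b}) \<cong> reduced_homology_group (int i - 1) (top_of_set (B - {b}))"
    using isomorphic_group_relative_homology_of_contractible[of "top_of_set B" "B - {b}" "int i"] assms ne
    by (auto simp: subtopology_subtopology Int_absorb1)
  have comm: "comm_group (reduced_homology_group p Z)" for p and Z :: "'z topology"
    unfolding reduced_homology_group_def
    by (intro group.abelian_subgroup_generated) auto
  note q = quasi_iso_reduced_homology[OF quasi_iso_homology continuous_map_proj, of "int i - 1"]
  note 3 = group.iso_sym[OF group_relative_homology_group 2]
  show "if i = n then rank_one_group (relative_homology_group (int i) (top_of_set B) (B - {b}))
       else torsion_group (relative_homology_group (int i) (top_of_set B) (B - {b}))"
    using assms(7)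
      rank_one_group_iso[OF comm abelian_relative_homology_group 3] torsion_group_iso[OF comm abelian_relative_homology_group 3]
      quasi_iso.rank_one_group[OF q] quasi_iso.torsion_group[OF q]
      rank_one_group_iso[OF abelian_relative_homology_group comm 1] torsion_group_iso[OF abelian_relative_homology_group comm 1]
    unfolding local_rank_def by (auto split: if_splits)
qed

section \<open>Products of two vectors\<close>

definition coord_space :: "'n set \<Rightarrow> (complex^'n) set" where
  "coord_space I = {v. \<forall>k. k \<notin> I \<longrightarrow> v $ k = 0}"

definition sq_matrix :: "complex^'n \<Rightarrow> complex^'n^'n" where
  "sq_matrix v = (\<chi> i j. v $ i * v $ j)"

definition sym_prod :: "complex^'n \<Rightarrow> complex^'n \<Rightarrow> complex^'n^'n" where
  "sym_prod u v = (\<chi> i j. u $ i * v $ j + v $ i * u $ j)"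

definition wedge_prod :: "complex^'n \<Rightarrow> complex^'n \<Rightarrow> complex^'n^'n" where
  "wedge_prod u v = (\<chi> i j. u $ i * v $ j - v $ i * u $ j)"

definition sym_rank2 :: "(complex^'n^'n) set" where
  "sym_rank2 = {S. S \<noteq> 0 \<and> (\<exists>u v. S = sym_prod u v)}"

text \<open>The affine cone over the Grassmannian of planes in its Plucker embedding, without the
  vertex.\<close>

definition wedge_cone :: "(complex^'n^'n) set" where
  "wedge_cone = {S. S \<noteq> 0 \<and> (\<exists>u v. S = wedge_prod u v)}"

lemma homeomorphismI':
  assumes "continuous_on S f" "continuous_on T g" "\<And>x. x \<in> S \<Longrightarrow> f x \<in> T" "\<And>y. y \<in> T \<Longrightarrow> g y \<in> S"
    "\<And>x. x \<in> S \<Longrightarrow> g (f x) = x" "\<And>y. y \<in> T \<Longrightarrow> f (g y) = y"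
  shows "homeomorphism S T f g"
proof -
  have "f ` S = T" using assms(3,4,6) by force
  moreover have "g ` T = S" using assms(3,4,5) by force
  ultimately show ?thesis unfolding homeomorphism_def using assms by blast
qed

lemma continuous_on_if_const:
  assumes "P \<Longrightarrow> continuous_on S f" "\<not> P \<Longrightarrow> continuous_on S g"
  shows "continuous_on S (\<lambda>x. if P then f x else g x)"
  using assms by (cases P) auto

lemma local_rank_coord_space_times:
  fixes P :: "'p::real_normed_vector set" and v :: "complex^'n"
  assumes "local_rank P p n" "p \<in> P" "finite I" "v \<in> coord_space I"
  shows "local_rank (coord_space I \<times> P) (v, p) (n + 2 * card I)"
  using assms(3,4)
proof (induction I arbitrary: v)
  case empty
  have "homeomorphism P (coord_space {} \<times> P) (\<lambda>x. (0 :: complex^'n, x)) snd"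
    by (rule homeomorphismI') (auto simp: coord_space_def vec_eq_iff intro!: continuous_intros)
  from local_rank_homeomorphism[OF assms(1) this assms(2), of "(v, p)"] empty show ?case
    by (auto simp: coord_space_def vec_eq_iff)
next
  case (insert k I)
  define f where "f = (\<lambda>(c, v, x). ((\<chi> i. if i = k then c else v $ i) :: complex^'n, x :: 'p))"
  define g where "g = (\<lambda>(v, x). (v $ k, (\<chi> i. if i = k then 0 else v $ i) :: complex^'n, x :: 'p))"
  have hom: "homeomorphism (UNIV \<times> coord_space I \<times> P) (coord_space (insert k I) \<times> P) f g"
  proof (rule homeomorphismI')
    show "continuous_on (UNIV \<times> coord_space I \<times> P) f"
      unfolding f_def case_prod_beta
      by (intro continuous_on_Pair continuous_on_vec_lambda continuous_on_if_const continuous_intros)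
    show "continuous_on (coord_space (insert k I) \<times> P) g"
      unfolding g_def case_prod_beta
      by (intro continuous_on_Pair continuous_on_vec_lambda continuous_on_if_const continuous_intros)
    show "f x \<in> coord_space (insert k I) \<times> P" if "x \<in> UNIV \<times> coord_space I \<times> P" for x
      using that by (auto simp: f_def coord_space_def)
    show "g y \<in> UNIV \<times> coord_space I \<times> P" if "y \<in> coord_space (insert k I) \<times> P" for y
      using that by (auto simp: g_def coord_space_def)
    show "g (f x) = x" if "x \<in> UNIV \<times> coord_space I \<times> P" for x
      using that insert.hyps(2) by (auto simp: f_def g_def coord_space_def vec_eq_iff)
    show "f (g y) = y" if "y \<in> coord_space (insert k I) \<times> P" for y
      using that by (auto simp: f_def g_def vec_eq_iff)
  qed
  define v' where "v' = ((\<chi> i. if i = k then 0 else v $ i) :: complex^'n)"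
  have v': "v' \<in> coord_space I" using insert.prems by (auto simp: v'_def coord_space_def)
  have "local_rank (UNIV \<times> coord_space I \<times> P) (v $ k, v', p) (n + 2 * card I + 2)"
    by (intro local_rank_complex_product insert.IH) (use v' assms in auto)
  moreover have "f (v $ k, v', p) = (v, p)" by (auto simp: f_def v'_def vec_eq_iff)
  ultimately have "local_rank (coord_space (insert k I) \<times> P) (v, p) (n + 2 * card I + 2)"
    using local_rank_homeomorphism[OF _ hom, of "(v $ k, v', p)"] v' assms(2) by auto
  then show ?case using insert.hyps by (simp add: ac_simps)
qed

lemma local_rank_coord_space:
  fixes v :: "complex^'n"
  assumes "v \<in> coord_space I"
  shows "local_rank (coord_space I) v (2 * card I)"
proof -
  have 1: "local_rank (coord_space I \<times> {0::real}) (v, 0) (0 + 2 * card I)"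
    by (rule local_rank_coord_space_times) (use assms local_rank_singleton in auto)
  have "homeomorphism (coord_space I \<times> {0::real}) (coord_space I) fst (\<lambda>x. (x, 0))"
    by (auto simp: homeomorphism_def image_iff intro!: continuous_intros)
  from local_rank_homeomorphism[OF 1 this] assms show ?thesis by simp
qed

section \<open>The cone of squares\<close>

lemma sq_matrix_nth [simp]: "sq_matrix v $ i $ j = v $ i * v $ j"
  by (simp add: sq_matrix_def)

lemma sq_matrix_eq_iff:
  "sq_matrix x = sq_matrix y \<longleftrightarrow> x = y \<or> x = - y"
proof
  assume eq: "sq_matrix x = sq_matrix y"
  then have e: "x $ i * x $ j = y $ i * y $ j" for i j by (metis sq_matrix_nth)
  show "x = y \<or> x = - y"
  proof (cases "x = 0")
    case True
    then have "y $ i * y $ i = 0" for i using e[of i i] by simp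
    with True show ?thesis by (simp add: vec_eq_iff)
  next
    case False
    then obtain k where k: "x $ k \<noteq> 0" by (auto simp: vec_eq_iff)
    have "(x $ k - y $ k) * (x $ k + y $ k) = 0" using e[of k k] by (simp add: algebra_simps)
    then consider "y $ k = x $ k" | "y $ k = - x $ k" by (auto simp: add_eq_0_iff)
    then show ?thesis
    proof cases
      case 1
      then have "x $ j = y $ j" for j using e[of k j] k by simp
      then show ?thesis by (simp add: vec_eq_iff)
    next
      case 2
      have "x $ j = - y $ j" for j
      proof -
        have "x $ k * (x $ j + y $ j) = 0" using e[of k j] 2 by (simp add: algebra_simps)
        with k show ?thesis by (simp add: add_eq_0_iff2)
      qed
      then show ?thesis by (simp add: vec_eq_iff)
    qed
  qed
next
  assume "x = y \<or> x = - y"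
  then show "sq_matrix x = sq_matrix y" by (auto simp: vec_eq_iff)
qed

lemma sq_matrix_0 [simp]: "sq_matrix 0 = 0"
  by (simp add: vec_eq_iff)

lemma sq_matrix_eq_0 [simp]: "sq_matrix x = 0 \<longleftrightarrow> x = 0"
  using sq_matrix_eq_iff[of x 0] by simp

lemma continuous_on_sq_matrix: "continuous_on A sq_matrix"
  unfolding sq_matrix_def by (intro continuous_on_vec_lambda continuous_intros)

text \<open>A local inverse divides the row \<open>v $ k *s v\<close> by \<open>v $ k\<close>, which
  is a square root of the diagonal entry; the two choices of the root are the two sheets. Stability
  under complex scalars lets a half turn connect \<open>uminus\<close> with the identity.\<close>

lemma antipodal_covering_sq_matrix:
  fixes A :: "(complex^'n) set"
  assumes scale: "\<And>c v. v \<in> A \<Longrightarrow> c *s v \<in> A" and "0 \<in> A"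
  shows "antipodal_covering (A - {0}) sq_matrix (sq_matrix ` A - {0})"
proof
  let ?C = "A - {0}" and ?S = "sq_matrix ` A - {0}"
  have mA: "- v \<in> A" if "v \<in> A" for v
  proof -
    have "- v = (-1) *s v" by (simp add: vec_eq_iff)
    then show ?thesis using scale[OF that, of "-1"] by metis
  qed
  show "covering_space ?C sq_matrix ?S"
  proof
    show "continuous_on ?C sq_matrix" by (rule continuous_on_sq_matrix)
    show "sq_matrix ` ?C = ?S" by auto
    fix M assume "M \<in> ?S"
    then obtain x where x: "x \<in> A" "x \<noteq> 0" "M = sq_matrix x" by auto
    then obtain k where k: "x $ k \<noteq> 0" by (auto simp: vec_eq_iff)
    define c where "c = x $ k"
    have c: "c \<noteq> 0" using k by (simp add: c_def)
    \<comment> \<open>Dividing by the square of \<open>c\<close> places the entry in the right half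
      plane, where the principal root is continuous and the two roots differ by the sign of their
      real part. The sign \<open>s\<close> in \<open>U\<close> and \<open>q\<close> names the
      sheet.\<close>
    define T where "T = {N \<in> ?S. 0 < Re (N $ k $ k / c\<^sup>2)}"
    define U where "U s = {v \<in> ?C. 0 < Re ((v $ k / c)\<^sup>2) \<and> 0 < s * Re (v $ k / c)}" for s :: real
    define q where "q s N = (of_real s / (c * csqrt (N $ k $ k / c\<^sup>2))) *s (N $ k)" for s and N :: "complex^'n^'n"
    have opT: "openin (top_of_set ?S) T"
    proof -
      have "open {N :: complex^'n^'n. 0 < Re (N $ k $ k / c\<^sup>2)}"
        using c by (intro open_Collect_less continuous_intros) auto
      moreover have "T = ?S \<inter> {N. 0 < Re (N $ k $ k / c\<^sup>2)}" by (auto simp: T_def)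
      ultimately show ?thesis by (simp add: openin_open_Int)
    qed
    have opU: "openin (top_of_set ?C) (U s)" for s
    proof -
      have "open {v :: complex^'n. 0 < Re ((v $ k / c)\<^sup>2)}" "open {v :: complex^'n. 0 < s * Re (v $ k / c)}"
        using c by (intro open_Collect_less continuous_intros; simp)+
      then have "open ({v :: complex^'n. 0 < Re ((v $ k / c)\<^sup>2)} \<inter> {v. 0 < s * Re (v $ k / c)})" by (rule open_Int)
      moreover have "U s = ?C \<inter> ({v. 0 < Re ((v $ k / c)\<^sup>2)} \<inter> {v. 0 < s * Re (v $ k / c)})" by (auto simp: U_def)
      ultimately show ?thesis by (simp add: openin_open_Int)
    qed
    have qv: "q s (sq_matrix v) = v" if v: "v \<in> U s" and s: "s = 1 \<or> s = - 1" for s v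
    proof -
      have vk: "v $ k \<noteq> 0" using v by (auto simp: U_def)
      have "csqrt ((of_real s * (v $ k / c))\<^sup>2) = of_real s * (v $ k / c)"
        using v s by (intro csqrt_square) (auto simp: U_def)
      then have "csqrt (v $ k * v $ k / c\<^sup>2) = of_real s * (v $ k / c)"
        using s by (auto simp: power2_eq_square)
      then have "q s (sq_matrix v) $ j = v $ j" for j
        using s vk c by (auto simp: q_def)
      then show ?thesis by (simp add: vec_eq_iff)
    qed
    have sU: "sq_matrix v \<in> T" if "v \<in> U s" for v s
      using that by (auto simp: T_def U_def power2_eq_square)
    have mU: "- v \<in> U (- s)" if "v \<in> U s" for v s
      using that mA by (auto simp: U_def)
    have Uex: "v \<in> U 1 \<or> v \<in> U (-1)" if "v \<in> ?C" "sq_matrix v \<in> T" for v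
    proof -
      have p: "0 < Re ((v $ k / c)\<^sup>2)" using that(2) by (simp add: T_def power2_eq_square)
      have "Re (z\<^sup>2) = (Re z)\<^sup>2 - (Im z)\<^sup>2" for z by (simp add: power2_eq_square)
      then have "Re (v $ k / c) \<noteq> 0" using p by (metis diff_gt_0_iff_gt not_less zero_le_power2 zero_power2)
      with p that(1) show ?thesis by (auto simp: U_def)
    qed
    have Tex: "\<exists>v\<in>U s. N = sq_matrix v" if N: "N \<in> T" and s: "s = 1 \<or> s = - 1" for N s
    proof -
      obtain v where v: "v \<in> ?C" "N = sq_matrix v" using N by (auto simp: T_def)
      then have "v \<in> U s \<or> - v \<in> U s" using Uex[OF v(1)] N s mU[of v 1] mU[of v "-1"] v(2) by auto
      moreover have "sq_matrix (- v) = sq_matrix v" by (simp add: sq_matrix_eq_iff)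
      ultimately show ?thesis using v(2) by metis
    qed
    have hom: "homeomorphism (U s) T sq_matrix (q s)" if s: "s = 1 \<or> s = - 1" for s
      unfolding homeomorphism_def
    proof (intro conjI ballI)
      show "sq_matrix ` U s = T" using sU Tex[OF _ s] by blast
      show "q s ` T = U s" using sU Tex[OF _ s] qv[OF _ s] by (force simp: image_iff)
      show "continuous_on T (q s)"
      proof -
        have cs: "continuous_on T (\<lambda>N. csqrt (N $ k $ k / c\<^sup>2))"
          using c by (intro continuous_on_compose2[OF continuous_on_csqrt] continuous_intros)
            (auto simp: T_def complex_nonpos_Reals_iff)
        have nz: "c * csqrt (N $ k $ k / c\<^sup>2) \<noteq> 0" if "N \<in> T" for N
          using that c by (auto simp: T_def)
        show ?thesis unfolding q_def vector_scalar_mult_def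
          by (intro continuous_on_vec_lambda continuous_intros cs) (use nz in auto)
      qed
      show "q s (sq_matrix v) = v" if "v \<in> U s" for v using qv[OF that s] .
      show "sq_matrix (q s N) = N" if "N \<in> T" for N using Tex[OF that s] qv[OF _ s] by force
    qed (rule continuous_on_sq_matrix)
    show "\<exists>T. M \<in> T \<and> openin (top_of_set ?S) T \<and> (\<exists>v. \<Union>v = ?C \<inter> sq_matrix -` T \<and>
        (\<forall>u\<in>v. openin (top_of_set ?C) u) \<and> pairwise disjnt v \<and> (\<forall>u\<in>v. \<exists>q. homeomorphism u T sq_matrix q))"
    proof (intro exI[of _ T] exI[of _ "{U 1, U (-1)}"] conjI)
      show "M \<in> T" using x c by (auto simp: T_def c_def power2_eq_square)
      show "\<Union>{U 1, U (-1)} = ?C \<inter> sq_matrix -` T"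
      proof (intro equalityI subsetI)
        fix v assume "v \<in> \<Union>{U 1, U (-1)}"
        then obtain s where s: "v \<in> U s" by blast
        then have "v \<in> ?C" by (simp add: U_def)
        with sU[OF s] show "v \<in> ?C \<inter> sq_matrix -` T" by simp
      next
        fix v assume "v \<in> ?C \<inter> sq_matrix -` T"
        then show "v \<in> \<Union>{U 1, U (-1)}" using Uex[of v] by simp
      qed
      show "pairwise disjnt {U 1, U (-1)}" by (auto simp: pairwise_def disjnt_def U_def)
      show "\<forall>u\<in>{U 1, U (-1)}. \<exists>q. homeomorphism u T sq_matrix q" using hom by blast
    qed (use opT opU in auto)
  qed
  show "- x \<in> ?C" if "x \<in> ?C" for x using that mA by auto
  show "0 \<notin> ?C" by simp
  show "sq_matrix x = sq_matrix y \<longleftrightarrow> x = y \<or> x = - y" for x y :: "complex^'n"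
    by (rule sq_matrix_eq_iff)
  show "homotopic_with (\<lambda>h. True) (top_of_set ?C) (top_of_set ?C) uminus id"
  proof -
    \<comment> \<open>Scalars on the unit circle, from \<open>-1\<close> at time 0 to
      \<open>1\<close> at time 1.\<close>
    define h where "h = (\<lambda>(t::real, v :: complex^'n). exp (\<i> * of_real (pi * (1 - t))) *s v)"
    have "continuous_on ({0..1} \<times> ?C) h"
      unfolding h_def case_prod_beta vector_scalar_mult_def by (intro continuous_on_vec_lambda continuous_intros)
    moreover have "h ` ({0..1} \<times> ?C) \<subseteq> ?C"
      using scale by (auto simp: h_def)
    ultimately have "continuous_map (prod_topology (top_of_set {0..1}) (top_of_set ?C)) (top_of_set ?C) h"
      by (auto simp: prod_topology_subtopology_eu)
    moreover have "h (0, v) = - v" "h (1, v) = id v" for v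
      by (simp_all add: h_def vec_eq_iff)
    ultimately show ?thesis unfolding homotopic_with_def by blast
  qed
qed

text \<open>At the vertex the antipodal quotient applies, as the linear space and its image are both
  contractible. Elsewhere the covering is a local homeomorphism.\<close>

lemma local_rank_sq_matrix_image:
  fixes I :: "'n::finite set"
  assumes "I \<noteq> {}" "M \<in> sq_matrix ` coord_space I"
  shows "local_rank (sq_matrix ` coord_space I) M (2 * card I)"
proof -
  let ?A = "coord_space I" and ?B = "sq_matrix ` coord_space I"
  have A: "c *s v \<in> ?A" if "v \<in> ?A" for c v using that by (auto simp: coord_space_def)
  have A0: "0 \<in> ?A" by (simp add: coord_space_def)
  interpret antipodal_covering "?A - {0}" sq_matrix "?B - {0}"
    by (rule antipodal_covering_sq_matrix[OF A A0])
  show ?thesis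
  proof (cases "M = 0")
    case True
    have "local_rank ?B 0 (2 * card I)"
    proof (rule local_rank_antipodal_quotient)
      show "antipodal_covering (?A - {0}) sq_matrix (?B - {0})" by unfold_locales
      have "convex ?A" by (auto simp: convex_def coord_space_def)
      then show "contractible ?A" by (rule convex_imp_contractible)
      have "starlike ?B"
        unfolding starlike_def
      proof (intro bexI[of _ 0] ballI)
        fix N assume "N \<in> ?B"
        then obtain v where v: "v \<in> ?A" "N = sq_matrix v" by blast
        show "closed_segment 0 N \<subseteq> ?B"
        proof
          fix z assume "z \<in> closed_segment 0 N"
          then obtain t where t: "0 \<le> t" "z = t *\<^sub>R N" by (auto simp: closed_segment_def)
          \<comment> \<open>Scaling a square by \<open>t\<close> scales its root by
            \<open>sqrt t\<close>, so the image is star-shaped about \<open>0\<close>.\<close>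
          have "z = sq_matrix (of_real (sqrt t) *s v)"
          proof -
            have "complex_of_real (sqrt t) * complex_of_real (sqrt t) = of_real t"
              using t(1) by (simp flip: of_real_mult)
            then have "(of_real (sqrt t) * x) * (of_real (sqrt t) * y) = t *\<^sub>R (x * y)" for x y :: complex
              by (metis mult.assoc mult.left_commute scaleR_conv_of_real)
            then show ?thesis
              unfolding t(2) v(2) vec_eq_iff by (simp only: sq_matrix_nth vector_scaleR_component vector_smult_component) simp
          qed
          then show "z \<in> ?B" using A[OF v(1)] by blast
        qed
      qed (use A0 in \<open>auto intro: image_eqI[of _ _ 0]\<close>)
      then show "contractible ?B" by (rule starlike_imp_contractible)
      obtain k where "k \<in> I" using assms by blast
      then have "axis k 1 \<in> ?A" by (auto simp: coord_space_def axis_def)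
      moreover have "axis k 1 \<noteq> (0 :: complex^'n)" by (simp add: axis_eq_0_iff)
      ultimately show "?A \<noteq> {0}" by blast
    qed (use A0 in \<open>auto intro: local_rank_coord_space image_eqI[of _ _ 0]\<close>)
    with True show ?thesis by simp
  next
    case False
    obtain v where v: "v \<in> ?A" "M = sq_matrix v" using assms by blast
    with False have v0: "v \<noteq> 0" by auto
    obtain T u q where T: "v \<in> T" "openin (top_of_set (?A - {0})) T" "sq_matrix v \<in> u"
        "openin (top_of_set (?B - {0})) u" "homeomorphism T u sq_matrix q"
      using covering_space_local_homeomorphism[OF cov, of v] v v0 by blast
    have "openin (top_of_set ?A) (?A - {0})" "openin (top_of_set ?B) (?B - {0})"
      by (auto simp: openin_delete)
    then have op: "openin (top_of_set ?A) T" "openin (top_of_set ?B) u"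
      using T by (meson openin_trans)+
    have "local_rank T v (2 * card I)"
      using local_rank_openin_iff[OF op(1) T(1)] local_rank_coord_space[OF v(1)] by blast
    then have "local_rank u M (2 * card I)"
      using local_rank_homeomorphism[OF _ T(5) T(1)] v(2) by metis
    then show ?thesis using local_rank_openin_iff[OF op(2)] T(3) v(2) by blast
  qed
qed

section \<open>Charts of the two cones\<close>

lemma local_rank_chart:
  fixes X :: "'a::t1_space set" and Z :: "'b::t1_space set"
  assumes "openin (top_of_set X) U" "x \<in> U" "homeomorphism U T f g" "openin (top_of_set Z) T"
    and "local_rank Z (f x) n"
  shows "local_rank X x n"
proof -
  have fx: "f x \<in> T" using assms by (auto simp: homeomorphism_def)
  then have "local_rank T (f x) n" using local_rank_openin_iff[OF assms(4)] assms(5) by blast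
  then have "local_rank U x n"
    using local_rank_homeomorphism[OF _ homeomorphism_symD[OF assms(3)] fx] assms by (auto simp: homeomorphism_def)
  then show ?thesis using local_rank_openin_iff[OF assms(1,2)] by blast
qed

text \<open>Completing the square in the \<open>i\<close>-th coordinate leaves a single square: for \<open>S = u v\<close> the remainder
  \<open>S - S\<^sub>i\<^sup>2 / S\<^sub>i\<^sub>i\<close> is \<open>w\<^sup>2\<close> with \<open>w\<close> proportional to \<open>u\<^sub>i v - v\<^sub>i u\<close>.\<close>

lemma local_rank_sym_rank2_diag:
  fixes S :: "complex^'n^'n"
  assumes S: "S \<in> sym_rank2" and i: "S $ i $ i \<noteq> 0" and n: "CARD('n) \<ge> 2"
  shows "local_rank sym_rank2 S (4 * CARD('n) - 2)"
proof -
  define U where "U = {S \<in> sym_rank2. S $ i $ i \<noteq> (0::complex)}"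
  define Q where "Q = sq_matrix ` coord_space (UNIV - {i})"
  define T where "T = {r :: complex^'n. r $ i \<noteq> 0} \<times> Q"
  define f where "f S = (S $ i, (\<chi> k l. S $ k $ l - S $ i $ k * S $ i $ l / S $ i $ i))" for S :: "complex^'n^'n"
  define g where "g = (\<lambda>(r :: complex^'n, M :: complex^'n^'n). \<chi> k l. r $ k * r $ l / r $ i + M $ k $ l)"
  have "openin (top_of_set sym_rank2) U"
  proof -
    have "open {S :: complex^'n^'n. S $ i $ i \<noteq> 0}" by (intro open_Collect_neq continuous_intros)
    moreover have "U = sym_rank2 \<inter> {S. S $ i $ i \<noteq> 0}" by (auto simp: U_def)
    ultimately show ?thesis by (simp add: openin_open_Int)
  qed
  moreover have "S \<in> U" using assms by (simp add: U_def)
  moreover have "homeomorphism U T f g"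
  proof (rule homeomorphismI')
    show "continuous_on U f" unfolding f_def
      by (intro continuous_on_Pair continuous_on_vec_lambda continuous_intros) (auto simp: U_def)
    show "continuous_on T g" unfolding g_def case_prod_beta
      by (intro continuous_on_vec_lambda continuous_intros) (auto simp: T_def)
  next
    fix S assume "S \<in> U"
    then obtain u v where uv: "S = sym_prod u v" and nz: "S $ i $ i \<noteq> 0" by (auto simp: U_def sym_rank2_def)
    have uvi: "u $ i \<noteq> 0" "v $ i \<noteq> 0" using nz by (auto simp: uv sym_prod_def)
    \<comment> \<open>The remainder is \<open>- 1 / (2 * u $ i * v $ i)\<close> times the square of
      \<open>u $ i *s v - v $ i *s u\<close>; the root \<open>s\<close> absorbs that factor.\<close>
    define s where "s = csqrt (- 1 / (2 * u $ i * v $ i))"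
    have s: "s * s = - 1 / (2 * u $ i * v $ i)" by (simp add: s_def flip: power2_eq_square)
    define w where "w = (\<chi> k. s * (u $ i * v $ k - v $ i * u $ k))"
    have "snd (f S) $ k $ l = sq_matrix w $ k $ l" for k l
    proof -
      have "sq_matrix w $ k $ l = (s * s) * ((u $ i * v $ k - v $ i * u $ k) * (u $ i * v $ l - v $ i * u $ l))"
        by (simp add: w_def)
      also have "\<dots> = snd (f S) $ k $ l"
        unfolding s using uvi by (simp add: f_def uv sym_prod_def divide_simps) (simp add: algebra_simps)
      finally show ?thesis by simp
    qed
    then have "snd (f S) = sq_matrix w" by (simp add: vec_eq_iff)
    moreover have "w \<in> coord_space (UNIV - {i})" by (auto simp: coord_space_def w_def)
    ultimately show "f S \<in> T" using nz by (auto simp: T_def Q_def f_def)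
    show "g (f S) = S" by (simp add: f_def g_def vec_eq_iff)
  next
    fix y assume "y \<in> T"
    then obtain r w where y: "y = (r, sq_matrix w)" "r $ i \<noteq> 0" "w $ i = 0"
      by (auto simp: T_def Q_def coord_space_def)
    define a where "a = (1 / csqrt (r $ i)) *s r"
    have cs: "csqrt (r $ i) * csqrt (r $ i) = r $ i" by (simp flip: power2_eq_square)
    have aa: "a $ k * a $ l = r $ k * r $ l / r $ i" for k l
      using cs y(2) by (simp add: a_def)
    \<comment> \<open>A sum of two squares factors over the complex numbers; the 1/2 compensates for
      \<open>sym_prod\<close> adding both orders.\<close>
    have "g y = sym_prod ((1/2) *s (a + \<i> *s w)) (a - \<i> *s w)"
      by (simp add: g_def y vec_eq_iff sym_prod_def flip: aa) (simp add: algebra_simps add_divide_distrib)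
    moreover have gi: "g y $ i $ k = r $ k" for k using y by (simp add: g_def)
    moreover have "g y $ i $ i \<noteq> 0" using gi y(2) by simp
    then have "g y \<noteq> 0" by auto
    ultimately show "g y \<in> U" using y(2) unfolding U_def sym_rank2_def by auto
    show "f (g y) = y"
      by (simp add: f_def gi) (simp add: y g_def vec_eq_iff)
  qed
  moreover have "openin (top_of_set (coord_space UNIV \<times> Q)) T"
  proof -
    have "open ({r :: complex^'n. r $ i \<noteq> 0} \<times> (UNIV :: (complex^'n^'n) set))"
      by (intro open_Times open_Collect_neq continuous_intros) auto
    moreover have "T = (coord_space UNIV \<times> Q) \<inter> ({r :: complex^'n. r $ i \<noteq> 0} \<times> UNIV)"
      by (auto simp: T_def coord_space_def)
    ultimately show ?thesis by (simp add: openin_open_Int)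
  qed
  moreover have "local_rank (coord_space UNIV \<times> Q) (f S) (4 * CARD('n) - 2)"
  proof -
    have "f S \<in> T" using \<open>homeomorphism U T f g\<close> \<open>S \<in> U\<close> by (auto simp: homeomorphism_def)
    then have sf: "snd (f S) \<in> Q" by (auto simp: T_def)
    have c: "card (UNIV - {i}) = CARD('n) - 1" by (simp add: card_Diff_singleton)
    then have "UNIV - {i} \<noteq> {}" using n by (metis card.empty diff_is_0_eq not_less_eq_eq numeral_2_eq_2 One_nat_def)
    then have "local_rank Q (snd (f S)) (2 * card (UNIV - {i}))"
      using sf unfolding Q_def by (rule local_rank_sq_matrix_image)
    then have "local_rank (coord_space UNIV \<times> Q) (fst (f S), snd (f S)) (2 * card (UNIV - {i}) + 2 * card (UNIV :: 'n set))"
      by (rule local_rank_coord_space_times) (use sf in \<open>auto simp: coord_space_def\<close>)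
    moreover have "2 * card (UNIV - {i}) + 2 * card (UNIV :: 'n set) = 4 * CARD('n) - 2" using c n by simp
    ultimately show ?thesis by simp
  qed
  ultimately show ?thesis by (rule local_rank_chart)
qed

text \<open>If the diagonal vanishes, adding row and column \<open>j\<close> to row and column
  \<open>i\<close> turns the \<open>i\<close>-th diagonal entry into twice \<open>S $ i $ j\<close>.
  This congruence is \<open>H 1\<close>; it acts on the factors by \<open>h 1\<close>, so it is a
  homeomorphism of the cone onto itself.\<close>

lemma local_rank_sym_rank2:
  fixes S :: "complex^'n^'n"
  assumes S: "S \<in> sym_rank2" and n: "CARD('n) \<ge> 2"
  shows "local_rank sym_rank2 S (4 * CARD('n) - 2)"
proof (cases "\<exists>i. S $ i $ i \<noteq> 0")
  case True
  then show ?thesis using local_rank_sym_rank2_diag assms by blast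
next
  case False
  obtain u v where uv: "S = sym_prod u v" "S \<noteq> 0" using S by (auto simp: sym_rank2_def)
  obtain i j where ij: "S $ i $ j \<noteq> 0" using uv(2) by (auto simp: vec_eq_iff)
  with False have ne: "i \<noteq> j" by metis
  define h where "h c u = (\<chi> k. if k = i then u $ k + c * u $ j else u $ k)" for c and u :: "complex^'n"
  define H where "H c M = (\<chi> k l. M $ k $ l + (if k = i then c * M $ j $ l else 0) + (if l = i then c * M $ k $ j else 0)
      + (if k = i \<and> l = i then c * c * M $ j $ j else 0))" for c and M :: "complex^'n^'n"
  have H: "H c (sym_prod u v) = sym_prod (h c u) (h c v)" for c u v
    by (auto simp: H_def h_def sym_prod_def vec_eq_iff algebra_simps)
  have inv: "H (- c) (H c M) = M" for c M
    using ne by (auto simp: H_def vec_eq_iff algebra_simps)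
  have in': "H c M \<in> sym_rank2" if "M \<in> sym_rank2" for c M
  proof -
    have "H c M \<noteq> 0"
    proof
      assume "H c M = 0"
      then have "M = H (- c) 0" using inv[of c M] by simp
      also have "\<dots> = 0" by (auto simp: H_def vec_eq_iff)
      finally show False using that by (simp add: sym_rank2_def)
    qed
    moreover have "\<exists>u v. M = sym_prod u v" using that by (simp add: sym_rank2_def)
    then obtain u v where "M = sym_prod u v" by blast
    then have "H c M = sym_prod (h c u) (h c v)" by (simp add: H)
    ultimately show ?thesis unfolding sym_rank2_def by blast
  qed
  have cont: "continuous_on A (H c)" for c A
    unfolding H_def by (intro continuous_on_vec_lambda continuous_on_add continuous_on_if_const continuous_intros)
  have hom: "homeomorphism sym_rank2 sym_rank2 (H (- 1)) (H 1)"
    using in' inv[of 1] inv[of "- 1"] cont by (intro homeomorphismI') auto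
  have sym: "S $ j $ i = S $ i $ j" by (simp add: uv sym_prod_def ac_simps)
  have "H 1 S $ i $ i = 2 * S $ i $ j" using False sym by (simp add: H_def)
  then have "local_rank sym_rank2 (H 1 S) (4 * CARD('n) - 2)"
    using ij in'[OF S] n by (intro local_rank_sym_rank2_diag[of _ i]) auto
  from local_rank_homeomorphism[OF this hom in'[OF S]] show ?thesis using inv[of 1 S] by simp
qed

text \<open>Where \<open>P $ i $ j\<close> is nonzero, rows \<open>i\<close> and \<open>j\<close>
  determine \<open>P\<close> by the Plucker relations. Row \<open>i\<close> is free off position
  \<open>i\<close>, row \<open>j\<close> is free off the positions \<open>i\<close> and
  \<open>j\<close>; with \<open>n\<close> the size of the matrix this makes \<open>2 * n - 3\<close>
  complex coordinates.\<close>

lemma local_rank_wedge_cone: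
  fixes P :: "complex^'n^'n"
  assumes P: "P \<in> wedge_cone"
  shows "local_rank wedge_cone P (4 * CARD('n) - 6)"
proof -
  obtain u0 v0 where uv0: "P = wedge_prod u0 v0" "P \<noteq> 0" using P by (auto simp: wedge_cone_def)
  obtain i j where ij: "P $ i $ j \<noteq> 0" using uv0(2) by (auto simp: vec_eq_iff)
  then have ne: "i \<noteq> j" by (auto simp: uv0 wedge_prod_def)
  define U where "U = {P \<in> wedge_cone. P $ i $ j \<noteq> (0::complex)}"
  let ?A = "coord_space (UNIV - {i})" and ?B = "coord_space (UNIV - {i, j})"
  define T where "T = {r \<in> ?A. r $ j \<noteq> 0} \<times> ?B"
  define f where "f P = (P $ i, \<chi> k. if k = i then 0 else P $ j $ k)" for P :: "complex^'n^'n"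
  \<comment> \<open>Row \<open>j\<close> rebuilt from its free part \<open>s\<close>: antisymmetry
    forces its entry at \<open>i\<close> to be the negative of \<open>r $ j\<close>.\<close>
  define e where "e r s k = (if k = i then - r $ j else s $ k)" for r s :: "complex^'n" and k
  define g where "g = (\<lambda>(r, s). \<chi> k l. (r $ k * e r s l - e r s k * r $ l) / r $ j)"
  have "openin (top_of_set wedge_cone) U"
  proof -
    have "open {S :: complex^'n^'n. S $ i $ j \<noteq> 0}" by (intro open_Collect_neq continuous_intros)
    moreover have "U = wedge_cone \<inter> {S. S $ i $ j \<noteq> 0}" by (auto simp: U_def)
    ultimately show ?thesis by (simp add: openin_open_Int)
  qed
  moreover have PU: "P \<in> U" using assms ij by (simp add: U_def)
  moreover have "homeomorphism U T f g"
  proof (rule homeomorphismI')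
    show "continuous_on U f" unfolding f_def
      by (intro continuous_on_Pair continuous_on_vec_lambda continuous_on_if_const continuous_intros)
    have "continuous_on T (\<lambda>y. e (fst y) (snd y) k)" for k
      unfolding e_def by (cases "k = i") (auto intro!: continuous_intros)
    then show "continuous_on T g" unfolding g_def case_prod_beta
      by (intro continuous_on_vec_lambda continuous_intros) (auto simp: T_def)
  next
    fix P assume "P \<in> U"
    then obtain u v where uv: "P = wedge_prod u v" and nz: "P $ i $ j \<noteq> 0" by (auto simp: U_def wedge_cone_def)
    show "f P \<in> T" using nz by (auto simp: f_def T_def coord_space_def uv wedge_prod_def)
    have eP: "e (P $ i) (\<chi> k. if k = i then 0 else P $ j $ k) k = P $ j $ k" for k
      by (auto simp: e_def uv wedge_prod_def)
    have "(P $ i $ k * P $ j $ l - P $ j $ k * P $ i $ l) / P $ i $ j = P $ k $ l" for k l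
      using nz by (simp add: divide_simps) (simp add: uv wedge_prod_def algebra_simps)
    then show "g (f P) = P" by (simp add: f_def g_def eP vec_eq_iff)
  next
    fix y assume "y \<in> T"
    then obtain r s where y: "y = (r, s)" "r $ j \<noteq> 0" "r $ i = 0" "s $ i = 0" "s $ j = 0"
      by (auto simp: T_def coord_space_def)
    have "g y = wedge_prod ((1 / r $ j) *s r) (\<chi> k. e r s k)"
      by (simp add: g_def y(1) wedge_prod_def vec_eq_iff diff_divide_distrib)
    moreover have gi: "g y $ i $ k = r $ k" for k using y ne by (simp add: g_def e_def)
    moreover have gj: "g y $ j $ k = e r s k" for k using y ne by (simp add: g_def e_def)
    moreover have "g y $ i $ j \<noteq> 0" using gi y(2) by simp
    then have "g y \<noteq> 0" by auto
    ultimately show "g y \<in> U" using y(2) unfolding U_def wedge_cone_def by auto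
    show "f (g y) = y"
    proof -
      have "g y $ i = r" by (simp add: vec_eq_iff gi)
      moreover have "(\<chi> k. if k = i then 0 else g y $ j $ k) = s" using y(4) by (simp add: vec_eq_iff gj e_def)
      ultimately show ?thesis unfolding f_def by (simp only: y(1))
    qed
  qed
  moreover have "openin (top_of_set (?A \<times> ?B)) T"
  proof -
    have "open ({r :: complex^'n. r $ j \<noteq> 0} \<times> (UNIV :: (complex^'n) set))"
      by (intro open_Times open_Collect_neq continuous_intros) auto
    moreover have "T = (?A \<times> ?B) \<inter> ({r :: complex^'n. r $ j \<noteq> 0} \<times> UNIV)"
      by (auto simp: T_def)
    ultimately show ?thesis by (simp add: openin_open_Int)
  qed
  moreover have "local_rank (?A \<times> ?B) (f P) (4 * CARD('n) - 6)"
  proof -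
    have "f P \<in> T" using \<open>homeomorphism U T f g\<close> PU by (auto simp: homeomorphism_def)
    then have fP: "fst (f P) \<in> ?A" "snd (f P) \<in> ?B" by (auto simp: T_def)
    have c: "card (UNIV - {i}) = CARD('n) - 1" "card (UNIV - {i, j}) = CARD('n) - 2"
      using ne by (auto simp: card_Diff_subset)
    have "card {i, j} \<le> CARD('n)" by (rule card_mono) auto
    then have n: "CARD('n) \<ge> 2" using ne by simp
    have "local_rank (?A \<times> ?B) (fst (f P), snd (f P)) (2 * card (UNIV - {i, j}) + 2 * card (UNIV - {i}))"
      using fP by (intro local_rank_coord_space_times local_rank_coord_space) auto
    moreover have "2 * card (UNIV - {i, j}) + 2 * card (UNIV - {i}) = 4 * CARD('n) - 6" using c n by simp
    ultimately show ?thesis by simp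
  qed
  ultimately show ?thesis by (rule local_rank_chart)
qed

section \<open>Irreducibility and Krull dimension\<close>

lemma polynomial_functions_sum:
  "(\<And>i. i \<in> I \<Longrightarrow> f i \<in> polynomial_functions) \<Longrightarrow> (\<lambda>A. \<Sum>i\<in>I. f i A) \<in> polynomial_functions"
  by (induction I rule: infinite_finite_induct) (auto intro: polynomial_functions.intros)

lemma polynomial_functions_power:
  "f \<in> polynomial_functions \<Longrightarrow> (\<lambda>A. f A ^ n) \<in> polynomial_functions"
  by (induction n) (auto intro: polynomial_functions.intros)

lemma polynomial_functions_on_curve:
  assumes "f \<in> polynomial_functions" "\<And>i j. \<exists>p. \<forall>t. \<gamma> t $ i $ j = poly p t"
  shows "\<exists>p. \<forall>t. f (\<gamma> t) = poly p t"
  using assms(1)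
proof induction
  case (const c)
  show ?case by (rule exI[of _ "[:c:]"]) simp
next
  case (entry i j)
  show ?case by (rule assms(2))
next
  case (add f g)
  then obtain p q where "\<forall>t. f (\<gamma> t) = poly p t" "\<forall>t. g (\<gamma> t) = poly q t" by blast
  then show ?case by (intro exI[of _ "p + q"]) simp
next
  case (mult f g)
  then obtain p q where "\<forall>t. f (\<gamma> t) = poly p t" "\<forall>t. g (\<gamma> t) = poly q t" by blast
  then show ?case by (intro exI[of _ "p * q"]) simp
qed

text \<open>The ideal of polynomial functions vanishing on \<open>X\<close> is prime. In this form
  irreducibility passes directly to closures and to polynomial images.\<close>

definition zariski_prime :: "(complex^'n^'m) set \<Rightarrow> bool" where
  "zariski_prime X \<longleftrightarrow> X \<noteq> {} \<and> (\<forall>f\<in>polynomial_functions. \<forall>g\<in>polynomial_functions.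
     (\<forall>x\<in>X. f x * g x = 0) \<longrightarrow> (\<forall>x\<in>X. f x = 0) \<or> (\<forall>x\<in>X. g x = 0))"

lemma zariski_primeD:
  assumes "zariski_prime X" "f \<in> polynomial_functions" "g \<in> polynomial_functions" "\<forall>x\<in>X. f x * g x = 0"
  shows "(\<forall>x\<in>X. f x = 0) \<or> (\<forall>x\<in>X. g x = 0)"
  using assms unfolding zariski_prime_def by blast

lemma closedin_zariski_zero:
  "f \<in> polynomial_functions \<Longrightarrow> closedin zariski {x. f x = 0}"
  unfolding closedin_zariski by (intro exI[of _ "{f}"]) (auto simp: zero_locus_def)

lemma irreducible_space_iff_zariski_prime:
  "irreducible_space (subtopology zariski X) \<longleftrightarrow> zariski_prime X"
proof
  assume irr: "irreducible_space (subtopology zariski X)"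
  show "zariski_prime X"
    unfolding zariski_prime_def
  proof (intro conjI ballI impI)
    show "X \<noteq> {}" using irr by (auto simp: irreducible_space_def)
    fix f g :: "complex^'a^'b \<Rightarrow> complex"
    assume fg: "f \<in> polynomial_functions" "g \<in> polynomial_functions" "\<forall>x\<in>X. f x * g x = 0"
    have "closedin (subtopology zariski X) ({x. f x = 0} \<inter> X)" "closedin (subtopology zariski X) ({x. g x = 0} \<inter> X)"
      using fg closedin_zariski_zero by (auto simp: closedin_subtopology)
    moreover have "({x. f x = 0} \<inter> X) \<union> ({x. g x = 0} \<inter> X) = topspace (subtopology zariski X)"
      using fg(3) by auto
    ultimately have "{x. f x = 0} \<inter> X = X \<or> {x. g x = 0} \<inter> X = X"
      using irr unfolding irreducible_space_def by (metis topspace_subtopology topspace_zariski inf_top_left)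
    then show "(\<forall>x\<in>X. f x = 0) \<or> (\<forall>x\<in>X. g x = 0)" by blast
  qed
next
  assume pr: "zariski_prime X"
  show "irreducible_space (subtopology zariski X)"
    unfolding irreducible_space_def
  proof (intro conjI allI impI)
    show "topspace (subtopology zariski X) \<noteq> {}" using pr by (simp add: zariski_prime_def)
    fix A B assume AB: "closedin (subtopology zariski X) A \<and> closedin (subtopology zariski X) B \<and> A \<union> B = topspace (subtopology zariski X)"
    then obtain P Q where PQ: "P \<subseteq> polynomial_functions" "Q \<subseteq> polynomial_functions"
      "A = zero_locus P \<inter> X" "B = zero_locus Q \<inter> X"
      by (auto simp: closedin_subtopology closedin_zariski)
    show "A = topspace (subtopology zariski X) \<or> B = topspace (subtopology zariski X)"
    proof (rule ccontr)
      assume "\<not> ?thesis"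
      then obtain x y where xy: "x \<in> X" "x \<notin> A" "y \<in> X" "y \<notin> B" using PQ by auto
      then obtain f g where fg: "f \<in> P" "f x \<noteq> 0" "g \<in> Q" "g y \<noteq> 0" using PQ by (auto simp: zero_locus_def)
      have "\<forall>z\<in>X. f z * g z = 0" using AB PQ fg by (auto simp: zero_locus_def)
      then show False using pr fg xy PQ unfolding zariski_prime_def by blast
    qed
  qed
qed

text \<open>If \<open>f\<close> is nonzero at one endpoint and \<open>g\<close> at the other, both
  restrict to nonzero polynomials in \<open>t\<close>. Their product would vanish off a finite set,
  hence at infinitely many \<open>t\<close>.\<close>

lemma zariski_prime_rational_curves:
  assumes "X \<noteq> {}"
    and curve: "\<And>x y. x \<in> X \<Longrightarrow> y \<in> X \<Longrightarrow> \<exists>\<gamma> a b. (\<forall>i j. \<exists>p. \<forall>t. \<gamma> t $ i $ j = poly p t)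
      \<and> \<gamma> a = x \<and> \<gamma> b = y \<and> finite {t. \<gamma> t \<notin> X}"
  shows "zariski_prime X"
  unfolding zariski_prime_def
proof (intro conjI ballI impI assms(1))
  fix f g :: "complex^'a^'b \<Rightarrow> complex"
  assume fg: "f \<in> polynomial_functions" "g \<in> polynomial_functions" "\<forall>x\<in>X. f x * g x = 0"
  show "(\<forall>x\<in>X. f x = 0) \<or> (\<forall>x\<in>X. g x = 0)"
  proof (rule ccontr)
    assume "\<not> ?thesis"
    then obtain x y where xy: "x \<in> X" "f x \<noteq> 0" "y \<in> X" "g y \<noteq> 0" by blast
    obtain \<gamma> a b where \<gamma>: "\<forall>i j. \<exists>p. \<forall>t. \<gamma> t $ i $ j = poly p t" "\<gamma> a = x" "\<gamma> b = y" "finite {t. \<gamma> t \<notin> X}"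
      using curve[OF xy(1,3)] by blast
    obtain p q where pq: "\<forall>t. f (\<gamma> t) = poly p t" "\<forall>t. g (\<gamma> t) = poly q t"
      using polynomial_functions_on_curve[OF fg(1), of \<gamma>] polynomial_functions_on_curve[OF fg(2), of \<gamma>] \<gamma>(1) by blast
    have nz: "p \<noteq> 0" "q \<noteq> 0" using pq xy \<gamma> by (metis poly_0)+
    have "(UNIV :: complex set) \<subseteq> {t. \<gamma> t \<notin> X} \<union> {t. poly (p * q) t = 0}"
      using fg(3) pq by (auto simp flip: pq(1) pq(2))
    moreover have "finite ({t. \<gamma> t \<notin> X} \<union> {t. poly (p * q) t = 0})"
      using \<gamma>(4) nz by (simp add: poly_roots_finite del: poly_mult)
    ultimately show False using infinite_UNIV_char_0 finite_subset by metis
  qed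
qed

lemma zariski_prime_closure:
  assumes "zariski_prime W" "W \<subseteq> X"
  shows "zariski_prime (subtopology zariski X closure_of W)"
    and "\<And>f x. f \<in> polynomial_functions \<Longrightarrow> \<forall>x\<in>W. f x = 0 \<Longrightarrow> x \<in> subtopology zariski X closure_of W \<Longrightarrow> f x = 0"
proof -
  show van: "f x = 0" if "f \<in> polynomial_functions" "\<forall>x\<in>W. f x = 0" "x \<in> subtopology zariski X closure_of W" for f x
  proof -
    have "closedin (subtopology zariski X) ({x. f x = 0} \<inter> X)"
      using that closedin_zariski_zero by (auto simp: closedin_subtopology)
    then have "subtopology zariski X closure_of W \<subseteq> {x. f x = 0} \<inter> X"
      using that assms(2) by (intro closure_of_minimal) auto
    with that show ?thesis by blast
  qed
  have sub: "W \<subseteq> subtopology zariski X closure_of W" using assms(2) by (intro closure_of_subset) simp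
  show "zariski_prime (subtopology zariski X closure_of W)"
    unfolding zariski_prime_def
  proof (intro conjI ballI impI)
    show "subtopology zariski X closure_of W \<noteq> {}" using sub assms(1) by (auto simp: zariski_prime_def)
    fix f g :: "complex^'a^'b \<Rightarrow> complex"
    assume fg: "f \<in> polynomial_functions" "g \<in> polynomial_functions"
      "\<forall>x\<in>subtopology zariski X closure_of W. f x * g x = 0"
    then have "(\<forall>x\<in>W. f x = 0) \<or> (\<forall>x\<in>W. g x = 0)"
      using assms(1) sub unfolding zariski_prime_def by blast
    then show "(\<forall>x\<in>subtopology zariski X closure_of W. f x = 0) \<or> (\<forall>x\<in>subtopology zariski X closure_of W. g x = 0)"
      using van fg by blast
  qed
qed

section \<open>Lower bound for the Krull dimension\<close>

text \<open>The chain is formed by the closures of the \<open>W i\<close>, which stay irreducible. A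
  function vanishing on \<open>W i\<close> vanishes on its closure, so the last assumption keeps
  consecutive closures distinct.\<close>

lemma krull_dim_ge:
  assumes prime: "\<And>i. i \<le> n \<Longrightarrow> zariski_prime (W i)" and sub: "\<And>i. i \<le> n \<Longrightarrow> W i \<subseteq> X"
    and mono: "\<And>i. i < n \<Longrightarrow> W i \<subseteq> W (Suc i)"
    and e: "\<And>i. i < n \<Longrightarrow> \<exists>f\<in>polynomial_functions. (\<forall>x\<in>W i. f x = 0) \<and> (\<exists>x\<in>W (Suc i). f x \<noteq> 0)"
  shows "enat n \<le> krull_dim (subtopology zariski X)"
proof -
  define Z where "Z i = subtopology zariski X closure_of (W i)" for i
  have ZX: "Z i \<subseteq> X" for i unfolding Z_def using closure_of_subset_topspace[of "subtopology zariski X"] by simp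
  have "closedin (subtopology zariski X) (Z i)" for i by (simp add: Z_def)
  moreover have "irreducible_space (subtopology (subtopology zariski X) (Z i))" if "i \<le> n" for i
    using zariski_prime_closure(1)[OF prime sub, OF that that] ZX[of i]
    by (simp add: Z_def subtopology_subtopology Int_absorb1 irreducible_space_iff_zariski_prime)
  moreover have "Z i \<subset> Z (Suc i)" if "i < n" for i
  proof -
    have "Z i \<subseteq> Z (Suc i)" unfolding Z_def using mono[OF that] by (rule closure_of_mono)
    moreover obtain f x where f: "f \<in> polynomial_functions" "\<forall>x\<in>W i. f x = 0" "x \<in> W (Suc i)" "f x \<noteq> 0"
      using e[OF \<open>i < n\<close>] by blast
    have "x \<notin> Z i" using zariski_prime_closure(2)[OF prime sub f(1,2)] f(4) that by (auto simp: Z_def)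
    moreover have "x \<in> Z (Suc i)"
      using f(3) sub[of "Suc i"] that closure_of_subset[of "W (Suc i)" "subtopology zariski X"] by (auto simp: Z_def)
    ultimately show ?thesis by blast
  qed
  ultimately have "\<exists>Z. (\<forall>i\<le>n. closedin (subtopology zariski X) (Z i) \<and> irreducible_space (subtopology (subtopology zariski X) (Z i))) \<and>
     (\<forall>i<n. Z i \<subset> Z (Suc i))" by blast
  then show ?thesis unfolding krull_dim_def by (intro Sup_upper) blast
qed

section \<open>Algebraic independence along chains\<close>

text \<open>Bounding each exponent separately, instead of the total degree, gives exactly
  \<open>m ^ n\<close> exponent vectors, which keeps the later count elementary.\<close>

definition exponents :: "nat \<Rightarrow> nat \<Rightarrow> nat list set" where
  "exponents n m = {\<alpha>. set \<alpha> \<subseteq> {..<m} \<and> length \<alpha> = n}"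

fun monomial :: "('w \<Rightarrow> complex) list \<Rightarrow> nat list \<Rightarrow> 'w \<Rightarrow> complex" where
  "monomial (f # fs) (k # \<alpha>) w = f w ^ k * monomial fs \<alpha> w"
| "monomial _ _ w = 1"

definition alg_indep :: "'w set \<Rightarrow> ('w \<Rightarrow> complex) list \<Rightarrow> bool" where
  "alg_indep Z fs \<longleftrightarrow> (\<forall>m c. (\<forall>x\<in>Z. (\<Sum>\<alpha>\<in>exponents (length fs) m. c \<alpha> * monomial fs \<alpha> x) = 0)
     \<longrightarrow> (\<forall>\<alpha>\<in>exponents (length fs) m. c \<alpha> = 0))"

lemma alg_indepD:
  assumes "alg_indep Z fs" "\<forall>x\<in>Z. (\<Sum>\<alpha>\<in>exponents (length fs) m. c \<alpha> * monomial fs \<alpha> x) = 0"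
  shows "\<forall>\<alpha>\<in>exponents (length fs) m. c \<alpha> = 0"
  using assms unfolding alg_indep_def by blast

lemma finite_exponents [simp]: "finite (exponents n m)"
  unfolding exponents_def by (rule finite_lists_length_eq) simp

lemma card_exponents: "card (exponents n m) = m ^ n"
  unfolding exponents_def by (subst card_lists_length_eq) auto

lemma exponents_0: "exponents 0 m = {[]}"
  by (auto simp: exponents_def)

lemma sum_exponents_Suc:
  "(\<Sum>\<alpha>\<in>exponents (Suc n) m. F \<alpha>) = (\<Sum>k<m. \<Sum>\<alpha>\<in>exponents n m. F (k # \<alpha>))"
proof -
  have "bij_betw (\<lambda>(k, \<alpha>). k # \<alpha>) ({..<m} \<times> exponents n m) (exponents (Suc n) m)"
    by (rule bij_betw_byWitness[where f' = "\<lambda>\<alpha>. (hd \<alpha>, tl \<alpha>)"])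
      (auto simp: exponents_def length_Suc_conv)
  from sum.reindex_bij_betw[OF this, of F] show ?thesis
    by (simp add: sum.cartesian_product case_prod_beta)
qed

lemma polynomial_functions_monomial:
  "set fs \<subseteq> polynomial_functions \<Longrightarrow> (\<lambda>A. monomial fs \<alpha> A) \<in> polynomial_functions"
proof (induction fs arbitrary: \<alpha>)
  case Nil
  show ?case by (simp add: polynomial_functions.const)
next
  case (Cons f fs)
  then show ?case
    by (cases \<alpha>) (auto intro!: polynomial_functions.intros polynomial_functions_power)
qed

text \<open>On the irreducible set \<open>Z1\<close> a relation may be divided by the highest power of \<open>f\<close> dividing it; restricting the quotient
  to \<open>Z0\<close> gives a relation between the functions \<open>fs\<close>.\<close>

lemma alg_indep_Cons:
  assumes ind: "alg_indep Z0 fs" and pr: "zariski_prime Z1" and sub: "Z0 \<subseteq> Z1"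
    and fs: "set fs \<subseteq> polynomial_functions" and f: "f \<in> polynomial_functions"
    and f0: "\<And>x. x \<in> Z0 \<Longrightarrow> f x = 0" and f1: "\<exists>x\<in>Z1. f x \<noteq> 0"
  shows "alg_indep Z1 (f # fs)"
  unfolding alg_indep_def
proof (intro allI impI)
  fix m c
  let ?E = "exponents (length fs) m"
  assume "\<forall>x\<in>Z1. (\<Sum>\<alpha>\<in>exponents (length (f # fs)) m. c \<alpha> * monomial (f # fs) \<alpha> x) = 0"
  then have rel: "(\<Sum>k<m. \<Sum>\<alpha>\<in>?E. c (k # \<alpha>) * (f x ^ k * monomial fs \<alpha> x)) = 0" if "x \<in> Z1" for x
    using that by (simp add: sum_exponents_Suc)
  define G where "G k x = (\<Sum>\<alpha>\<in>?E. c (k # \<alpha>) * monomial fs \<alpha> x)" for k x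
  have G: "G k \<in> polynomial_functions" for k
    unfolding G_def using fs
    by (intro polynomial_functions_sum polynomial_functions.mult polynomial_functions.const polynomial_functions_monomial)
  have rel': "(\<Sum>k<m. f x ^ k * G k x) = 0" if "x \<in> Z1" for x
    using rel[OF that] by (simp add: G_def sum_distrib_left mult_ac)
  have zero: "\<forall>\<alpha>\<in>?E. c (k # \<alpha>) = 0" if "k < m" for k
    using that
  proof (induction k rule: less_induct)
    case (less k)
    have Gz: "G j x = 0" if "j < k" for j x
      using less.IH[OF that] that less.prems by (simp add: G_def)
    define H where "H x = (\<Sum>j\<in>{k..<m}. f x ^ (j - k) * G j x)" for x
    have H: "H \<in> polynomial_functions"
      unfolding H_def by (intro polynomial_functions_sum polynomial_functions.mult polynomial_functions_power f G)
    have "\<forall>x\<in>Z1. f x ^ k * H x = 0"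
    proof
      fix x assume x: "x \<in> Z1"
      have "(\<Sum>j<m. f x ^ j * G j x) = (\<Sum>j\<in>{k..<m}. f x ^ j * G j x)"
        using Gz by (intro sum.mono_neutral_right) auto
      also have "\<dots> = f x ^ k * H x"
        unfolding H_def sum_distrib_left by (intro sum.cong) (auto simp flip: mult.assoc power_add)
      finally show "f x ^ k * H x = 0" using rel'[OF x] by simp
    qed
    then have "(\<forall>x\<in>Z1. f x ^ k = 0) \<or> (\<forall>x\<in>Z1. H x = 0)"
      by (rule zariski_primeD[OF pr polynomial_functions_power[OF f] H])
    then have "\<forall>x\<in>Z1. H x = 0" using f1 by auto
    then have "H x = 0" if "x \<in> Z0" for x using that sub by auto
    \<comment> \<open>Since \<open>f\<close> vanishes on \<open>Z0\<close> and
      \<open>0 ^ 0 = 1\<close>, only the term with \<open>j = k\<close> survives.\<close>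
    moreover have "H x = G k x" if "x \<in> Z0" for x
    proof -
      have "H x = (\<Sum>j\<in>{k..<m}. if j = k then G k x else 0)"
        unfolding H_def using f0[OF that] by (intro sum.cong) (auto simp: power_0_left)
      then show ?thesis using less.prems by simp
    qed
    ultimately have "\<forall>x\<in>Z0. (\<Sum>\<alpha>\<in>?E. c (k # \<alpha>) * monomial fs \<alpha> x) = 0"
      by (simp add: G_def)
    then show ?case
      by (rule alg_indepD[OF ind, where c = "\<lambda>\<alpha>. c (k # \<alpha>)"])
  qed
  show "\<forall>\<alpha>\<in>exponents (length (f # fs)) m. c \<alpha> = 0"
  proof
    fix \<alpha> assume "\<alpha> \<in> exponents (length (f # fs)) m"
    then obtain k \<beta> where "\<alpha> = k # \<beta>" "k < m" "\<beta> \<in> ?E"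
      by (auto simp: exponents_def length_Suc_conv)
    then show "c \<alpha> = 0" using zero by blast
  qed
qed

text \<open>Each strict inclusion contributes one function: the smaller set is closed, so some
  polynomial vanishes on it but not on the larger one.\<close>

lemma alg_indep_chain:
  assumes cl: "\<And>i. i \<le> n \<Longrightarrow> closedin (subtopology zariski X) (Z i)"
    and irr: "\<And>i. i \<le> n \<Longrightarrow> zariski_prime (Z i)" and ss: "\<And>i. i < n \<Longrightarrow> Z i \<subset> Z (Suc i)"
  shows "\<exists>fs. length fs = n \<and> set fs \<subseteq> polynomial_functions \<and> alg_indep (Z n) fs"
  using assms
proof (induction n)
  case 0
  have "Z 0 \<noteq> {}" using 0 by (auto simp: zariski_prime_def)
  then have "alg_indep (Z 0) []" by (auto simp: alg_indep_def exponents_0)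
  then show ?case by (intro exI[of _ "[]"]) auto
next
  case (Suc n)
  have "\<exists>fs. length fs = n \<and> set fs \<subseteq> polynomial_functions \<and> alg_indep (Z n) fs"
    by (rule Suc.IH) (use Suc.prems in auto)
  then obtain fs where fs: "length fs = n" "set fs \<subseteq> polynomial_functions" "alg_indep (Z n) fs" by blast
  have ss: "Z n \<subset> Z (Suc n)" using Suc.prems(3) by simp
  then obtain x where x: "x \<in> Z (Suc n)" "x \<notin> Z n" by blast
  obtain P where P: "P \<subseteq> polynomial_functions" "Z n = zero_locus P \<inter> X"
    using Suc.prems(1)[of n] by (auto simp: closedin_subtopology closedin_zariski)
  have "Z (Suc n) \<subseteq> X" using closedin_subset[OF Suc.prems(1)[of "Suc n"]] by simp
  then obtain f where f: "f \<in> P" "f x \<noteq> 0" using x P by (auto simp: zero_locus_def)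
  have "alg_indep (Z (Suc n)) (f # fs)"
    by (rule alg_indep_Cons[OF fs(3) Suc.prems(2)]) (use ss fs f P x in \<open>auto simp: zero_locus_def\<close>)
  then show ?case using fs f P by (intro exI[of _ "f # fs"]) auto
qed

text \<open>Gaussian elimination. The equation \<open>\<kappa>0\<close> removes the unknown
  \<open>\<alpha>0\<close> from the other equations, whose new coefficients are \<open>N\<close>;
  after those are solved, \<open>s\<close> is the value that \<open>\<kappa>0\<close> forces on
  it.\<close>

lemma homogeneous_system_nontrivial:
  fixes M :: "'a \<Rightarrow> 'b \<Rightarrow> complex"
  assumes "finite B" "finite A" "card B < card A"
  shows "\<exists>c. (\<exists>\<alpha>\<in>A. c \<alpha> \<noteq> 0) \<and> (\<forall>\<kappa>\<in>B. (\<Sum>\<alpha>\<in>A. c \<alpha> * M \<alpha> \<kappa>) = 0)"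
  using assms
proof (induction B arbitrary: A M rule: finite_induct)
  case empty
  then obtain \<alpha> where "\<alpha> \<in> A" by (metis card_gt_0_iff card.empty ex_in_conv)
  then show ?case by (intro exI[of _ "\<lambda>_. 1"]) auto
next
  case (insert \<kappa>0 B)
  show ?case
  proof (cases "\<forall>\<alpha>\<in>A. M \<alpha> \<kappa>0 = 0")
    case True
    have "card B < card A" using insert by simp
    then obtain c where "\<exists>\<alpha>\<in>A. c \<alpha> \<noteq> 0" "\<forall>\<kappa>\<in>B. (\<Sum>\<alpha>\<in>A. c \<alpha> * M \<alpha> \<kappa>) = 0"
      using insert.IH[OF insert.prems(1)] by blast
    with True show ?thesis by (intro exI[of _ c]) auto
  next
    case False
    then obtain \<alpha>0 where a: "\<alpha>0 \<in> A" "M \<alpha>0 \<kappa>0 \<noteq> 0" by blast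
    let ?A = "A - {\<alpha>0}"
    define N where "N \<alpha> \<kappa> = M \<alpha> \<kappa> - M \<alpha> \<kappa>0 / M \<alpha>0 \<kappa>0 * M \<alpha>0 \<kappa>" for \<alpha> \<kappa>
    have "card B < card ?A" using insert a by simp
    then obtain c where c: "\<exists>\<alpha>\<in>?A. c \<alpha> \<noteq> 0" "\<forall>\<kappa>\<in>B. (\<Sum>\<alpha>\<in>?A. c \<alpha> * N \<alpha> \<kappa>) = 0"
      using insert.IH[of ?A N] insert.prems(1) by auto
    define s where "s = - (\<Sum>\<alpha>\<in>?A. c \<alpha> * M \<alpha> \<kappa>0) / M \<alpha>0 \<kappa>0"
    define d where "d = c(\<alpha>0 := s)"
    have sm: "(\<Sum>\<alpha>\<in>A. d \<alpha> * M \<alpha> \<kappa>) = s * M \<alpha>0 \<kappa> + (\<Sum>\<alpha>\<in>?A. c \<alpha> * M \<alpha> \<kappa>)" for \<kappa>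
      using a(1) insert.prems(1) by (subst sum.remove[of A \<alpha>0]) (auto simp: d_def)
    have "(\<Sum>\<alpha>\<in>?A. c \<alpha> * N \<alpha> \<kappa>) = (\<Sum>\<alpha>\<in>?A. c \<alpha> * M \<alpha> \<kappa>) + s * M \<alpha>0 \<kappa>" for \<kappa>
      unfolding N_def s_def
      by (simp add: algebra_simps sum_subtractf sum_distrib_left sum_distrib_right sum_divide_distrib)
    then have "(\<Sum>\<alpha>\<in>A. d \<alpha> * M \<alpha> \<kappa>) = 0" if "\<kappa> \<in> B" for \<kappa>
      using c(2) sm that by (simp add: add.commute)
    moreover have "(\<Sum>\<alpha>\<in>A. d \<alpha> * M \<alpha> \<kappa>0) = 0" using sm[of \<kappa>0] a(2) by (simp add: s_def)
    moreover have "\<exists>\<alpha>\<in>A. d \<alpha> \<noteq> 0" using c(1) by (auto simp: d_def)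
    ultimately show ?thesis by blast
  qed
qed

section \<open>Upper bound for the Krull dimension\<close>

text \<open>Polynomial expressions of degree at most \<open>D\<close> in each listed function
  separately, viewed as polynomials in the head with coefficients from the tail. Only membership
  matters, so the functions in the list may satisfy relations.\<close>

fun box_polys :: "('w \<Rightarrow> complex) list \<Rightarrow> nat \<Rightarrow> ('w \<Rightarrow> complex) set" where
  "box_polys [] D = range (\<lambda>c _. c)"
| "box_polys (x # xs) D = {F. \<exists>G. (\<forall>k. G k \<in> box_polys xs D) \<and> F = (\<lambda>w. \<Sum>k\<le>D. G k w * x w ^ k)}"

lemma box_polys_const: "(\<lambda>_. c) \<in> box_polys xs D"
proof (induction xs arbitrary: c)
  case (Cons x xs)
  have "(\<lambda>_. c) = (\<lambda>w. \<Sum>k\<le>D. (if k = 0 then c else 0) * x w ^ k)"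
    by (simp add: if_distrib if_distribR cong: if_cong)
  moreover have "(\<lambda>w. if k = 0 then c else 0) \<in> box_polys xs D" for k :: nat
    using Cons by (cases "k = 0") auto
  ultimately show ?case by (auto intro!: exI[of _ "\<lambda>k w. if k = 0 then c else 0"])
qed simp

lemma box_polys_add: "F \<in> box_polys xs D \<Longrightarrow> G \<in> box_polys xs D \<Longrightarrow> (\<lambda>w. F w + G w) \<in> box_polys xs D"
proof (induction xs arbitrary: F G)
  case (Cons x xs)
  then obtain F' G' where FG: "\<And>k. F' k \<in> box_polys xs D" "F = (\<lambda>w. \<Sum>k\<le>D. F' k w * x w ^ k)"
     "\<And>k. G' k \<in> box_polys xs D" "G = (\<lambda>w. \<Sum>k\<le>D. G' k w * x w ^ k)" by auto
  have "(\<lambda>w. F w + G w) = (\<lambda>w. \<Sum>k\<le>D. (F' k w + G' k w) * x w ^ k)"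
    by (simp add: FG algebra_simps sum.distrib)
  with FG Cons.IH show ?case by (auto intro!: exI[of _ "\<lambda>k w. F' k w + G' k w"])
qed auto

lemma box_polys_sum: "(\<And>i. i \<in> I \<Longrightarrow> F i \<in> box_polys xs D) \<Longrightarrow> (\<lambda>w. \<Sum>i\<in>I. F i w) \<in> box_polys xs D"
  by (induction I rule: infinite_finite_induct) (auto intro: box_polys_const box_polys_add)

lemma box_polys_mono: "F \<in> box_polys xs D \<Longrightarrow> D \<le> E \<Longrightarrow> F \<in> box_polys xs E"
proof (induction xs arbitrary: F)
  case (Cons x xs)
  then obtain G where G: "\<And>k. G k \<in> box_polys xs D" "F = (\<lambda>w. \<Sum>k\<le>D. G k w * x w ^ k)" by auto
  define G' where "G' k = (if k \<le> D then G k else (\<lambda>_. 0))" for k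
  have "(\<Sum>k\<le>E. G' k w * x w ^ k) = F w" for w
    unfolding G(2) using Cons.prems(2) by (intro sum.mono_neutral_cong_right) (auto simp: G'_def)
  then have "F = (\<lambda>w. \<Sum>k\<le>E. G' k w * x w ^ k)" by auto
  moreover have "G' k \<in> box_polys xs E" for k
    using Cons.IH[OF G(1) Cons.prems(2)] by (simp add: G'_def box_polys_const)
  ultimately show ?case by auto
qed simp

lemma box_polys_mult: "F \<in> box_polys xs D \<Longrightarrow> G \<in> box_polys xs E \<Longrightarrow> (\<lambda>w. F w * G w) \<in> box_polys xs (D + E)"
proof (induction xs arbitrary: F G)
  case (Cons x xs)
  then obtain F' G' where FG: "\<And>k. F' k \<in> box_polys xs D" "F = (\<lambda>w. \<Sum>k\<le>D. F' k w * x w ^ k)"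
     "\<And>k. G' k \<in> box_polys xs E" "G = (\<lambda>w. \<Sum>k\<le>E. G' k w * x w ^ k)" by auto
  \<comment> \<open>Padding with zero above the degree bounds makes the Cauchy product formula
    applicable.\<close>
  define a where "a k = (if k \<le> D then F' k else (\<lambda>_. 0))" for k
  define b where "b k = (if k \<le> E then G' k else (\<lambda>_. 0))" for k
  have ab: "a k \<in> box_polys xs D" "b k \<in> box_polys xs E" for k
    using FG by (simp_all add: a_def b_def box_polys_const)
  have "F w * G w = (\<Sum>r\<le>D + E. (\<Sum>k\<le>r. a k w * b (r - k) w) * x w ^ r)" for w
  proof -
    have "F w * G w = (\<Sum>i\<le>D. a i w * x w ^ i) * (\<Sum>j\<le>E. b j w * x w ^ j)"
      by (simp add: FG a_def b_def)
    also have "\<dots> = (\<Sum>r\<le>D + E. (\<Sum>k\<le>r. a k w * b (r - k) w) * x w ^ r)"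
      by (rule polynomial_product) (auto simp: a_def b_def)
    finally show ?thesis .
  qed
  moreover have "(\<lambda>w. \<Sum>k\<le>r. a k w * b (r - k) w) \<in> box_polys xs (D + E)" for r
    using ab Cons.IH by (intro box_polys_sum) blast
  ultimately show ?case by (auto intro!: exI[of _ "\<lambda>r w. \<Sum>k\<le>r. a k w * b (r - k) w"])
qed auto

lemma box_polys_power: "F \<in> box_polys xs D \<Longrightarrow> (\<lambda>w. F w ^ k) \<in> box_polys xs (k * D)"
  by (induction k) (auto intro: box_polys_const dest: box_polys_mult)

lemma box_polys_coordinate: "x \<in> set xs \<Longrightarrow> x \<in> box_polys xs 1"
proof (induction xs)
  case (Cons y xs)
  show ?case
  proof (cases "x = y")
    case True
    then show ?thesis by (auto intro!: exI[of _ "\<lambda>k w. if k = 1 then 1 else 0"] box_polys_const)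
  next
    case False
    with Cons have x: "x \<in> box_polys xs 1" by simp
    have "(\<lambda>w. if k = 0 then x w else 0) \<in> box_polys xs 1" for k :: nat
      using x by (cases "k = 0") (auto intro: box_polys_const)
    then show ?thesis by (auto intro!: exI[of _ "\<lambda>k w. if k = 0 then x w else 0"])
  qed
qed simp

lemma box_polys_expansion:
  "F \<in> box_polys xs D \<Longrightarrow> \<exists>a. \<forall>w. F w = (\<Sum>\<kappa>\<in>exponents (length xs) (Suc D). a \<kappa> * monomial xs \<kappa> w)"
proof (induction xs arbitrary: F)
  case Nil
  then obtain c where "F = (\<lambda>_. c)" by auto
  then show ?case by (intro exI[of _ "\<lambda>_. c"]) (simp add: exponents_0)
next
  case (Cons x xs)
  then obtain G where G: "\<And>k. G k \<in> box_polys xs D" "F = (\<lambda>w. \<Sum>k\<le>D. G k w * x w ^ k)" by auto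
  have "\<forall>k. \<exists>a. \<forall>w. G k w = (\<Sum>\<kappa>\<in>exponents (length xs) (Suc D). a \<kappa> * monomial xs \<kappa> w)"
    using Cons.IH G(1) by blast
  then obtain a where a: "\<And>k w. G k w = (\<Sum>\<kappa>\<in>exponents (length xs) (Suc D). a k \<kappa> * monomial xs \<kappa> w)" by metis
  show ?case
    by (rule exI[of _ "\<lambda>\<kappa>. a (hd \<kappa>) (tl \<kappa>)"])
      (simp add: sum_exponents_Suc G(2) a lessThan_Suc_atMost sum_distrib_left mult_ac)
qed

lemma box_polys_monomial:
  assumes "\<And>f. f \<in> set fs \<Longrightarrow> (\<lambda>w. f (\<Phi> w)) \<in> box_polys xs D" "\<alpha> \<in> exponents (length fs) m"
  shows "(\<lambda>w. monomial fs \<alpha> (\<Phi> w)) \<in> box_polys xs (length fs * (m * D))"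
  using assms
proof (induction fs arbitrary: \<alpha>)
  case Nil
  then show ?case using box_polys_const[of 1] by (auto simp: exponents_0)
next
  case (Cons f fs)
  then obtain k \<beta> where \<alpha>: "\<alpha> = k # \<beta>" "k < m" "\<beta> \<in> exponents (length fs) m"
    by (auto simp: exponents_def length_Suc_conv)
  have "(\<lambda>w. f (\<Phi> w) ^ k) \<in> box_polys xs (k * D)"
    using Cons.prems(1) by (intro box_polys_power) simp
  then have "(\<lambda>w. f (\<Phi> w) ^ k) \<in> box_polys xs (m * D)"
    by (rule box_polys_mono) (use \<alpha> in simp)
  from box_polys_mult[OF this Cons.IH[OF Cons.prems(1) \<alpha>(3)]] show ?case
    by (simp add: \<alpha>(1))
qed

lemma polynomial_functions_box:
  assumes "f \<in> polynomial_functions" "\<And>i j. \<exists>D. (\<lambda>w. \<Phi> w $ i $ j) \<in> box_polys xs D"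
  shows "\<exists>D. (\<lambda>w. f (\<Phi> w)) \<in> box_polys xs D"
  using assms(1)
proof induction
  case (add f g)
  then obtain D E where "(\<lambda>w. f (\<Phi> w)) \<in> box_polys xs D" "(\<lambda>w. g (\<Phi> w)) \<in> box_polys xs E" by blast
  then have "(\<lambda>w. f (\<Phi> w)) \<in> box_polys xs (D + E)" "(\<lambda>w. g (\<Phi> w)) \<in> box_polys xs (D + E)"
    by (auto elim: box_polys_mono)
  then show ?case using box_polys_add by blast
qed (use assms(2) box_polys_const box_polys_mult in blast)+

text \<open>There are \<open>m ^ length fs\<close> monomials of degree less than \<open>m\<close> in each \<open>f\<close>; composed with \<open>\<Phi>\<close> they lie in a space whose dimension
  grows like \<open>m ^ length xs\<close>.\<close>

lemma alg_indep_length_le: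
  assumes fs: "set fs \<subseteq> polynomial_functions" and ind: "alg_indep X fs"
    and \<Phi>: "\<And>i j. \<exists>D. (\<lambda>w. \<Phi> w $ i $ j) \<in> box_polys xs D"
    and dense: "\<And>f. f \<in> polynomial_functions \<Longrightarrow> \<forall>w. f (\<Phi> w) = 0 \<Longrightarrow> \<forall>x\<in>X. f x = 0"
  shows "length fs \<le> length xs"
proof (rule ccontr)
  let ?n = "length fs" and ?r = "length xs"
  assume "\<not> ?n \<le> ?r"
  then have nr: "Suc ?r \<le> ?n" by simp
  have "\<exists>D. \<forall>f\<in>set fs. (\<lambda>w. f (\<Phi> w)) \<in> box_polys xs D"
    using fs
  proof (induction fs)
    case (Cons f fs)
    then obtain D where "\<forall>f\<in>set fs. (\<lambda>w. f (\<Phi> w)) \<in> box_polys xs D" by auto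
    moreover obtain E where "(\<lambda>w. f (\<Phi> w)) \<in> box_polys xs E"
      using polynomial_functions_box[OF _ \<Phi>, of f] Cons.prems by auto
    ultimately show ?case by (intro exI[of _ "D + E"]) (auto intro: box_polys_mono)
  qed simp
  then obtain D where D: "\<And>f. f \<in> set fs \<Longrightarrow> (\<lambda>w. f (\<Phi> w)) \<in> box_polys xs D" by blast
  \<comment> \<open>Write \<open>n\<close> and \<open>r\<close> for the lengths of \<open>fs\<close>
    and \<open>xs\<close>. As \<open>m\<close> exceeds \<open>(n * D + 1) ^ r\<close>, the box has
    at most \<open>(m * (n * D + 1)) ^ r\<close>, hence fewer than \<open>m ^ (r + 1)\<close>,
    exponents, and the monomials in \<open>fs\<close> outnumber it.\<close>
  define m where "m = Suc ((?n * D + 1) ^ ?r)"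
  define B where "B = exponents ?r (Suc (?n * (m * D)))"
  have "\<exists>a. \<forall>w. monomial fs \<alpha> (\<Phi> w) = (\<Sum>\<kappa>\<in>B. a \<kappa> * monomial xs \<kappa> w)" if "\<alpha> \<in> exponents ?n m" for \<alpha>
    unfolding B_def by (rule box_polys_expansion[OF box_polys_monomial[OF D that]])
  then have "\<forall>\<alpha>\<in>exponents ?n m. \<exists>a. \<forall>w. monomial fs \<alpha> (\<Phi> w) = (\<Sum>\<kappa>\<in>B. a \<kappa> * monomial xs \<kappa> w)" by blast
  from bchoice[OF this] obtain a where a: "\<And>\<alpha> w. \<alpha> \<in> exponents ?n m \<Longrightarrow> monomial fs \<alpha> (\<Phi> w) = (\<Sum>\<kappa>\<in>B. a \<alpha> \<kappa> * monomial xs \<kappa> w)"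
    by blast
  have "card B = (Suc (?n * (m * D))) ^ ?r" by (simp add: B_def card_exponents)
  also have "\<dots> \<le> (m * (?n * D + 1)) ^ ?r"
    by (intro power_mono) (auto simp: m_def algebra_simps)
  also have "\<dots> = m ^ ?r * (?n * D + 1) ^ ?r" by (rule power_mult_distrib)
  also have "\<dots> < m ^ ?r * m" by (intro mult_strict_left_mono) (auto simp: m_def)
  also have "\<dots> = m ^ Suc ?r" by simp
  also have "\<dots> \<le> m ^ ?n" using nr by (intro power_increasing) (auto simp: m_def)
  also have "\<dots> = card (exponents ?n m)" by (simp add: card_exponents)
  finally have "card B < card (exponents ?n m)" .
  moreover have "finite B" by (simp add: B_def)
  ultimately obtain c where c: "\<exists>\<alpha>\<in>exponents ?n m. c \<alpha> \<noteq> 0" "\<forall>\<kappa>\<in>B. (\<Sum>\<alpha>\<in>exponents ?n m. c \<alpha> * a \<alpha> \<kappa>) = 0"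
    using homogeneous_system_nontrivial[of B "exponents ?n m" a] by auto
  define F where "F x = (\<Sum>\<alpha>\<in>exponents ?n m. c \<alpha> * monomial fs \<alpha> x)" for x
  have "F \<in> polynomial_functions"
    unfolding F_def using fs
    by (intro polynomial_functions_sum polynomial_functions.mult polynomial_functions.const polynomial_functions_monomial)
  moreover have "F (\<Phi> w) = 0" for w
  proof -
    have "F (\<Phi> w) = (\<Sum>\<alpha>\<in>exponents ?n m. \<Sum>\<kappa>\<in>B. (c \<alpha> * a \<alpha> \<kappa>) * monomial xs \<kappa> w)"
      unfolding F_def by (intro sum.cong) (simp_all add: a sum_distrib_left mult_ac)
    also have "\<dots> = (\<Sum>\<kappa>\<in>B. (\<Sum>\<alpha>\<in>exponents ?n m. c \<alpha> * a \<alpha> \<kappa>) * monomial xs \<kappa> w)"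
      by (subst sum.swap) (simp add: sum_distrib_right)
    finally show ?thesis using c(2) by simp
  qed
  ultimately have "\<forall>x\<in>X. F x = 0" using dense by blast
  then show False using ind c(1) unfolding alg_indep_def F_def by blast
qed

text \<open>\<open>\<Phi>\<close> is a polynomial parametrization with dense image in the sense that
  matters for functions. It may pass through points outside \<open>X\<close>, such as the vertex of
  a cone.\<close>

lemma krull_dim_le:
  assumes \<Phi>: "\<And>i j. \<exists>D. (\<lambda>w. \<Phi> w $ i $ j) \<in> box_polys xs D"
    and dense: "\<And>f. f \<in> polynomial_functions \<Longrightarrow> \<forall>w. f (\<Phi> w) = 0 \<Longrightarrow> \<forall>x\<in>X. f x = 0"
  shows "krull_dim (subtopology zariski X) \<le> enat (length xs)"
  unfolding krull_dim_def
proof (rule Sup_least)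
  fix d assume "d \<in> {enat n |n. \<exists>Z. (\<forall>i\<le>n. closedin (subtopology zariski X) (Z i) \<and>
        irreducible_space (subtopology (subtopology zariski X) (Z i))) \<and> (\<forall>i<n. Z i \<subset> Z (Suc i))}"
  then obtain n Z where n: "d = enat n" and Z: "\<And>i. i \<le> n \<Longrightarrow> closedin (subtopology zariski X) (Z i)"
      "\<And>i. i \<le> n \<Longrightarrow> irreducible_space (subtopology (subtopology zariski X) (Z i))" "\<And>i. i < n \<Longrightarrow> Z i \<subset> Z (Suc i)"
    by blast
  have ZX: "Z i \<subseteq> X" if "i \<le> n" for i using closedin_subset[OF Z(1)[OF that]] by simp
  have "zariski_prime (Z i)" if "i \<le> n" for i
    using Z(2)[OF that] ZX[OF that]
    by (simp add: subtopology_subtopology Int_absorb1 irreducible_space_iff_zariski_prime)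
  then obtain fs where fs: "length fs = n" "set fs \<subseteq> polynomial_functions" "alg_indep (Z n) fs"
    using alg_indep_chain[of n X Z] Z by blast
  have "length fs \<le> length xs"
    by (rule alg_indep_length_le[OF fs(2,3) \<Phi>]) (use dense ZX in blast)+
  then show "d \<le> enat (length xs)" using fs n by simp
qed

section \<open>Centralizers in \<open>sp\<^sub>4\<close>\<close>

lemma sp4_iff:
  "X \<in> sp4 \<longleftrightarrow> X $ 3 $ 3 = - X $ 1 $ 1 \<and> X $ 3 $ 4 = - X $ 2 $ 1 \<and> X $ 4 $ 3 = - X $ 1 $ 2 \<and> X $ 4 $ 4 = - X $ 2 $ 2
     \<and> X $ 1 $ 4 = X $ 2 $ 3 \<and> X $ 3 $ 2 = X $ 4 $ 1"
proof -
  have l: "(symplectic_form ** X) $ 1 = X $ 3" "(symplectic_form ** X) $ 2 = X $ 4"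
    "(symplectic_form ** X) $ 3 = - (X $ 1)" "(symplectic_form ** X) $ 4 = - (X $ 2)"
    by (simp_all add: vec_eq_iff matrix_matrix_mult_def symplectic_form_def sum_4)
  have r: "(transpose X ** symplectic_form) $ i $ 1 = - X $ 3 $ i" "(transpose X ** symplectic_form) $ i $ 2 = - X $ 4 $ i"
    "(transpose X ** symplectic_form) $ i $ 3 = X $ 1 $ i" "(transpose X ** symplectic_form) $ i $ 4 = X $ 2 $ i" for i
    by (simp_all add: matrix_matrix_mult_def symplectic_form_def sum_4 transpose_def)
  show ?thesis
    unfolding sp4_eq mem_Collect_eq vec_eq_iff forall_4 vector_add_component l r
    by (auto simp: add_eq_0_iff)
qed

lemma symplectic_mult_nth:
  "(symplectic_form ** X) $ 1 = X $ 3" "(symplectic_form ** X) $ 2 = X $ 4"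
  "(symplectic_form ** X) $ 3 = - (X $ 1)" "(symplectic_form ** X) $ 4 = - (X $ 2)"
  for X :: "complex^4^4"
  by (simp_all add: vec_eq_iff matrix_matrix_mult_def symplectic_form_def sum_4)

section \<open>Equations of the two cones\<close>

text \<open>A quarter of the trace of \<open>X ** X\<close> when \<open>X\<close> is in
  \<open>sp4\<close>, since the last two diagonal entries of the square repeat the first
  two.\<close>

definition sp4_mean :: "complex^4^4 \<Rightarrow> complex" where
  "sp4_mean X = ((X ** X) $ 1 $ 1 + (X ** X) $ 2 $ 2) / 2"

definition sp4_nil :: "complex^4^4 \<Rightarrow> complex^4^4" where
  "sp4_nil X = X ** X - mat (sp4_mean X)"

text \<open>This is \<open>X ** X ** X\<close> minus twice \<open>sp4_mean X\<close> times
  \<open>X\<close>.\<close>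

definition sp4_cubic :: "complex^4^4 \<Rightarrow> complex^4^4" where
  "sp4_cubic X = sp4_nil X ** X - cmat_scale (sp4_mean X) X"

text \<open>The square \<open>E\<close> of an element of \<open>sp4\<close> makes
  \<open>symplectic_form ** E\<close> skew, which leaves six dimensions; splitting off the scalars
  leaves the five entries on which the others depend here.\<close>

lemma sp4_nil_nth:
  assumes "X \<in> sp4"
  shows "sp4_nil X $ 2 $ 2 = - sp4_nil X $ 1 $ 1" "sp4_nil X $ 3 $ 3 = sp4_nil X $ 1 $ 1" "sp4_nil X $ 4 $ 4 = - sp4_nil X $ 1 $ 1"
    "sp4_nil X $ 1 $ 3 = 0" "sp4_nil X $ 2 $ 4 = 0" "sp4_nil X $ 3 $ 1 = 0" "sp4_nil X $ 4 $ 2 = 0"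
    "sp4_nil X $ 4 $ 3 = sp4_nil X $ 1 $ 2" "sp4_nil X $ 3 $ 4 = sp4_nil X $ 2 $ 1"
    "sp4_nil X $ 2 $ 3 = - sp4_nil X $ 1 $ 4" "sp4_nil X $ 4 $ 1 = - sp4_nil X $ 3 $ 2"
  using assms unfolding sp4_iff
  by (simp_all add: sp4_nil_def sp4_mean_def mat_def matrix_matrix_mult_def sum_4 field_simps)

text \<open>The identity \<open>(X\<^sup>2 - m)\<^sup>2 = q\<close>. It holds for every matrix of
  the five-dimensional shape of \<open>sp4_nil_nth\<close>: these matrices behave like the vectors
  of a Clifford algebra, whose squares are scalars.\<close>

lemma sp4_nil_square:
  assumes "X \<in> sp4"
  shows "sp4_nil X ** sp4_nil X = mat ((sp4_nil X ** sp4_nil X) $ 1 $ 1)"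
  by (simp add: vec_eq_iff forall_4 matrix_matrix_mult_def mat_def sum_4 sp4_nil_nth[OF assms])

definition minor3 :: "complex^'n^'m \<Rightarrow> 'm \<Rightarrow> 'm \<Rightarrow> 'm \<Rightarrow> 'n \<Rightarrow> 'n \<Rightarrow> 'n \<Rightarrow> complex" where
  "minor3 S a b c i j k = S $ a $ i * (S $ b $ j * S $ c $ k - S $ b $ k * S $ c $ j)
     - S $ a $ j * (S $ b $ i * S $ c $ k - S $ b $ k * S $ c $ i)
     + S $ a $ k * (S $ b $ i * S $ c $ j - S $ b $ j * S $ c $ i)"

lemma minor3_swap:
  "minor3 S b a c i j k = - minor3 S a b c i j k" "minor3 S a c b i j k = - minor3 S a b c i j k"
  "minor3 S a b c j i k = - minor3 S a b c i j k" "minor3 S a b c i k j = - minor3 S a b c i j k"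
  by (simp_all add: minor3_def algebra_simps)

lemma minor3_eq:
  "minor3 S a a c i j k = 0" "minor3 S a b b i j k = 0" "minor3 S a b a i j k = 0"
  "minor3 S a b c i i k = 0" "minor3 S a b c i j j = 0" "minor3 S a b c i j i = 0"
  by (simp_all add: minor3_def algebra_simps)

text \<open>Each instance removes one inversion, so rewriting sorts the row and column indices,
  whereas the general swaps would loop.\<close>

lemmas minor3_sort =
  minor3_swap(1)[where a = 1 and b = 2] minor3_swap(1)[where a = 1 and b = 3] minor3_swap(1)[where a = 1 and b = 4]
  minor3_swap(1)[where a = 2 and b = 3] minor3_swap(1)[where a = 2 and b = 4] minor3_swap(1)[where a = 3 and b = 4]
  minor3_swap(2)[where b = 1 and c = 2] minor3_swap(2)[where b = 1 and c = 3] minor3_swap(2)[where b = 1 and c = 4]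
  minor3_swap(2)[where b = 2 and c = 3] minor3_swap(2)[where b = 2 and c = 4] minor3_swap(2)[where b = 3 and c = 4]
  minor3_swap(3)[where i = 1 and j = 2] minor3_swap(3)[where i = 1 and j = 3] minor3_swap(3)[where i = 1 and j = 4]
  minor3_swap(3)[where i = 2 and j = 3] minor3_swap(3)[where i = 2 and j = 4] minor3_swap(3)[where i = 3 and j = 4]
  minor3_swap(4)[where j = 1 and k = 2] minor3_swap(4)[where j = 1 and k = 3] minor3_swap(4)[where j = 1 and k = 4]
  minor3_swap(4)[where j = 2 and k = 3] minor3_swap(4)[where j = 2 and k = 4] minor3_swap(4)[where j = 3 and k = 4]

text \<open>Since \<open>sp4_nil X $ 1 $ 1\<close> is \<open>sp4_mean X - E $ 2 $ 2\<close>, and its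
  negative is \<open>sp4_mean X - E $ 1 $ 1\<close>, the mean cancels, and the entries become cubic
  forms without denominators.\<close>

lemma sp4_cubic_nth:
  fixes X :: "complex^4^4"
  assumes "X \<in> sp4"
  defines "Y \<equiv> sp4_cubic X" and "E \<equiv> X ** X"
  shows "Y $ 1 $ j = - E $ 2 $ 2 * X $ 1 $ j + E $ 1 $ 2 * X $ 2 $ j + E $ 1 $ 4 * X $ 4 $ j"
    "Y $ 2 $ j = E $ 2 $ 1 * X $ 1 $ j - E $ 1 $ 1 * X $ 2 $ j - E $ 1 $ 4 * X $ 3 $ j"
    "Y $ 3 $ j = E $ 3 $ 2 * X $ 2 $ j - E $ 2 $ 2 * X $ 3 $ j + E $ 2 $ 1 * X $ 4 $ j"
    "Y $ 4 $ j = - E $ 3 $ 2 * X $ 1 $ j + E $ 1 $ 2 * X $ 3 $ j - E $ 1 $ 1 * X $ 4 $ j"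
proof -
  note N = sp4_nil_nth[OF assms(1)]
  have e: "sp4_nil X $ 1 $ 1 = sp4_mean X - E $ 2 $ 2" "- sp4_nil X $ 1 $ 1 = sp4_mean X - E $ 1 $ 1"
    by (simp_all add: sp4_nil_def sp4_mean_def mat_def E_def field_simps)
  have o: "sp4_nil X $ 1 $ 2 = E $ 1 $ 2" "sp4_nil X $ 2 $ 1 = E $ 2 $ 1" "sp4_nil X $ 1 $ 4 = E $ 1 $ 4" "sp4_nil X $ 3 $ 2 = E $ 3 $ 2"
    by (simp_all add: sp4_nil_def mat_def E_def)
  have Y: "Y $ i $ j = (sp4_nil X $ i $ 1 * X $ 1 $ j + sp4_nil X $ i $ 2 * X $ 2 $ j
      + sp4_nil X $ i $ 3 * X $ 3 $ j + sp4_nil X $ i $ 4 * X $ 4 $ j) - sp4_mean X * X $ i $ j" for i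
    by (simp add: Y_def sp4_cubic_def cmat_scale_def map_matrix_def matrix_matrix_mult_def sum_4)
  show "Y $ 1 $ j = - E $ 2 $ 2 * X $ 1 $ j + E $ 1 $ 2 * X $ 2 $ j + E $ 1 $ 4 * X $ 4 $ j"
    unfolding Y N o e(1) by (simp add: algebra_simps)
  show "Y $ 2 $ j = E $ 2 $ 1 * X $ 1 $ j - E $ 1 $ 1 * X $ 2 $ j - E $ 1 $ 4 * X $ 3 $ j"
    unfolding Y N o e(2) by (simp add: algebra_simps)
  show "Y $ 3 $ j = E $ 3 $ 2 * X $ 2 $ j - E $ 2 $ 2 * X $ 3 $ j + E $ 2 $ 1 * X $ 4 $ j"
    unfolding Y N o e(1) by (simp add: algebra_simps)
  show "Y $ 4 $ j = - E $ 3 $ 2 * X $ 1 $ j + E $ 1 $ 2 * X $ 3 $ j - E $ 1 $ 1 * X $ 4 $ j"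
    unfolding Y N o e(2) by (simp add: algebra_simps)
qed

text \<open>The adjugate of \<open>J X\<close> is \<open>(X\<^sup>3 - 2 m X) J\<close>, by the Cayley--Hamilton identity \<open>(X\<^sup>2 - m)\<^sup>2 = q\<close>.\<close>

lemma minor3_adjugate:
  fixes X :: "complex^4^4"
  assumes "X \<in> sp4"
  shows "minor3 (symplectic_form ** X) 2 3 4 2 3 4 = - sp4_cubic X $ 1 $ 3"
    and "minor3 (symplectic_form ** X) 1 3 4 2 3 4 = sp4_cubic X $ 1 $ 4"
    and "minor3 (symplectic_form ** X) 1 2 4 2 3 4 = sp4_cubic X $ 1 $ 1"
    and "minor3 (symplectic_form ** X) 1 2 3 2 3 4 = - sp4_cubic X $ 1 $ 2"
    and "minor3 (symplectic_form ** X) 2 3 4 1 3 4 = sp4_cubic X $ 2 $ 3"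
    and "minor3 (symplectic_form ** X) 1 3 4 1 3 4 = - sp4_cubic X $ 2 $ 4"
    and "minor3 (symplectic_form ** X) 1 2 4 1 3 4 = - sp4_cubic X $ 2 $ 1"
    and "minor3 (symplectic_form ** X) 1 2 3 1 3 4 = sp4_cubic X $ 2 $ 2"
    and "minor3 (symplectic_form ** X) 2 3 4 1 2 4 = - sp4_cubic X $ 3 $ 3"
    and "minor3 (symplectic_form ** X) 1 3 4 1 2 4 = sp4_cubic X $ 3 $ 4"
    and "minor3 (symplectic_form ** X) 1 2 4 1 2 4 = sp4_cubic X $ 3 $ 1"
    and "minor3 (symplectic_form ** X) 1 2 3 1 2 4 = - sp4_cubic X $ 3 $ 2"
    and "minor3 (symplectic_form ** X) 2 3 4 1 2 3 = sp4_cubic X $ 4 $ 3"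
    and "minor3 (symplectic_form ** X) 1 3 4 1 2 3 = - sp4_cubic X $ 4 $ 4"
    and "minor3 (symplectic_form ** X) 1 2 4 1 2 3 = - sp4_cubic X $ 4 $ 1"
    and "minor3 (symplectic_form ** X) 1 2 3 1 2 3 = sp4_cubic X $ 4 $ 2"
proof -
  note X = assms[unfolded sp4_iff]
  have E: "(X ** X) $ i $ j = X $ i $ 1 * X $ 1 $ j + X $ i $ 2 * X $ 2 $ j + X $ i $ 3 * X $ 3 $ j + X $ i $ 4 * X $ 4 $ j" for i j
    by (simp add: matrix_matrix_mult_def sum_4)
  note simps = minor3_def symplectic_mult_nth sp4_cubic_nth[OF assms] E
  show "minor3 (symplectic_form ** X) 2 3 4 2 3 4 = - sp4_cubic X $ 1 $ 3"
    using X by (simp add: simps algebra_simps)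
  show "minor3 (symplectic_form ** X) 1 3 4 2 3 4 = sp4_cubic X $ 1 $ 4"
    using X by (simp add: simps algebra_simps)
  show "minor3 (symplectic_form ** X) 1 2 4 2 3 4 = sp4_cubic X $ 1 $ 1"
    using X by (simp add: simps algebra_simps)
  show "minor3 (symplectic_form ** X) 1 2 3 2 3 4 = - sp4_cubic X $ 1 $ 2"
    using X by (simp add: simps algebra_simps)
  show "minor3 (symplectic_form ** X) 2 3 4 1 3 4 = sp4_cubic X $ 2 $ 3"
    using X by (simp add: simps algebra_simps)
  show "minor3 (symplectic_form ** X) 1 3 4 1 3 4 = - sp4_cubic X $ 2 $ 4"
    using X by (simp add: simps algebra_simps)
  show "minor3 (symplectic_form ** X) 1 2 4 1 3 4 = - sp4_cubic X $ 2 $ 1"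
    using X by (simp add: simps algebra_simps)
  show "minor3 (symplectic_form ** X) 1 2 3 1 3 4 = sp4_cubic X $ 2 $ 2"
    using X by (simp add: simps algebra_simps)
  show "minor3 (symplectic_form ** X) 2 3 4 1 2 4 = - sp4_cubic X $ 3 $ 3"
    using X by (simp add: simps algebra_simps)
  show "minor3 (symplectic_form ** X) 1 3 4 1 2 4 = sp4_cubic X $ 3 $ 4"
    using X by (simp add: simps algebra_simps)
  show "minor3 (symplectic_form ** X) 1 2 4 1 2 4 = sp4_cubic X $ 3 $ 1"
    using X by (simp add: simps algebra_simps)
  show "minor3 (symplectic_form ** X) 1 2 3 1 2 4 = - sp4_cubic X $ 3 $ 2"
    using X by (simp add: simps algebra_simps)
  show "minor3 (symplectic_form ** X) 2 3 4 1 2 3 = sp4_cubic X $ 4 $ 3"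
    using X by (simp add: simps algebra_simps)
  show "minor3 (symplectic_form ** X) 1 3 4 1 2 3 = - sp4_cubic X $ 4 $ 4"
    using X by (simp add: simps algebra_simps)
  show "minor3 (symplectic_form ** X) 1 2 4 1 2 3 = - sp4_cubic X $ 4 $ 1"
    using X by (simp add: simps algebra_simps)
  show "minor3 (symplectic_form ** X) 1 2 3 1 2 3 = sp4_cubic X $ 4 $ 2"
    using X by (simp add: simps algebra_simps)
qed

lemma minor3_zero:
  fixes X :: "complex^4^4"
  assumes X: "X \<in> sp4" and eq: "sp4_cubic X = 0"
  shows "minor3 (symplectic_form ** X) a b c i j k = 0"
proof -
  have base: "minor3 (symplectic_form ** X) a b c i j k = 0"
    if "(a, b, c) \<in> {(1,2,3), (1,2,4), (1,3,4), (2,3,4)}" "(i, j, k) \<in> {(1,2,3), (1,2,4), (1,3,4), (2,3,4)}" for a b c i j k :: 4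
    using that minor3_adjugate[OF X] by (auto simp: eq)
  have rows: "minor3 (symplectic_form ** X) a b c i j k = 0"
    if "(i, j, k) \<in> {(1,2,3), (1,2,4), (1,3,4), (2,3,4)}" for a b c i j k :: 4
    using base[OF _ that] exhaust_4[of a] exhaust_4[of b] exhaust_4[of c]
    by (elim disjE) (simp_all add: minor3_eq minor3_sort)
  show ?thesis
    using rows exhaust_4[of i] exhaust_4[of j] exhaust_4[of k]
    by (elim disjE) (simp_all add: minor3_eq minor3_sort)
qed

lemma cmat_scale_nth [simp]: "cmat_scale c A $ i $ j = c * A $ i $ j"
  by (simp add: cmat_scale_def map_matrix_def)

lemma cmat_scale_mult_left: "cmat_scale c A ** B = cmat_scale c (A ** B)"
  by (simp add: vec_eq_iff matrix_matrix_mult_def sum_distrib_left mult.assoc)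

lemma cmat_scale_mult_right: "A ** cmat_scale c B = cmat_scale c (A ** B)"
  by (simp add: vec_eq_iff matrix_matrix_mult_def sum_distrib_left mult_ac)

lemma mat_mult_left: "mat c ** A = cmat_scale c A"
  by (simp add: vec_eq_iff matrix_matrix_mult_def mat_def if_distrib if_distribR sum.delta cong: if_cong)

lemma mat_mult_right: "A ** mat c = cmat_scale c A"
  by (simp add: vec_eq_iff matrix_matrix_mult_def mat_def if_distrib if_distribR sum.delta mult.commute cong: if_cong)

lemma cmat_scale_vector_mult: "cmat_scale c A *v x = c *s (A *v x)"
  by (simp add: vec_eq_iff matrix_vector_mult_def sum_distrib_left mult.assoc)

lemma mat_vector_mult: "mat c *v x = c *s (x :: complex^'n)"
  by (simp add: vec_eq_iff matrix_vector_mult_def mat_def if_distrib if_distribR sum.delta cong: if_cong)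

lemma cmat_scale_0_right [simp]: "cmat_scale c 0 = 0"
  by (simp add: vec_eq_iff)

lemmas matrix_mult_minus_right = bounded_bilinear.minus_right[OF bounded_bilinear_matrix_mult]
lemmas matrix_mult_minus_left = bounded_bilinear.minus_left[OF bounded_bilinear_matrix_mult]

lemma minor3_sym_prod: "minor3 (sym_prod u v) a b c i j k = 0"
  by (simp add: minor3_def sym_prod_def algebra_simps)

lemma sum_squares_sym_prod:
  "(\<chi> k l. a $ k * a $ l + w $ k * w $ l) = sym_prod ((1/2) *s (a + \<i> *s w)) (a - \<i> *s w)"
  by (simp add: vec_eq_iff sym_prod_def algebra_simps add_divide_distrib)

text \<open>With a nonzero pivot \<open>S $ i $ i\<close>, completing the square leaves
  \<open>M\<close>, whose two by two minors are the pivot times three by three minors of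
  \<open>S\<close> by Sylvester's identity; so \<open>M\<close> is a square and \<open>S\<close> a
  sum of two squares. If the diagonal vanishes, the minors with a nonzero entry
  \<open>S $ i $ j\<close> express \<open>S\<close> directly as the product of rows \<open>i\<close>
  and \<open>j\<close> divided by that entry.\<close>

lemma sym_rank2_if_minors:
  fixes S :: "complex^'n^'n"
  assumes sym: "\<And>i j. S $ j $ i = S $ i $ j" and "S \<noteq> 0" and minors: "\<And>a b c i j k. minor3 S a b c i j k = 0"
  shows "S \<in> sym_rank2"
proof (cases "\<exists>i. S $ i $ i \<noteq> 0")
  case True
  then obtain i where i: "S $ i $ i \<noteq> 0" by blast
  define M where "M k l = S $ i $ i * S $ k $ l - S $ k $ i * S $ i $ l" for k l
  have M: "M k l * M m n = M k n * M m l" for k l m n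
  proof -
    have "M k l * M m n - M k n * M m l = S $ i $ i * minor3 S i k m i l n"
      by (simp add: M_def minor3_def algebra_simps)
    then show ?thesis using minors by simp
  qed
  have Msym: "M k l = M l k" for k l by (simp add: M_def sym[of k l] sym[of i k] sym[of i l] mult.commute)
  have "\<exists>w. \<forall>k l. M k l = w $ k * w $ l"
  proof (cases "\<exists>k. M k k \<noteq> 0")
    case True
    then obtain k where k: "M k k \<noteq> 0" by blast
    define w where "w = (\<chi> l. M k l / csqrt (M k k))"
    have "M l m = w $ l * w $ m" for l m
    proof -
      have "w $ l * w $ m = M l k * M k m / M k k"
        by (simp add: w_def Msym[of k l] flip: power2_eq_square)
      also have "\<dots> = M l m" using M[of l k k m] k by simp
      finally show ?thesis by simp
    qed
    then show ?thesis by blast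
  next
    case False
    have "M k l * M k l = 0" for k l using M[of k l l k] Msym[of k l] False by simp
    then show ?thesis by (intro exI[of _ 0]) simp
  qed
  then obtain w where w: "\<And>k l. M k l = w $ k * w $ l" by blast
  define c where "c = csqrt (S $ i $ i)"
  have c: "c * c = S $ i $ i" by (simp add: c_def flip: power2_eq_square)
  then have c0: "c \<noteq> 0" using i by auto
  have Skl: "S $ k $ l = (S $ i $ k * S $ i $ l + w $ k * w $ l) / (c * c)" for k l
    using i by (simp add: c M_def sym[of k i] flip: w)
  define T where "T = (\<chi> k l. ((1 / c) *s (S $ i)) $ k * ((1 / c) *s (S $ i)) $ l + ((1 / c) *s w) $ k * ((1 / c) *s w) $ l)"
  have "T $ k $ l = (S $ i $ k * S $ i $ l + w $ k * w $ l) / (c * c)" for k l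
    by (simp add: T_def add_divide_distrib)
  then have "S = T" using Skl by (metis vec_eq_iff)
  then have "S = (\<chi> k l. ((1 / c) *s (S $ i)) $ k * ((1 / c) *s (S $ i)) $ l + ((1 / c) *s w) $ k * ((1 / c) *s w) $ l)"
    by (simp only: T_def)
  then have "\<exists>u v. S = sym_prod u v" unfolding sum_squares_sym_prod by blast
  then show ?thesis using assms(2) unfolding sym_rank2_def by blast
next
  case False
  obtain i j where ij: "S $ i $ j \<noteq> 0" using assms(2) by (auto simp: vec_eq_iff)
  have Skl: "S $ k $ l = (S $ i $ k * S $ j $ l + S $ j $ k * S $ i $ l) / S $ i $ j" for k l
  proof -
    have "S $ i $ j * (S $ j $ l * S $ i $ k + S $ i $ l * S $ j $ k - S $ i $ j * S $ k $ l) = minor3 S i j k i j l"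
      using False sym[of i j] sym[of i k] sym[of j k] by (simp add: minor3_def algebra_simps)
    then have "S $ j $ l * S $ i $ k + S $ i $ l * S $ j $ k = S $ i $ j * S $ k $ l" using ij minors by simp
    then show ?thesis using ij by (simp add: mult.commute eq_divide_eq)
  qed
  have "sym_prod ((1 / S $ i $ j) *s (S $ i)) (S $ j) $ k $ l = (S $ i $ k * S $ j $ l + S $ j $ k * S $ i $ l) / S $ i $ j" for k l
    by (simp add: sym_prod_def add_divide_distrib)
  then have "S = sym_prod ((1 / S $ i $ j) *s (S $ i)) (S $ j)"
    using Skl by (metis vec_eq_iff)
  then show ?thesis using assms(2) unfolding sym_rank2_def by blast
qed

section \<open>Regular elements\<close>

lemma sp4_sym:
  assumes "X \<in> sp4"
  shows "(symplectic_form ** X) $ j $ i = (symplectic_form ** X) $ i $ j"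
proof -
  have "\<forall>i j. (symplectic_form ** X) $ j $ i = (symplectic_form ** X) $ i $ j"
    using assms unfolding sp4_iff by (simp add: forall_4 symplectic_mult_nth)
  then show ?thesis by blast
qed

lemma sp4_transpose: "X \<in> sp4 \<Longrightarrow> transpose X ** symplectic_form = - (symplectic_form ** X)"
  unfolding sp4_eq by (simp add: eq_neg_iff_add_eq_0)

text \<open>Every factor changes sign when its transpose moves past the symplectic form, so odd
  powers stay in \<open>sp4\<close>.\<close>

lemma sp4_cube: assumes "X \<in> sp4" shows "X ** X ** X \<in> sp4"
proof -
  note t = sp4_transpose[OF assms]
  have "transpose (X ** X ** X) ** symplectic_form = transpose X ** (transpose X ** (transpose X ** symplectic_form))"
    by (simp add: matrix_transpose_mul matrix_mul_assoc)
  also have "\<dots> = - (transpose X ** ((transpose X ** symplectic_form) ** X))"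
    by (simp add: t matrix_mult_minus_right matrix_mul_assoc)
  also have "\<dots> = (transpose X ** symplectic_form) ** X ** X"
    by (simp add: t matrix_mult_minus_right matrix_mult_minus_left matrix_mul_assoc)
  also have "\<dots> = - (symplectic_form ** (X ** X ** X))"
    by (simp add: t matrix_mult_minus_left matrix_mul_assoc)
  finally show ?thesis unfolding sp4_eq by simp
qed

lemma sp4_add: "X \<in> sp4 \<Longrightarrow> Y \<in> sp4 \<Longrightarrow> X + Y \<in> sp4"
  and sp4_cmat_scale: "X \<in> sp4 \<Longrightarrow> cmat_scale c X \<in> sp4"
  and sp4_minus: "X \<in> sp4 \<Longrightarrow> - X \<in> sp4"
  by (simp_all add: sp4_iff)

lemma square_eq_mean_nil: "X ** X = mat (sp4_mean X) + sp4_nil X"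
  by (simp add: sp4_nil_def)

text \<open>Scalars and \<open>sp4_nil X\<close> are self-adjoint for the symplectic form, elements
  of \<open>sp4\<close> are anti-self-adjoint, and the two kinds meet only in 0.\<close>

lemma sp4_even_eq_0:
  assumes "X \<in> sp4" "mat a + cmat_scale b (sp4_nil X) \<in> sp4"
  shows "a = 0" "cmat_scale b (sp4_nil X) = 0"
proof -
  have dbl: "z = - z \<longleftrightarrow> z = 0" for z :: complex by (metis equation_minus_iff neg_equal_iff_equal eq_neg_iff_add_eq_0 mult_2 mult_eq_0_iff zero_neq_numeral add.inverse_neutral)
  note e = assms(2)[unfolded sp4_iff, simplified sp4_nil_nth[OF assms(1)] vector_add_component cmat_scale_nth mat_def vec_lambda_beta]
  have 1: "a + b * sp4_nil X $ 1 $ 1 = 0" "a - b * sp4_nil X $ 1 $ 1 = 0"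
    using e dbl by auto
  then show a: "a = 0" by (simp add: algebra_simps)
  have "b * sp4_nil X $ 1 $ 2 = 0" "b * sp4_nil X $ 2 $ 1 = 0" "b * sp4_nil X $ 1 $ 4 = 0" "b * sp4_nil X $ 3 $ 2 = 0"
    "b * sp4_nil X $ 1 $ 1 = 0"
    using e 1 a dbl by auto
  then show "cmat_scale b (sp4_nil X) = 0"
    by (auto simp: vec_eq_iff forall_4 sp4_nil_nth[OF assms(1)])
qed

text \<open>The even and odd parts of a relation vanish separately, and the even one forces
  \<open>c2 = 0\<close> and \<open>c0 = 0\<close>. A relation with \<open>c3\<close> nonzero gives
  \<open>?N ** X = cmat_scale \<nu> X\<close>. Multiplying by \<open>X\<close> and using that the
  square of \<open>?N\<close> is a scalar makes \<open>?m - \<nu>\<close> times \<open>?N\<close> a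
  scalar matrix. Its entries at 1 and 2 on the diagonal are opposite, so it is 0; hence
  \<open>\<nu> = ?m\<close>, contrary to \<open>sp4_cubic X \<noteq> 0\<close>.\<close>

lemma sp4_powers_independent:
  assumes X: "X \<in> sp4" and N: "sp4_nil X \<noteq> 0" and C: "sp4_cubic X \<noteq> 0"
    and rel: "mat c0 + cmat_scale c1 X + cmat_scale c2 (X ** X) + cmat_scale c3 (X ** X ** X) = 0"
  shows "c0 = 0 \<and> c1 = 0 \<and> c2 = 0 \<and> c3 = 0"
proof -
  let ?m = "sp4_mean X" and ?N = "sp4_nil X"
  have odd: "cmat_scale c1 X + cmat_scale c3 (X ** X ** X) \<in> sp4"
    by (intro sp4_add sp4_cmat_scale X sp4_cube)
  have "mat (c0 + c2 * ?m) + cmat_scale c2 ?N = mat c0 + cmat_scale c2 (X ** X)"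
    unfolding square_eq_mean_nil by (simp add: vec_eq_iff mat_def algebra_simps)
  also have "\<dots> = - (cmat_scale c1 X + cmat_scale c3 (X ** X ** X))"
    using rel by (simp add: eq_neg_iff_add_eq_0 algebra_simps)
  finally have "mat (c0 + c2 * ?m) + cmat_scale c2 ?N \<in> sp4"
    using sp4_minus[OF odd] by simp
  note ev = sp4_even_eq_0[OF X this]
  have c2: "c2 = 0" using ev(2) N by (auto simp: vec_eq_iff)
  then have c0: "c0 = 0" using ev(1) by simp
  have od: "cmat_scale c1 X + cmat_scale c3 (X ** X ** X) = 0" using rel c2 c0 by (simp add: vec_eq_iff mat_def)
  have c3: "c3 = 0"
  proof (rule ccontr)
    assume c3: "c3 \<noteq> 0"
    define \<nu> where "\<nu> = - c1 / c3 - ?m"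
    have "X ** X ** X = cmat_scale ?m X + ?N ** X"
      unfolding square_eq_mean_nil by (simp add: matrix_mult_distribs mat_mult_left)
    then have "c1 * X $ i $ j + c3 * (?m * X $ i $ j + (?N ** X) $ i $ j) = 0" for i j
      using od by (simp add: vec_eq_iff)
    then have "c3 * (?N ** X) $ i $ j = - c1 * X $ i $ j - c3 * ?m * X $ i $ j" for i j
      by (simp add: algebra_simps eq_neg_iff_add_eq_0)
    moreover have "c3 * (\<nu> * X $ i $ j) = - c1 * X $ i $ j - c3 * ?m * X $ i $ j" for i j
      using c3 by (simp add: \<nu>_def algebra_simps)
    ultimately have "(?N ** X) $ i $ j = \<nu> * X $ i $ j" for i j
      using c3 by (metis mult_left_cancel)
    then have NX: "?N ** X = cmat_scale \<nu> X" by (simp add: vec_eq_iff)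
    obtain q where q: "?N ** ?N = mat q" using sp4_nil_square[OF X] by blast
    have "?N ** (X ** X) = cmat_scale \<nu> (X ** X)" by (simp add: matrix_mul_assoc NX cmat_scale_mult_left)
    then have "cmat_scale ?m ?N + mat q = cmat_scale \<nu> (mat ?m + ?N)"
      unfolding square_eq_mean_nil by (simp add: matrix_mult_distribs mat_mult_right q)
    then have e: "?m * ?N $ i $ j + mat q $ i $ j = \<nu> * (mat ?m $ i $ j + ?N $ i $ j)" for i j
      by (simp add: vec_eq_iff)
    have e': "(?m - \<nu>) * ?N $ i $ j = \<nu> * mat ?m $ i $ j - mat q $ i $ j" for i j
      using e[of i j] by (simp add: algebra_simps)
    have "(?m - \<nu>) * ?N $ 1 $ 1 = \<nu> * ?m - q" "- ((?m - \<nu>) * ?N $ 1 $ 1) = \<nu> * ?m - q"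
      using e'[of 1 1] e'[of 2 2] by (simp_all add: mat_def sp4_nil_nth[OF X])
    then have k: "\<nu> * ?m - q = 0" by (metis add.left_inverse mult_2 mult_eq_0_iff zero_neq_numeral)
    obtain i j where ij: "?N $ i $ j \<noteq> 0" using N by (auto simp: vec_eq_iff)
    have "\<nu> * mat ?m $ i $ j - mat q $ i $ j = 0" using k by (auto simp: mat_def)
    then have "(?m - \<nu>) * ?N $ i $ j = 0" using e'[of i j] by simp
    then have "\<nu> = ?m" using ij by simp
    then have "sp4_cubic X = 0" by (simp add: sp4_cubic_def NX)
    with C show False by simp
  qed
  have "c1 = 0"
  proof (rule ccontr)
    assume "c1 \<noteq> 0"
    then have "X = 0" using od c3 by (simp add: vec_eq_iff)
    then have "sp4_cubic X = 0" by (simp add: sp4_cubic_def)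
    with C show False by simp
  qed
  with c0 c2 c3 show ?thesis by simp
qed

text \<open>A complex vector space is not a finite union of proper subspaces: on the line
  \<open>v + t *s w\<close> each matrix excludes at most one \<open>t\<close>.\<close>

lemma common_nonkernel_vector:
  fixes F :: "(complex^'n^'n) set"
  assumes "finite F" "0 \<notin> F"
  shows "\<exists>v. \<forall>A\<in>F. A *v v \<noteq> 0"
  using assms
proof (induction F rule: finite_induct)
  case (insert A F)
  then obtain v where v: "\<forall>B\<in>F. B *v v \<noteq> 0" by auto
  have "\<exists>w. A *v w \<noteq> 0" using insert.prems by (metis insertI1 matrix_eq matrix_vector_mult_0)
  then obtain w where w: "A *v w \<noteq> 0" by blast
  have fin: "finite {t. B *v (v + t *s w) = 0}" if "B *v v \<noteq> 0 \<or> B *v w \<noteq> 0" for B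
  proof (cases "B *v w = 0")
    case True
    then show ?thesis using that by (simp add: matrix_vector_right_distrib vector_scalar_commute)
  next
    case False
    then obtain i where i: "(B *v w) $ i \<noteq> 0" by (auto simp: vec_eq_iff)
    have "{t. B *v (v + t *s w) = 0} \<subseteq> {- (B *v v) $ i / (B *v w) $ i}"
    proof
      fix t assume "t \<in> {t. B *v (v + t *s w) = 0}"
      then have "(B *v v) $ i + t * (B *v w) $ i = 0"
        by (simp add: matrix_vector_right_distrib vector_scalar_commute vec_eq_iff)
      then have "t * (B *v w) $ i = - (B *v v) $ i" by (simp add: eq_neg_iff_add_eq_0 add.commute)
      then show "t \<in> {- (B *v v) $ i / (B *v w) $ i}" using i by (metis nonzero_mult_div_cancel_right singletonI)
    qed
    then show ?thesis by (rule finite_subset) simp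
  qed
  have "finite (\<Union>B\<in>insert A F. {t. B *v (v + t *s w) = 0})"
    using insert.hyps(1) v w by (intro finite_UN_I fin) auto
  then obtain t where "t \<notin> (\<Union>B\<in>insert A F. {t. B *v (v + t *s w) = 0})"
    using infinite_UNIV_char_0[where 'a = complex] by (metis UNIV_eq_I)
  then show ?case by blast
qed auto

text \<open>The vector \<open>f(X) v\<close>, evaluated by Horner's rule.\<close>

definition poly_act :: "complex^'n^'n \<Rightarrow> complex^'n \<Rightarrow> complex poly \<Rightarrow> complex^'n" where
  "poly_act X v f = fold_coeffs (\<lambda>c w. c *s v + X *v w) f 0"

lemma poly_act_0 [simp]: "poly_act X v 0 = 0"
  by (simp add: poly_act_def)

lemma poly_act_pCons [simp]: "poly_act X v (pCons c f) = c *s v + X *v poly_act X v f"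
  by (cases "c = 0 \<and> f = 0") (auto simp: poly_act_def fold_coeffs_pCons_coeff_not_0_eq fold_coeffs_pCons_not_0_0_eq)

lemma poly_act_add: "poly_act X v (f + g) = poly_act X v f + poly_act X v g"
  by (induction f g rule: poly_induct2) (auto simp: vector_sadd_rdistrib matrix_vector_right_distrib)

lemma poly_act_smult: "poly_act X v (Polynomial.smult c f) = c *s poly_act X v f"
  by (induction f) (auto simp: vector_add_ldistrib vector_scalar_commute vector_smult_assoc)

lemma poly_act_mult_eq_0: "poly_act X v g = 0 \<Longrightarrow> poly_act X v (f * g) = 0"
  by (induction f) (auto simp: mult_pCons_left poly_act_add poly_act_smult)

lemma degree_le_3_pCons: "degree f \<le> 3 \<Longrightarrow> f = [:Polynomial.coeff f 0, Polynomial.coeff f 1, Polynomial.coeff f 2, Polynomial.coeff f 3:]"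
  by (rule poly_eqI) (auto simp: coeff_pCons numeral_3_eq_3 numeral_2_eq_2 coeff_eq_0 split: nat.split)

lemma matrix_right_inverse_if_injective:
  fixes P :: "complex^'n^'n"
  assumes "\<And>c. P *v c = 0 \<Longrightarrow> c = 0"
  obtains h where "P ** h = mat 1" "h ** P = mat 1"
  using assms matrix_left_invertible_ker[of P] matrix_left_right_inverse by metis

text \<open>\<open>X\<close> has a cyclic vector, so everything commuting with it is a polynomial in \<open>X\<close>; the polynomials lying
  in \<open>sp4\<close> are the odd ones.\<close>

lemma sp4_regular_centralizer_dim:
  assumes X: "X \<in> sp4" and N: "sp4_nil X \<noteq> 0" and C: "sp4_cubic X \<noteq> 0"
  shows "cmat.dim (centralizer_in sp4 X) \<le> 2"
proof -
  let ?m = "sp4_mean X" and ?N = "sp4_nil X" and ?X2 = "X ** X" and ?X3 = "X ** X ** X"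
  obtain q where q: "?N ** ?N = mat q" using sp4_nil_square[OF X] by blast
  define k where "k = - (2 * ?m)"
  \<comment> \<open>The polynomial \<open>(t\<^sup>2 - m)\<^sup>2 - q\<close>, which annihilates
    \<open>X\<close>.\<close>
  define p where "p = [:?m * ?m - q, 0, k, 0, 1:]"
  have p4: "degree p = 4" by (simp add: p_def)
  have X4: "X ** (X ** (X ** X)) = cmat_scale (2 * ?m) (X ** X) - mat (?m * ?m - q)"
  proof -
    have "X ** (X ** (X ** X)) = (mat ?m + ?N) ** (mat ?m + ?N)"
      by (metis matrix_mul_assoc square_eq_mean_nil)
    also have "\<dots> = cmat_scale (2 * ?m) (mat ?m + ?N) - mat (?m * ?m - q)"
      unfolding matrix_mult_distribs mat_mult_left mat_mult_right q by (simp add: vec_eq_iff mat_def algebra_simps)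
    finally show ?thesis by (simp flip: square_eq_mean_nil)
  qed
  have actp: "poly_act X v p = 0" for v
  proof -
    have "poly_act X v p = (?m * ?m - q) *s v + k *s ((X ** X) *v v) + (X ** (X ** (X ** X))) *v v"
      by (simp add: p_def matrix_vector_right_distrib vector_scalar_commute matrix_vector_mul_assoc matrix_mul_assoc add.assoc)
    then show ?thesis
      unfolding X4 by (simp add: k_def matrix_vector_mult_diff_rdistrib cmat_scale_vector_mult mat_vector_mult vec_eq_iff algebra_simps)
  qed
  define fm where "fm f = mat (Polynomial.coeff f 0) + cmat_scale (Polynomial.coeff f 1) X + cmat_scale (Polynomial.coeff f 2) ?X2 + cmat_scale (Polynomial.coeff f 3) ?X3" for f
  have fm: "fm f *v v = poly_act X v f" if "degree f \<le> 3" for f v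
    by (subst (2) degree_le_3_pCons[OF that])
      (simp add: fm_def matrix_vector_mult_add_rdistrib cmat_scale_vector_mult mat_vector_mult matrix_vector_right_distrib vector_scalar_commute
        matrix_vector_mul_assoc matrix_mul_assoc add.assoc)
  \<comment> \<open>A vector \<open>v\<close> is cyclic as soon as no maximal proper divisor of
    \<open>p\<close> kills it; these divisors are the quotients by a linear factor, evaluated at
    \<open>X\<close>.\<close>
  define F where "F = (\<lambda>\<alpha>. fm (p div [:-\<alpha>, 1:])) ` {\<alpha>. poly p \<alpha> = 0}"
  have quot: "degree (p div [:-\<alpha>, 1:]) = 3 \<and> p = [:-\<alpha>, 1:] * (p div [:-\<alpha>, 1:])" if "poly p \<alpha> = 0" for \<alpha>
  proof -
    have eq: "p = [:-\<alpha>, 1:] * (p div [:-\<alpha>, 1:])" using that by (metis dvd_mult_div_cancel poly_eq_0_iff_dvd)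
    have "p div [:-\<alpha>, 1:] \<noteq> 0" using eq p4 by (metis degree_0 mult_zero_right zero_neq_numeral)
    then have "degree p = 1 + degree (p div [:-\<alpha>, 1:])"
      by (subst eq) (simp add: degree_mult_eq del: mult_pCons_left)
    then show ?thesis using eq p4 by simp
  qed
  have "finite F"
    unfolding F_def using p4 by (intro finite_imageI poly_roots_finite) auto
  moreover have "0 \<notin> F"
  proof
    assume "0 \<in> F"
    then obtain \<alpha> where \<alpha>: "poly p \<alpha> = 0" "fm (p div [:-\<alpha>, 1:]) = 0" by (auto simp: F_def)
    then have "Polynomial.coeff (p div [:-\<alpha>, 1:]) 3 = 0"
      using sp4_powers_independent[OF X N C] unfolding fm_def by blast
    moreover have "degree (p div [:-\<alpha>, 1:]) = 3" using quot[OF \<alpha>(1)] by simp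
    ultimately show False by (metis leading_coeff_0_iff degree_0 zero_neq_numeral)
  qed
  ultimately obtain v where v: "\<forall>A\<in>F. A *v v \<noteq> 0" using common_nonkernel_vector by blast
  \<comment> \<open>A polynomial of least degree killing \<open>v\<close> divides \<open>p\<close>.
    If its degree is at most 3, the cofactor has a root, and then a quotient of \<open>p\<close> by
    a linear factor would kill \<open>v\<close>, against its choice.\<close>
  have indep: "r = 0" if r: "degree r \<le> 3" "poly_act X v r = 0" for r
  proof (rule ccontr)
    assume r0: "r \<noteq> 0"
    have "\<exists>d. (d \<noteq> 0 \<and> poly_act X v d = 0) \<and> (\<forall>f. f \<noteq> 0 \<and> poly_act X v f = 0 \<longrightarrow> degree d \<le> degree f)"
      by (rule ex_has_least_nat[of _ r]) (use r(2) r0 in simp)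
    then obtain d where d: "d \<noteq> 0" "poly_act X v d = 0"
      and least: "\<And>f. f \<noteq> 0 \<Longrightarrow> poly_act X v f = 0 \<Longrightarrow> degree d \<le> degree f"
      by blast
    have "degree d \<le> 3" using least[OF r0 r(2)] r(1) by simp
    have "poly_act X v (p mod d) = 0"
      using actp[of v] poly_act_mult_eq_0[OF d(2), of "p div d"] poly_act_add[of X v "p div d * d" "p mod d"] by simp
    then have "p mod d = 0" using least[of "p mod d"] degree_mod_less[OF d(1), of p] by (metis not_less)
    then have "d dvd p" by (simp add: dvd_eq_mod_eq_0)
    then obtain e where e: "p = d * e" by (rule dvdE)
    have "d \<noteq> 0" "e \<noteq> 0" using e p4 by auto
    then have "degree e \<noteq> 0" using e p4 \<open>degree d \<le> 3\<close> by (auto simp: degree_mult_eq)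
    then have "\<not> constant (poly e)" by (simp add: constant_degree)
    then obtain \<alpha> where \<alpha>: "poly e \<alpha> = 0" using fundamental_theorem_of_algebra by blast
    then obtain e' where e': "e = [:-\<alpha>, 1:] * e'" by (auto simp: poly_eq_0_iff_dvd)
    have pa: "poly p \<alpha> = 0" using e \<alpha> by simp
    have "[:-\<alpha>, 1:] * (p div [:-\<alpha>, 1:]) = [:-\<alpha>, 1:] * (e' * d)"
      using quot[OF pa] e e' by (metis mult.assoc mult.commute)
    then have "p div [:-\<alpha>, 1:] = e' * d" by (metis mult_left_cancel pCons_eq_0_iff one_neq_zero)
    then have "poly_act X v (p div [:-\<alpha>, 1:]) = 0" using poly_act_mult_eq_0[OF d(2)] by simp
    then have "fm (p div [:-\<alpha>, 1:]) *v v = 0" using fm quot[OF pa] by simp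
    moreover have "fm (p div [:-\<alpha>, 1:]) \<in> F" using pa by (auto simp: F_def)
    ultimately show False using v by blast
  qed
  define P :: "complex^4^4" where "P = (\<chi> i k. if k = 1 then v $ i else if k = 2 then (X *v v) $ i else if k = 3 then (?X2 *v v) $ i else (?X3 *v v) $ i)"
  have P: "P *v c = c $ 1 *s v + c $ 2 *s (X *v v) + c $ 3 *s (?X2 *v v) + c $ 4 *s (?X3 *v v)" for c
    by (simp add: P_def vec_eq_iff matrix_vector_mult_def sum_4 mult.commute)
  have Pfm: "P *v c = fm [:c $ 1, c $ 2, c $ 3, c $ 4:] *v v" for c
    unfolding P fm_def by (simp add: matrix_vector_mult_add_rdistrib cmat_scale_vector_mult mat_vector_mult coeff_pCons numeral_2_eq_2 numeral_3_eq_3)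
  have "c = 0" if "P *v c = 0" for c
  proof -
    have "degree [:c $ 1, c $ 2, c $ 3, c $ 4:] \<le> 3" by (auto simp: degree_pCons_eq_if)
    then have "[:c $ 1, c $ 2, c $ 3, c $ 4:] = 0" using indep fm that Pfm by metis
    then show ?thesis by (simp add: vec_eq_iff forall_4)
  qed
  then obtain h where h: "P ** h = mat 1" "h ** P = mat 1" using matrix_right_inverse_if_injective by blast
  have "centralizer_in sp4 X \<subseteq> cmat.span {X, ?X3}"
  proof
    fix Y assume "Y \<in> centralizer_in sp4 X"
    then have Y: "Y \<in> sp4" "X ** Y = Y ** X" by (auto simp: centralizer_in_def)
    define c where "c = h *v (Y *v v)"
    define f where "f = [:c $ 1, c $ 2, c $ 3, c $ 4:]"
    \<comment> \<open>\<open>Y\<close> and \<open>fm f\<close> agree on \<open>v\<close>. Their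
      difference commutes with \<open>X\<close> and kills \<open>v\<close>, hence kills the iterates
      of \<open>v\<close> under \<open>X\<close>, which span.\<close>
    define Z where "Z = Y - fm f"
    have cv: "fm f *v v = Y *v v" unfolding f_def Pfm[symmetric] c_def by (metis matrix_vector_mul_assoc matrix_vector_mul_lid h(1))
    have comm: "X ** Z = Z ** X"
      by (simp add: Z_def fm_def matrix_mult_distribs Y(2) mat_mult_left mat_mult_right cmat_scale_mult_left cmat_scale_mult_right matrix_mul_assoc)
    have Zv: "Z *v v = 0" by (simp add: Z_def matrix_vector_mult_diff_rdistrib cv)
    have step: "Z *v (X *v w) = 0" if "Z *v w = 0" for w
      using that by (metis comm matrix_vector_mul_assoc matrix_vector_mult_0_right)
    have "Z *v (P *v c) = 0" for c
      unfolding P by (simp add: matrix_vector_right_distrib vector_scalar_commute Zv step flip: matrix_vector_mul_assoc)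
    then have "Z *v (P *v (h *v w)) = 0" for w by blast
    then have "Z *v w = 0" for w by (simp add: matrix_vector_mul_assoc h)
    then have "Z = 0" by (metis matrix_eq matrix_vector_mult_0)
    then have Yf: "Y = fm f" by (simp add: Z_def)
    define od where "od = cmat_scale (Polynomial.coeff f 1) X + cmat_scale (Polynomial.coeff f 3) ?X3"
    have "cmat_scale (Polynomial.coeff f 2) ?X2 = mat (Polynomial.coeff f 2 * ?m) + cmat_scale (Polynomial.coeff f 2) ?N"
      by (simp add: square_eq_mean_nil vec_eq_iff mat_def algebra_simps)
    then have Yod: "Y = (mat (Polynomial.coeff f 0 + Polynomial.coeff f 2 * ?m) + cmat_scale (Polynomial.coeff f 2) ?N) + od"
      unfolding Yf fm_def od_def by (simp add: vec_eq_iff mat_def algebra_simps)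
    then have "mat (Polynomial.coeff f 0 + Polynomial.coeff f 2 * ?m) + cmat_scale (Polynomial.coeff f 2) ?N = Y + - od" by simp
    moreover have "Y + - od \<in> sp4" unfolding od_def by (intro sp4_add sp4_minus sp4_cmat_scale X sp4_cube Y)
    ultimately have ev: "mat (Polynomial.coeff f 0 + Polynomial.coeff f 2 * ?m) + cmat_scale (Polynomial.coeff f 2) ?N \<in> sp4" by simp
    have "Y = od" unfolding Yod sp4_even_eq_0[OF X ev] by (simp add: vec_eq_iff mat_def)
    then have "Y = cmat_scale (Polynomial.coeff f 1) X + cmat_scale (Polynomial.coeff f 3) ?X3" by (simp only: od_def)
    moreover have "\<dots> \<in> cmat.span {X, ?X3}"
      by (intro cmat.span_add cmat.span_scale cmat.span_base) auto
    ultimately show "Y \<in> cmat.span {X, ?X3}" by simp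
  qed
  then have "cmat.dim (centralizer_in sp4 X) \<le> card {X, ?X3}"
    by (rule cmat.dim_le_card) simp
  also have "\<dots> \<le> 2" by (simp add: card_insert_if)
  finally show ?thesis .
qed

section \<open>Centralizers and symmetric matrices\<close>

lemma cmat_dim_image_inj:
  assumes add: "\<And>x y. T (x + y) = T x + T y" and scale: "\<And>c x. T (cmat_scale c x) = cmat_scale c (T x)" and inj: "inj T"
  shows "cmat.dim (T ` S) = cmat.dim S"
proof -
  interpret T: Vector_Spaces.linear cmat_scale cmat_scale T
    unfolding Vector_Spaces.linear_iff using add scale
    by (intro conjI allI) (unfold_locales, auto simp: cmat_scale_def vec_eq_iff map_matrix_def algebra_simps)
  obtain B where B: "B \<subseteq> S" "cmat.independent B" "S \<subseteq> cmat.span B" "card B = cmat.dim S"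
    using cmat.basis_exists[of S] by blast
  show ?thesis
  proof (rule cmat.dim_unique)
    show "T ` B \<subseteq> T ` S" using B by blast
    show "T ` S \<subseteq> cmat.span (T ` B)" using B by (auto simp: T.span_image)
    show "cmat.independent (T ` B)" by (rule T.independent_injective_image[OF B(2) inj_on_subset[OF inj subset_UNIV]])
    show "card (T ` B) = cmat.dim S" using B(4) card_image[OF inj_on_subset[OF inj subset_UNIV], of B] by simp
  qed
qed

text \<open>The entries at the positions \<open>I\<close> are coordinates on \<open>W\<close>, and
  \<open>B\<close> is the basis dual to them.\<close>

lemma dim_eq_card_positions:
  fixes W :: "(complex^'n^'m) set" and I :: "('m \<times> 'n) set"
  assumes W: "cmat.subspace W" and fin: "finite I"
    and det: "\<And>R. R \<in> W \<Longrightarrow> (\<And>i j. (i, j) \<in> I \<Longrightarrow> R $ i $ j = 0) \<Longrightarrow> R = 0"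
    and B: "\<forall>p\<in>I. B p \<in> W" "\<forall>p\<in>I. \<forall>q\<in>I. B p $ fst q $ snd q = (if q = p then 1 else 0)"
  shows "cmat.dim W = card I"
proof -
  have B: "\<And>p. p \<in> I \<Longrightarrow> B p \<in> W"
    "\<And>p q. p \<in> I \<Longrightarrow> q \<in> I \<Longrightarrow> B p $ fst q $ snd q = (if q = p then 1 else 0)" using B by auto
  have inj: "inj_on B I" by (rule inj_onI) (metis B(2) zero_neq_one)
  have comb: "(\<Sum>p\<in>I. cmat_scale (c p) (B p)) $ fst q $ snd q = c q" if "q \<in> I" for c q
  proof -
    have "(\<Sum>p\<in>I. cmat_scale (c p) (B p)) $ fst q $ snd q = (\<Sum>p\<in>I. c p * (B p $ fst q $ snd q))"
      by (simp add: sum_component)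
    also have "\<dots> = (\<Sum>p\<in>I. if q = p then c p else 0)"
      using that by (intro sum.cong) (auto simp: B(2))
    finally show ?thesis using that fin by simp
  qed
  have "cmat.dim W = card (B ` I)"
  proof (rule cmat.dim_unique)
    show "B ` I \<subseteq> W" using B by auto
    show "cmat.independent (B ` I)"
    proof
      assume "cmat.dependent (B ` I)"
      then obtain u v where u: "v \<in> B ` I" "u v \<noteq> 0" "(\<Sum>v\<in>B ` I. cmat_scale (u v) v) = 0"
        using cmat.dependent_finite[of "B ` I"] fin by auto
      then obtain q where q: "q \<in> I" "v = B q" by blast
      have "(\<Sum>p\<in>I. cmat_scale (u (B p)) (B p)) = 0" using u(3) by (simp add: sum.reindex[OF inj])
      then have "u (B q) = 0" using comb[OF q(1), of "\<lambda>p. u (B p)"] by simp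
      then show False using u q by simp
    qed
    show "W \<subseteq> cmat.span (B ` I)"
    proof
      fix R assume R: "R \<in> W"
      let ?S = "\<Sum>p\<in>I. cmat_scale (R $ fst p $ snd p) (B p)"
      have S: "?S \<in> W" using B(1) W by (intro cmat.subspace_sum cmat.subspace_scale)
      have "R - ?S = 0"
      proof (rule det)
        show "R - ?S \<in> W" using R S W by (rule cmat.subspace_diff[rotated])
        fix i j assume "(i, j) \<in> I"
        from comb[OF this, of "\<lambda>p. R $ fst p $ snd p"] show "(R - ?S) $ i $ j = 0" by simp
      qed
      then have "R = ?S" by simp
      moreover have "?S \<in> cmat.span (B ` I)" by (intro cmat.span_sum cmat.span_scale cmat.span_base) auto
      ultimately show "R \<in> cmat.span (B ` I)" by simp
    qed
  qed (rule refl)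
  then show ?thesis using card_image[OF inj] by simp
qed

lemma symplectic_square: "symplectic_form ** symplectic_form = - mat 1"
  by (simp add: vec_eq_iff forall_4 symplectic_mult_nth) (simp add: symplectic_form_def mat_def)

lemma mult_symplectic_nth:
  "(X ** symplectic_form) $ i $ 1 = - X $ i $ 3" "(X ** symplectic_form) $ i $ 2 = - X $ i $ 4"
  "(X ** symplectic_form) $ i $ 3 = X $ i $ 1" "(X ** symplectic_form) $ i $ 4 = X $ i $ 2"
  for X :: "complex^4^4"
  by (simp_all add: matrix_matrix_mult_def symplectic_form_def sum_4)

lemma sp4_iff_mult_symmetric: "X \<in> sp4 \<longleftrightarrow> transpose (X ** symplectic_form) = X ** symplectic_form"
proof -
  have "transpose (X ** symplectic_form) = X ** symplectic_form \<longleftrightarrow>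
    (\<forall>i j. (X ** symplectic_form) $ j $ i = (X ** symplectic_form) $ i $ j)"
    by (simp add: vec_eq_iff transpose_def)
  also have "\<dots> \<longleftrightarrow> X \<in> sp4"
    unfolding sp4_iff forall_4 mult_symplectic_nth by auto
  finally show ?thesis by simp
qed

text \<open>Symmetric tensors annihilated by \<open>\<eta>\<close> under the derivative of the
  action \<open>R \<mapsto> g R g\<^sup>T\<close>.\<close>

definition stabilizer_forms :: "complex^'n^'n \<Rightarrow> (complex^'n^'n) set" where
  "stabilizer_forms \<eta> = {R. transpose R = R \<and> \<eta> ** R + R ** transpose \<eta> = 0}"

lemma subspace_stabilizer_forms: "cmat.subspace (stabilizer_forms \<eta>)"
proof -
  have t: "transpose (cmat_scale c R) = cmat_scale c (transpose R)" for c and R :: "complex^'a^'a"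
    by (simp add: vec_eq_iff transpose_def)
  have "\<eta> ** (x + y) + (x + y) ** transpose \<eta> = (\<eta> ** x + x ** transpose \<eta>) + (\<eta> ** y + y ** transpose \<eta>)" for x y
    by (simp add: matrix_mult_distribs)
  moreover have "\<eta> ** cmat_scale c x + cmat_scale c x ** transpose \<eta> = cmat_scale c (\<eta> ** x + x ** transpose \<eta>)" for c x
    by (simp add: cmat_scale_mult_left cmat_scale_mult_right cmat.scale_right_distrib)
  ultimately show ?thesis
    unfolding cmat.subspace_def stabilizer_forms_def
    by (auto simp: transpose_add t) (simp_all add: vec_eq_iff transpose_def)
qed

text \<open>\<open>Y \<mapsto> Y J\<close> identifies \<open>sp4\<close> with the symmetric matrices, on which \<open>X\<close> acts by
  \<open>S \<mapsto> X S + S X\<^sup>T\<close>; hence only the conjugacy class of \<open>X\<close> under the full linear group matters.\<close>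

lemma centralizer_dim_eq_stabilizer_dim:
  assumes X: "X \<in> sp4" and Ph: "P ** h = mat 1" "h ** P = mat 1" and \<eta>: "X ** P = P ** \<eta>"
  shows "cmat.dim (centralizer_in sp4 X) = cmat.dim (stabilizer_forms \<eta>)"
proof -
  let ?J = symplectic_form
  define T where "T Y = h ** (Y ** ?J) ** transpose h" for Y
  have tPh: "transpose h ** transpose P = mat 1" "transpose P ** transpose h = mat 1"
    using Ph by (simp_all add: matrix_transpose_mul[symmetric] transpose_mat)
  have \<eta>': "\<eta> = h ** X ** P" using \<eta> Ph by (metis matrix_mul_assoc matrix_mul_lid)
  have Tinv: "P ** T Y ** transpose P ** (- ?J) = Y" for Y
  proof -
    have "P ** T Y ** transpose P ** (- ?J) = (P ** h) ** Y ** ?J ** (transpose h ** transpose P) ** (- ?J)"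
      by (simp add: T_def matrix_mul_assoc)
    also have "\<dots> = Y ** (?J ** (- ?J))" by (simp add: Ph tPh matrix_mul_assoc)
    also have "\<dots> = Y" by (simp add: matrix_mult_minus_right symplectic_square)
    finally show ?thesis .
  qed
  have XJ: "?J ** transpose X = - (X ** ?J)"
  proof -
    have "transpose ?J = - ?J" by (simp add: vec_eq_iff forall_4 transpose_def symplectic_form_def)
    then have "transpose (X ** ?J) = - (?J ** transpose X)"
      by (simp add: matrix_transpose_mul matrix_mult_minus_left)
    with X have "- (?J ** transpose X) = X ** ?J" by (simp add: sp4_iff_mult_symmetric)
    then show ?thesis by (metis minus_minus)
  qed
  have act: "\<eta> ** T Y + T Y ** transpose \<eta> = T (X ** Y - Y ** X)" for Y
  proof -
    have "\<eta> ** T Y = h ** X ** (P ** h) ** (Y ** ?J) ** transpose h"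
      by (simp add: T_def \<eta>' matrix_mul_assoc)
    then have 1: "\<eta> ** T Y = h ** (X ** Y ** ?J) ** transpose h" by (simp add: Ph matrix_mul_assoc)
    have "T Y ** transpose \<eta> = h ** (Y ** ?J) ** (transpose h ** transpose P) ** transpose X ** transpose h"
      by (simp add: T_def \<eta>' matrix_transpose_mul matrix_mul_assoc)
    also have "\<dots> = h ** (Y ** (?J ** transpose X)) ** transpose h" by (simp add: tPh matrix_mul_assoc)
    also have "\<dots> = - (h ** (Y ** X ** ?J) ** transpose h)"
      by (simp add: XJ matrix_mult_minus_left matrix_mult_minus_right matrix_mul_assoc)
    finally show ?thesis
      unfolding 1 by (simp add: T_def matrix_mult_distribs)
  qed
  have T0: "T Y = 0 \<longleftrightarrow> Y = 0" for Y using Tinv[of Y] by (auto simp: T_def)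
  have sym: "transpose (T Y) = T Y" if "Y \<in> sp4" for Y
    using that unfolding T_def sp4_iff_mult_symmetric by (simp add: matrix_transpose_mul matrix_mul_assoc)
  have "T ` centralizer_in sp4 X = stabilizer_forms \<eta>"
  proof (intro equalityI subsetI)
    fix R assume "R \<in> T ` centralizer_in sp4 X"
    then obtain Y where Y: "Y \<in> sp4" "X ** Y - Y ** X = 0" "R = T Y" by (auto simp: centralizer_in_def)
    then show "R \<in> stabilizer_forms \<eta>" using sym act[of Y] T0[of 0] by (simp add: stabilizer_forms_def)
  next
    fix R assume R: "R \<in> stabilizer_forms \<eta>"
    define Y where "Y = P ** R ** transpose P ** (- ?J)"
    have YJ: "Y ** ?J = P ** R ** transpose P"
      by (simp add: Y_def matrix_mult_minus_right matrix_mult_minus_left symplectic_square flip: matrix_mul_assoc[of _ ?J])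
    have "Y \<in> sp4" using R by (simp add: sp4_iff_mult_symmetric YJ stabilizer_forms_def matrix_transpose_mul matrix_mul_assoc)
    moreover have TY: "T Y = R"
    proof -
      have "T Y = (h ** P) ** R ** (transpose P ** transpose h)" by (simp add: T_def YJ matrix_mul_assoc)
      then show ?thesis by (simp add: Ph tPh)
    qed
    moreover have "X ** Y - Y ** X = 0" using act[of Y] R T0 by (simp add: TY stabilizer_forms_def)
    ultimately show "R \<in> T ` centralizer_in sp4 X" by (auto simp: centralizer_in_def)
  qed
  moreover have "cmat.dim (T ` centralizer_in sp4 X) = cmat.dim (centralizer_in sp4 X)"
  proof (rule cmat_dim_image_inj)
    show "inj T" by (rule inj_onI) (metis Tinv)
  qed (simp_all add: T_def matrix_mult_distribs cmat_scale_mult_left cmat_scale_mult_right)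
  ultimately show ?thesis by simp
qed

section \<open>Stabilizers of the normal forms\<close>

definition sym_unit :: "'n \<Rightarrow> 'n \<Rightarrow> complex^'n^'n" where
  "sym_unit k l = (\<chi> i j. if i = k \<and> j = l \<or> i = l \<and> j = k then 1 else 0)"

lemma stabilizer_forms_iff:
  "R \<in> stabilizer_forms \<eta> \<longleftrightarrow> (\<forall>i j. R $ j $ i = R $ i $ j) \<and>
    (\<forall>i j. (\<Sum>k\<in>UNIV. \<eta> $ i $ k * R $ k $ j) + (\<Sum>k\<in>UNIV. R $ i $ k * \<eta> $ j $ k) = 0)"
  by (simp add: stabilizer_forms_def vec_eq_iff transpose_def matrix_matrix_mult_def)

lemma stabilizer_forms_diag_iff:
  "R \<in> stabilizer_forms (\<chi> i j. if i = j then d i else 0) \<longleftrightarrow> (\<forall>i j. R $ j $ i = R $ i $ j) \<and> (\<forall>i j. (d i + d j) * R $ i $ j = 0)"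
proof -
  have "(\<Sum>k\<in>UNIV. (if i = k then d i else 0) * R $ k $ j) = d i * R $ i $ j" for i j
    by (simp add: if_distrib if_distribR cong: if_cong)
  moreover have "(\<Sum>k\<in>UNIV. R $ i $ k * (if j = k then d j else 0)) = R $ i $ j * d j" for i j
    by (simp add: if_distrib if_distribR cong: if_cong)
  ultimately show ?thesis
    unfolding stabilizer_forms_iff vec_lambda_beta by (simp only: distrib_right mult.commute[of "R $ _ $ _"])
qed

lemma sym_unit_sym: "sym_unit k l $ j $ i = sym_unit k l $ i $ j"
  by (auto simp: sym_unit_def)

lemma sym_unit_stabilizer_diag:
  "d k + d l = 0 \<Longrightarrow> sym_unit k l \<in> stabilizer_forms (\<chi> i j. if i = j then d i else 0)"
  unfolding stabilizer_forms_diag_iff by (auto simp: sym_unit_def add.commute)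

text \<open>Free are the entry pairing the eigenvalues \<open>t\<close> and \<open>- t\<close> and
  the three entries of a symmetric block on the kernel.\<close>

lemma stabilizer_dim_semisimple_rank2:
  assumes "t \<noteq> 0"
  shows "cmat.dim (stabilizer_forms (\<chi> i j. if i = j then if i = 1 then t else if i = 2 then - t else 0 else 0 :: complex^4^4)) = 4" (is "cmat.dim (stabilizer_forms ?\<eta>) = _")
proof -
  define B :: "4 \<times> 4 \<Rightarrow> complex^4^4" where "B = (\<lambda>(k, l). sym_unit k l)"
  have "cmat.dim (stabilizer_forms ?\<eta>) = card {(1, 2), (3, 3), (3, 4), (4 :: 4, 4 :: 4)}"
  proof (rule dim_eq_card_positions[OF subspace_stabilizer_forms])
    fix R assume R: "R \<in> stabilizer_forms ?\<eta>" and z: "\<And>i j. (i, j) \<in> {(1, 2), (3, 3), (3, 4), (4 :: 4, 4 :: 4)} \<Longrightarrow> R $ i $ j = 0"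
    note R' = R[unfolded stabilizer_forms_diag_iff]
    have s: "R $ j $ i = R $ i $ j" for i j using R' by blast
    have e: "((if i = 1 then t else if i = 2 then - t else 0) + (if j = 1 then t else if j = 2 then - t else 0)) * R $ i $ j = 0" for i j using R' by blast
    have r11: "R $ 1 $ 1 = 0" using e[of 1 1] assms by simp
    have r12: "R $ 1 $ 2 = 0" by (rule z) simp
    have r13: "R $ 1 $ 3 = 0" using e[of 1 3] assms by simp
    have r14: "R $ 1 $ 4 = 0" using e[of 1 4] assms by simp
    have r22: "R $ 2 $ 2 = 0" using e[of 2 2] assms by simp
    have r23: "R $ 2 $ 3 = 0" using e[of 2 3] assms by simp
    have r24: "R $ 2 $ 4 = 0" using e[of 2 4] assms by simp
    have r33: "R $ 3 $ 3 = 0" by (rule z) simp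
    have r34: "R $ 3 $ 4 = 0" by (rule z) simp
    have r44: "R $ 4 $ 4 = 0" by (rule z) simp
    show "R = 0"
      by (simp add: vec_eq_iff forall_4 r11 r12 r13 r14 r22 r23 r24 r33 r34 r44 trans[OF s r12] trans[OF s r13] trans[OF s r14] trans[OF s r23] trans[OF s r24] trans[OF s r34])
  next
    show "\<forall>p\<in>{(1, 2), (3, 3), (3, 4), (4 :: 4, 4 :: 4)}. B p \<in> stabilizer_forms ?\<eta>"
      by (simp add: B_def sym_unit_stabilizer_diag)
    show "\<forall>p\<in>{(1, 2), (3, 3), (3, 4), (4 :: 4, 4 :: 4)}. \<forall>q\<in>{(1, 2), (3, 3), (3, 4), (4 :: 4, 4 :: 4)}. B p $ fst q $ snd q = (if q = p then 1 else 0)"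
      by (simp add: B_def sym_unit_def)
  qed simp
  then show ?thesis by simp
qed

text \<open>Free is the two by two block that pairs the eigenvalue \<open>t\<close> with
  \<open>- t\<close>.\<close>

lemma stabilizer_dim_semisimple_scalar:
  assumes "t \<noteq> 0"
  shows "cmat.dim (stabilizer_forms (\<chi> i j. if i = j then if i = 1 \<or> i = 2 then t else - t else 0 :: complex^4^4)) = 4" (is "cmat.dim (stabilizer_forms ?\<eta>) = _")
proof -
  define B :: "4 \<times> 4 \<Rightarrow> complex^4^4" where "B = (\<lambda>(k, l). sym_unit k l)"
  have "cmat.dim (stabilizer_forms ?\<eta>) = card {(1, 3), (1, 4), (2, 3), (2 :: 4, 4 :: 4)}"
  proof (rule dim_eq_card_positions[OF subspace_stabilizer_forms])
    fix R assume R: "R \<in> stabilizer_forms ?\<eta>" and z: "\<And>i j. (i, j) \<in> {(1, 3), (1, 4), (2, 3), (2 :: 4, 4 :: 4)} \<Longrightarrow> R $ i $ j = 0"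
    note R' = R[unfolded stabilizer_forms_diag_iff]
    have s: "R $ j $ i = R $ i $ j" for i j using R' by blast
    have e: "((if i = 1 \<or> i = 2 then t else - t) + (if j = 1 \<or> j = 2 then t else - t)) * R $ i $ j = 0" for i j using R' by blast
    have r11: "R $ 1 $ 1 = 0" using e[of 1 1] assms by simp
    have r12: "R $ 1 $ 2 = 0" using e[of 1 2] assms by simp
    have r13: "R $ 1 $ 3 = 0" by (rule z) simp
    have r14: "R $ 1 $ 4 = 0" by (rule z) simp
    have r22: "R $ 2 $ 2 = 0" using e[of 2 2] assms by simp
    have r23: "R $ 2 $ 3 = 0" by (rule z) simp
    have r24: "R $ 2 $ 4 = 0" by (rule z) simp
    have r33: "R $ 3 $ 3 = 0" using e[of 3 3] assms by simp
    have r34: "R $ 3 $ 4 = 0" using e[of 3 4] assms by simp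
    have r44: "R $ 4 $ 4 = 0" using e[of 4 4] assms by simp
    show "R = 0"
      by (simp add: vec_eq_iff forall_4 r11 r12 r13 r14 r22 r23 r24 r33 r34 r44 trans[OF s r12] trans[OF s r13] trans[OF s r14] trans[OF s r23] trans[OF s r24] trans[OF s r34])
  next
    show "\<forall>p\<in>{(1, 3), (1, 4), (2, 3), (2 :: 4, 4 :: 4)}. B p \<in> stabilizer_forms ?\<eta>"
      by (simp add: B_def sym_unit_stabilizer_diag)
    show "\<forall>p\<in>{(1, 3), (1, 4), (2, 3), (2 :: 4, 4 :: 4)}. \<forall>q\<in>{(1, 3), (1, 4), (2, 3), (2 :: 4, 4 :: 4)}. B p $ fst q $ snd q = (if q = p then 1 else 0)"
      by (simp add: B_def sym_unit_def)
  qed simp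
  then show ?thesis by simp
qed

lemma stabilizer_forms_nilpotent_rank2_iff:
  fixes R :: "complex^4^4"
  shows "R \<in> stabilizer_forms (\<chi> i j. if i = 1 \<and> j = 3 \<or> i = 2 \<and> j = 4 then 1 else 0) \<longleftrightarrow>
    (\<forall>i j. R $ j $ i = R $ i $ j) \<and> (\<forall>i j. (if i = 1 then R $ 3 $ j else if i = 2 then R $ 4 $ j else 0)
      + (if j = 1 then R $ i $ 3 else if j = 2 then R $ i $ 4 else 0) = 0)"
proof -
  have "(\<Sum>k\<in>UNIV. (if i = 1 \<and> k = 3 \<or> i = 2 \<and> k = 4 then 1 else 0) * R $ k $ j)
      = (if i = 1 then R $ 3 $ j else if i = 2 then R $ 4 $ j else 0)" for i j :: 4
    unfolding sum_4 by simp
  moreover have "(\<Sum>k\<in>UNIV. R $ i $ k * (if j = 1 \<and> k = 3 \<or> j = 2 \<and> k = 4 then 1 else 0))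
      = (if j = 1 then R $ i $ 3 else if j = 2 then R $ i $ 4 else 0)" for i j :: 4
    unfolding sum_4 by simp
  ultimately show ?thesis unfolding stabilizer_forms_iff vec_lambda_beta by (simp only:)
qed

lemma stabilizer_forms_nilpotent_rank1_iff:
  fixes R :: "complex^4^4"
  shows "R \<in> stabilizer_forms (\<chi> i j. if i = 1 \<and> j = 2 then 1 else 0) \<longleftrightarrow>
    (\<forall>i j. R $ j $ i = R $ i $ j) \<and> (\<forall>i j. (if i = 1 then R $ 2 $ j else 0) + (if j = 1 then R $ i $ 2 else 0) = 0)"
proof -
  have "(\<Sum>k\<in>UNIV. (if i = 1 \<and> k = 2 then 1 else 0) * R $ k $ j) = (if i = 1 then R $ 2 $ j else 0)" for i j :: 4
    unfolding sum_4 by simp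
  moreover have "(\<Sum>k\<in>UNIV. R $ i $ k * (if j = 1 \<and> k = 2 then 1 else 0)) = (if j = 1 then R $ i $ 2 else 0)" for i j :: 4
    unfolding sum_4 by simp
  ultimately show ?thesis unfolding stabilizer_forms_iff vec_lambda_beta by (simp only:)
qed

text \<open>The upper left symmetric block is free, with three entries, and the upper right block
  must be skew; the latter explains the basis element
  \<open>sym_unit 1 4 - sym_unit 2 3\<close>.\<close>

lemma stabilizer_dim_nilpotent_rank2:
  "cmat.dim (stabilizer_forms (\<chi> i j. if i = 1 \<and> j = 3 \<or> i = 2 \<and> j = 4 then 1 else 0 :: complex^4^4)) = 4" (is "cmat.dim (stabilizer_forms ?\<eta>) = _")
proof -
  define B :: "4 \<times> 4 \<Rightarrow> complex^4^4" where "B = (\<lambda>(k, l). if l = 4 then sym_unit 1 4 - sym_unit 2 3 else sym_unit k l)"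
  have "cmat.dim (stabilizer_forms ?\<eta>) = card {(1, 1), (1, 2), (2, 2), (1 :: 4, 4 :: 4)}"
  proof (rule dim_eq_card_positions[OF subspace_stabilizer_forms])
    fix R assume R: "R \<in> stabilizer_forms ?\<eta>" and z: "\<And>i j. (i, j) \<in> {(1, 1), (1, 2), (2, 2), (1 :: 4, 4 :: 4)} \<Longrightarrow> R $ i $ j = 0"
    note R' = R[unfolded stabilizer_forms_nilpotent_rank2_iff]
    have s: "R $ j $ i = R $ i $ j" for i j using R' by blast
    have e: "(if i = 1 then R $ 3 $ j else if i = 2 then R $ 4 $ j else 0) + (if j = 1 then R $ i $ 3 else if j = 2 then R $ i $ 4 else 0) = 0" for i j using R' by blast
    have r11: "R $ 1 $ 1 = 0" by (rule z) simp
    have r12: "R $ 1 $ 2 = 0" by (rule z) simp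
    have r13: "R $ 1 $ 3 = 0" using e[of 1 1] s[of 1 2] s[of 1 3] s[of 2 4] by simp
    have r14: "R $ 1 $ 4 = 0" by (rule z) simp
    have r22: "R $ 2 $ 2 = 0" by (rule z) simp
    have r23: "R $ 2 $ 3 = 0" using e[of 1 2] r14 s[of 3 2] by simp
    have r24: "R $ 2 $ 4 = 0" using e[of 2 2] s[of 1 2] s[of 1 3] s[of 2 4] by simp
    have r33: "R $ 3 $ 3 = 0" using e[of 1 3] s[of 1 2] s[of 1 3] s[of 2 4] by simp
    have r34: "R $ 3 $ 4 = 0" using e[of 1 4] s[of 1 2] s[of 1 3] s[of 2 4] by simp
    have r44: "R $ 4 $ 4 = 0" using e[of 2 4] s[of 1 2] s[of 1 3] s[of 2 4] by simp
    show "R = 0"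
      by (simp add: vec_eq_iff forall_4 r11 r12 r13 r14 r22 r23 r24 r33 r34 r44 trans[OF s r12] trans[OF s r13] trans[OF s r14] trans[OF s r23] trans[OF s r24] trans[OF s r34])
  next
    show "\<forall>p\<in>{(1, 1), (1, 2), (2, 2), (1 :: 4, 4 :: 4)}. B p \<in> stabilizer_forms ?\<eta>"
      unfolding stabilizer_forms_nilpotent_rank2_iff
      by (simp only: forall_4 ball_simps B_def prod.case) (simp add: sym_unit_def)
    show "\<forall>p\<in>{(1, 1), (1, 2), (2, 2), (1 :: 4, 4 :: 4)}. \<forall>q\<in>{(1, 1), (1, 2), (2, 2), (1 :: 4, 4 :: 4)}. B p $ fst q $ snd q = (if q = p then 1 else 0)"
      by (simp add: B_def sym_unit_def)
  qed simp
  then show ?thesis by simp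
qed

text \<open>Row and column 2 vanish; the symmetric block on the three other coordinates is
  free.\<close>

lemma stabilizer_dim_nilpotent_rank1:
  "cmat.dim (stabilizer_forms (\<chi> i j. if i = 1 \<and> j = 2 then 1 else 0 :: complex^4^4)) = 6" (is "cmat.dim (stabilizer_forms ?\<eta>) = _")
proof -
  define B :: "4 \<times> 4 \<Rightarrow> complex^4^4" where "B = (\<lambda>(k, l). sym_unit k l)"
  have "cmat.dim (stabilizer_forms ?\<eta>) = card {(1, 1), (1, 3), (1, 4), (3, 3), (3, 4), (4 :: 4, 4 :: 4)}"
  proof (rule dim_eq_card_positions[OF subspace_stabilizer_forms])
    fix R assume R: "R \<in> stabilizer_forms ?\<eta>" and z: "\<And>i j. (i, j) \<in> {(1, 1), (1, 3), (1, 4), (3, 3), (3, 4), (4 :: 4, 4 :: 4)} \<Longrightarrow> R $ i $ j = 0"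
    note R' = R[unfolded stabilizer_forms_nilpotent_rank1_iff]
    have s: "R $ j $ i = R $ i $ j" for i j using R' by blast
    have e: "(if i = 1 then R $ 2 $ j else 0) + (if j = 1 then R $ i $ 2 else 0) = 0" for i j using R' by blast
    have r11: "R $ 1 $ 1 = 0" by (rule z) simp
    have r12: "R $ 1 $ 2 = 0" using e[of 1 1] s[of 1 2] s[of 1 3] s[of 2 4] by simp
    have r13: "R $ 1 $ 3 = 0" by (rule z) simp
    have r14: "R $ 1 $ 4 = 0" by (rule z) simp
    have r22: "R $ 2 $ 2 = 0" using e[of 1 2] s[of 1 2] s[of 1 3] s[of 2 4] by simp
    have r23: "R $ 2 $ 3 = 0" using e[of 1 3] s[of 1 2] s[of 1 3] s[of 2 4] by simp
    have r24: "R $ 2 $ 4 = 0" using e[of 1 4] s[of 1 2] s[of 1 3] s[of 2 4] by simp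
    have r33: "R $ 3 $ 3 = 0" by (rule z) simp
    have r34: "R $ 3 $ 4 = 0" by (rule z) simp
    have r44: "R $ 4 $ 4 = 0" by (rule z) simp
    show "R = 0"
      by (simp add: vec_eq_iff forall_4 r11 r12 r13 r14 r22 r23 r24 r33 r34 r44 trans[OF s r12] trans[OF s r13] trans[OF s r14] trans[OF s r23] trans[OF s r24] trans[OF s r34])
  next
    show "\<forall>p\<in>{(1, 1), (1, 3), (1, 4), (3, 3), (3, 4), (4 :: 4, 4 :: 4)}. B p \<in> stabilizer_forms ?\<eta>"
      unfolding stabilizer_forms_nilpotent_rank1_iff
      by (simp only: forall_4 ball_simps B_def prod.case) (simp add: sym_unit_def)
    show "\<forall>p\<in>{(1, 1), (1, 3), (1, 4), (3, 3), (3, 4), (4 :: 4, 4 :: 4)}. \<forall>q\<in>{(1, 1), (1, 3), (1, 4), (3, 3), (3, 4), (4 :: 4, 4 :: 4)}. B p $ fst q $ snd q = (if q = p then 1 else 0)"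
      by (simp add: B_def sym_unit_def)
  qed simp
  then show ?thesis by simp
qed

lemma stabilizer_dim_zero:
  "cmat.dim (stabilizer_forms (0 :: complex^4^4)) = 10" (is "cmat.dim (stabilizer_forms ?\<eta>) = _")
proof -
  define B :: "4 \<times> 4 \<Rightarrow> complex^4^4" where "B = (\<lambda>(k, l). sym_unit k l)"
  have "cmat.dim (stabilizer_forms ?\<eta>) = card {(1, 1), (1, 2), (1, 3), (1, 4), (2, 2), (2, 3), (2, 4), (3, 3), (3, 4), (4 :: 4, 4 :: 4)}"
  proof (rule dim_eq_card_positions[OF subspace_stabilizer_forms])
    fix R assume R: "R \<in> stabilizer_forms ?\<eta>" and z: "\<And>i j. (i, j) \<in> {(1, 1), (1, 2), (1, 3), (1, 4), (2, 2), (2, 3), (2, 4), (3, 3), (3, 4), (4 :: 4, 4 :: 4)} \<Longrightarrow> R $ i $ j = 0"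
    note R' = R[unfolded stabilizer_forms_iff]
    have s: "R $ j $ i = R $ i $ j" for i j using R' by blast
    have r11: "R $ 1 $ 1 = 0" by (rule z) simp
    have r12: "R $ 1 $ 2 = 0" by (rule z) simp
    have r13: "R $ 1 $ 3 = 0" by (rule z) simp
    have r14: "R $ 1 $ 4 = 0" by (rule z) simp
    have r22: "R $ 2 $ 2 = 0" by (rule z) simp
    have r23: "R $ 2 $ 3 = 0" by (rule z) simp
    have r24: "R $ 2 $ 4 = 0" by (rule z) simp
    have r33: "R $ 3 $ 3 = 0" by (rule z) simp
    have r34: "R $ 3 $ 4 = 0" by (rule z) simp
    have r44: "R $ 4 $ 4 = 0" by (rule z) simp
    show "R = 0"
      by (simp add: vec_eq_iff forall_4 r11 r12 r13 r14 r22 r23 r24 r33 r34 r44 trans[OF s r12] trans[OF s r13] trans[OF s r14] trans[OF s r23] trans[OF s r24] trans[OF s r34])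
  next
    show "\<forall>p\<in>{(1, 1), (1, 2), (1, 3), (1, 4), (2, 2), (2, 3), (2, 4), (3, 3), (3, 4), (4 :: 4, 4 :: 4)}. B p \<in> stabilizer_forms ?\<eta>"
      by (auto simp: B_def stabilizer_forms_iff sym_unit_sym)
    show "\<forall>p\<in>{(1, 1), (1, 2), (1, 3), (1, 4), (2, 2), (2, 3), (2, 4), (3, 3), (3, 4), (4 :: 4, 4 :: 4)}. \<forall>q\<in>{(1, 1), (1, 2), (1, 3), (1, 4), (2, 2), (2, 3), (2, 4), (3, 3), (3, 4), (4 :: 4, 4 :: 4)}. B p $ fst q $ snd q = (if q = p then 1 else 0)"
      by (simp add: B_def sym_unit_def)
  qed simp
  then show ?thesis by simp
qed

section \<open>Adapted bases\<close>

definition cols4 :: "complex^4 \<Rightarrow> complex^4 \<Rightarrow> complex^4 \<Rightarrow> complex^4 \<Rightarrow> complex^4^4" where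
  "cols4 a b c d = (\<chi> i k. if k = 1 then a $ i else if k = 2 then b $ i else if k = 3 then c $ i else d $ i)"

definition indep4 :: "complex^4 \<Rightarrow> complex^4 \<Rightarrow> complex^4 \<Rightarrow> complex^4 \<Rightarrow> bool" where
  "indep4 a b c d \<longleftrightarrow> (\<forall>x y z w. x *s a + y *s b + z *s c + w *s d = 0 \<longrightarrow> x = 0 \<and> y = 0 \<and> z = 0 \<and> w = 0)"

lemma mult_cols4: "X ** cols4 a b c d = cols4 (X *v a) (X *v b) (X *v c) (X *v d)"
  by (simp add: vec_eq_iff forall_4 cols4_def matrix_matrix_mult_def matrix_vector_mult_def sum_4)

lemma indep4_centralizer_dim:
  assumes X: "X \<in> sp4" and ind: "indep4 a b c d" and eq: "X ** cols4 a b c d = cols4 a b c d ** \<eta>"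
  shows "cmat.dim (centralizer_in sp4 X) = cmat.dim (stabilizer_forms \<eta>)"
proof -
  have "v = 0" if "cols4 a b c d *v v = 0" for v
  proof -
    have "cols4 a b c d *v v = v $ 1 *s a + v $ 2 *s b + v $ 3 *s c + v $ 4 *s d"
      by (simp add: vec_eq_iff cols4_def matrix_vector_mult_def sum_4 mult.commute)
    then have "v $ 1 = 0 \<and> v $ 2 = 0 \<and> v $ 3 = 0 \<and> v $ 4 = 0" using that ind unfolding indep4_def by metis
    then show ?thesis by (simp add: vec_eq_iff forall_4)
  qed
  then obtain h where "cols4 a b c d ** h = mat 1" "h ** cols4 a b c d = mat 1"
    using matrix_right_inverse_if_injective by blast
  then show ?thesis using centralizer_dim_eq_stabilizer_dim[OF X _ _ eq] by blast
qed

lemma independent_pair_minor: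
  fixes a b :: "complex^'n"
  assumes "\<And>x y. x *s a + y *s b = 0 \<Longrightarrow> x = 0 \<and> y = 0"
  shows "\<exists>i j. a $ i * b $ j - a $ j * b $ i \<noteq> 0"
proof (rule ccontr)
  assume "\<not> ?thesis"
  then have z: "a $ i * b $ j = a $ j * b $ i" for i j by simp
  have "a \<noteq> 0" using assms[of 1 0] by auto
  then obtain i where i: "a $ i \<noteq> 0" by (auto simp: vec_eq_iff)
  have "b $ i *s a + (- a $ i) *s b = 0" using z by (simp add: vec_eq_iff algebra_simps)
  then show False using assms i by fastforce
qed

text \<open>Some two by two minor of \<open>a\<close> and \<open>b\<close> is nonzero, in rows
  \<open>i\<close> and \<open>j\<close>; the unit vectors of the other two rows complete the
  basis.\<close>

lemma indep4_extend:
  assumes "\<And>x y. x *s a + y *s b = 0 \<Longrightarrow> x = 0 \<and> y = 0"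
  shows "\<exists>c d. indep4 a b c d"
proof -
  obtain i j where ij: "a $ i * b $ j - a $ j * b $ i \<noteq> 0" using independent_pair_minor[OF assms] by blast
  then have ne: "i \<noteq> j" by auto
  have "card (UNIV - {i, j}) = 2" using ne by (simp add: card_Diff_subset)
  then obtain k l where kl: "UNIV - {i, j} = {k, l}" "k \<noteq> l" by (metis card_2_iff)
  then have d: "k \<noteq> i" "k \<noteq> j" "l \<noteq> i" "l \<noteq> j" by blast+
  have "indep4 a b (axis k 1) (axis l 1)"
    unfolding indep4_def
  proof (intro allI impI)
    fix x y z w assume e: "x *s a + y *s b + z *s axis k 1 + w *s axis l 1 = 0"
    have c: "x * a $ p + y * b $ p + (if p = k then z else 0) + (if p = l then w else 0) = 0" for p
      using arg_cong[OF e, of "\<lambda>v. v $ p"] by (simp add: axis_def if_distrib cong: if_cong)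
    have i0: "x * a $ i + y * b $ i = 0" and j0: "x * a $ j + y * b $ j = 0" using c[of i] c[of j] d by auto
    have "x * (a $ i * b $ j - a $ j * b $ i) = (x * a $ i + y * b $ i) * b $ j - (x * a $ j + y * b $ j) * b $ i"
      by (simp add: algebra_simps)
    then have x: "x = 0" using ij i0 j0 by simp
    have "y * (a $ i * b $ j - a $ j * b $ i) = a $ i * (x * a $ j + y * b $ j) - a $ j * (x * a $ i + y * b $ i)"
      by (simp add: algebra_simps)
    then have y: "y = 0" using ij i0 j0 by simp
    show "x = 0 \<and> y = 0 \<and> z = 0 \<and> w = 0" using x y c[of k] c[of l] kl(2) by auto
  qed
  then show ?thesis by blast
qed

definition dot :: "complex^'n \<Rightarrow> complex^'n \<Rightarrow> complex" where
  "dot x y = (\<Sum>i\<in>UNIV. x $ i * y $ i)"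

lemma dot_simps [simp]: "dot x (y + z) = dot x y + dot x z" "dot x (y - z) = dot x y - dot x z" "dot x (c *s y) = c * dot x y"
  "dot x 0 = 0"
  by (simp_all add: dot_def sum.distrib sum_subtractf sum_distrib_left algebra_simps)

text \<open>For independent \<open>u\<close> and \<open>v\<close> the image of \<open>X\<close> is
  spanned by \<open>a\<close> and \<open>b\<close>, on which \<open>X\<close> acts by
  \<open>t\<close> and \<open>- t\<close> with \<open>t = dot v a\<close>. If
  \<open>t \<noteq> 0\<close>, \<open>X\<close> is diagonalizable; if \<open>t = 0\<close>, it has
  rank two and square zero. Dependent \<open>u\<close> and \<open>v\<close> leave rank one and
  square zero, the only type with dimension 6.\<close>

lemma sp4_rank2_centralizer_dim:
  fixes u v :: "complex^4"
  assumes X: "X \<in> sp4" and act: "\<And>w. X *v w = dot v w *s a + dot u w *s b"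
    and a: "a = - (symplectic_form *v u)" and b: "b = - (symplectic_form *v v)" and X0: "X \<noteq> 0"
  shows "cmat.dim (centralizer_in sp4 X) = 4 \<or> cmat.dim (centralizer_in sp4 X) = 6"
proof -
  have an: "a $ 1 = - u $ 3" "a $ 2 = - u $ 4" "a $ 3 = u $ 1" "a $ 4 = u $ 2"
    unfolding a by (simp_all add: matrix_vector_mult_def sum_4 symplectic_form_def)
  have bn: "b $ 1 = - v $ 3" "b $ 2 = - v $ 4" "b $ 3 = v $ 1" "b $ 4 = v $ 2"
    unfolding b by (simp_all add: matrix_vector_mult_def sum_4 symplectic_form_def)
  define t where "t = dot v a"
  have d: "dot u a = 0" "dot v b = 0" "dot u b = - t"
    by (simp_all add: t_def dot_def sum_4 an bn)
  show ?thesis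
  proof (cases "\<forall>x y. x *s u + y *s v = 0 \<longrightarrow> x = 0 \<and> y = 0")
    case True
    have ab: "x = 0 \<and> y = 0" if "x *s a + y *s b = 0" for x y
    proof -
      have "x *s u + y *s v = 0" using that by (auto simp: vec_eq_iff forall_4 an bn add_eq_0_iff minus_equation_iff)
      with True show ?thesis by blast
    qed
    show ?thesis
    proof (cases "t = 0")
      case False
      obtain y z where yz: "indep4 a b y z" using indep4_extend[OF ab] by blast
      \<comment> \<open>Corrects \<open>y\<close> by the eigenvectors \<open>a\<close> and
        \<open>b\<close> so that the result lies in the kernel of \<open>X\<close>.\<close>
      define p where "p y = y - (dot v y / t) *s a + (dot u y / t) *s b" for y
      have "indep4 a b (p y) (p z)"
        unfolding indep4_def
      proof (intro allI impI)
        fix c1 c2 c3 c4 assume "c1 *s a + c2 *s b + c3 *s p y + c4 *s p z = 0"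
        then have "(c1 - c3 * (dot v y / t) - c4 * (dot v z / t)) *s a + (c2 + c3 * (dot u y / t) + c4 * (dot u z / t)) *s b
            + c3 *s y + c4 *s z = 0"
          by (simp add: p_def vec_eq_iff algebra_simps)
        from yz[unfolded indep4_def, rule_format, OF this]
        have c: "c1 - c3 * (dot v y / t) - c4 * (dot v z / t) = 0" "c2 + c3 * (dot u y / t) + c4 * (dot u z / t) = 0"
          and c34: "c3 = 0" "c4 = 0"
          by blast+
        from c show "c1 = 0 \<and> c2 = 0 \<and> c3 = 0 \<and> c4 = 0" by (simp add: c34)
      qed
      moreover have "X *v a = t *s a" "X *v b = - t *s b" by (simp_all add: act d t_def[symmetric])
      moreover have "X *v p w = 0" for w
        using False by (simp add: act p_def d t_def[symmetric])
      ultimately have i4: "indep4 a b (p y) (p z)" and XX: "X *v a = t *s a" "X *v b = - t *s b" "\<And>w. X *v p w = 0"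
        by blast+
      have "X ** cols4 a b (p y) (p z) = cols4 a b (p y) (p z) ** (\<chi> i j. if i = j then if i = 1 then t else if i = 2 then - t else 0 else 0)"
        unfolding mult_cols4 XX by (simp add: vec_eq_iff forall_4 cols4_def matrix_matrix_mult_def sum_4)
      note indep4_centralizer_dim[OF X i4 this]
      then have "cmat.dim (centralizer_in sp4 X)
          = cmat.dim (stabilizer_forms (\<chi> i j. if i = j then if i = 1 then t else if i = 2 then - t else 0 else 0 :: complex^4^4))"
        .
      then show ?thesis using stabilizer_dim_semisimple_rank2[OF False] by simp
    next
      case t: True
      obtain i j where ij: "u $ i * v $ j - u $ j * v $ i \<noteq> 0" using independent_pair_minor[of u v] True by blast
      define D where "D = u $ i * v $ j - u $ j * v $ i"
      have D: "D \<noteq> 0" using ij by (simp add: D_def)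
      have dax: "dot x (axis k c) = x $ k * c" for x :: "complex^4" and k c
        by (simp add: dot_def axis_def if_distrib cong: if_cong)
      \<comment> \<open>By Cramer's rule \<open>w1\<close> and \<open>w2\<close> are dual to
        \<open>v\<close> and \<open>u\<close>, hence preimages of \<open>a\<close> and
        \<open>b\<close> under \<open>X\<close>.\<close>
      define w1 where "w1 = axis i (- u $ j / D) + axis j (u $ i / D)"
      define w2 where "w2 = axis i (v $ j / D) + axis j (- v $ i / D)"
      have w: "dot v w1 = 1" "dot u w1 = 0" "dot u w2 = 1" "dot v w2 = 0"
        using D by (simp_all add: w1_def w2_def dax field_simps) (simp_all add: D_def)
      have "indep4 a b w1 w2"
        unfolding indep4_def
      proof (intro allI impI)
        fix x y z q assume e: "x *s a + y *s b + z *s w1 + q *s w2 = 0"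
        have "z = 0" using arg_cong[OF e, of "dot v"] by (simp add: w d t t_def[symmetric])
        moreover have "q = 0" using arg_cong[OF e, of "dot u"] by (simp add: w d t)
        ultimately show "x = 0 \<and> y = 0 \<and> z = 0 \<and> q = 0" using e ab by simp
      qed
      moreover have "X *v a = 0" "X *v b = 0" "X *v w1 = a" "X *v w2 = b"
        by (simp_all add: act d t w t_def[symmetric])
      ultimately have i4: "indep4 a b w1 w2" and XX: "X *v a = 0" "X *v b = 0" "X *v w1 = a" "X *v w2 = b"
        by blast+
      have "X ** cols4 a b w1 w2 = cols4 a b w1 w2 ** (\<chi> i j. if i = 1 \<and> j = 3 \<or> i = 2 \<and> j = 4 then 1 else 0)"
        unfolding mult_cols4 XX by (simp add: vec_eq_iff forall_4 cols4_def matrix_matrix_mult_def sum_4)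
      note indep4_centralizer_dim[OF X i4 this]
      then have "cmat.dim (centralizer_in sp4 X)
          = cmat.dim (stabilizer_forms (\<chi> i j. if i = 1 \<and> j = 3 \<or> i = 2 \<and> j = 4 then 1 else 0 :: complex^4^4))"
        .
      then show ?thesis using stabilizer_dim_nilpotent_rank2 by simp
    qed
  next
    case False
    then obtain x y where xy: "x *s u + y *s v = 0" "x \<noteq> 0 \<or> y \<noteq> 0" by blast
    \<comment> \<open>By dependence the product of \<open>u\<close> and \<open>v\<close> is a
      multiple of the square of one vector \<open>r\<close>.\<close>
    have "\<exists>r k. (\<forall>w. X *v w = (k * dot r w) *s (- (symplectic_form *v r)))"
    proof (cases "y = 0")
      case True
      then have "u = 0" using xy by (auto simp: vec_eq_iff)
      then have "a = 0" "\<And>w. dot u w = 0" by (simp_all add: a dot_def matrix_vector_mult_def vec_eq_iff)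
      then show ?thesis by (intro exI[of _ 0]) (simp add: act)
    next
      case y: False
      obtain c where v: "v = c *s u"
      proof
        have "y * v $ i = - x * u $ i" for i using arg_cong[OF xy(1), of "\<lambda>z. z $ i"] by (simp add: add_eq_0_iff)
        then show "v = (- x / y) *s u" using y by (simp add: vec_eq_iff field_simps)
      qed
      have "b = c *s a" unfolding a b v vector_scalar_commute by (simp add: vec_eq_iff)
      moreover have "dot v w = c * dot u w" for w by (simp add: v dot_def sum_distrib_left mult.assoc)
      ultimately have "X *v w = ((2 * c) * dot u w) *s a" for w by (simp add: act vec_eq_iff)
      then show ?thesis unfolding a by blast
    qed
    then obtain r k where rk: "\<And>w. X *v w = (k * dot r w) *s (- (symplectic_form *v r))" by blast
    define s where "s = - (symplectic_form *v r)"
    have sn: "s $ 1 = - r $ 3" "s $ 2 = - r $ 4" "s $ 3 = r $ 1" "s $ 4 = r $ 2"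
      unfolding s_def by (simp_all add: matrix_vector_mult_def sum_4 symplectic_form_def)
    have rs: "dot r s = 0" by (simp add: dot_def sum_4 sn)
    have "\<exists>w. X *v w \<noteq> 0" using X0 by (metis matrix_eq matrix_vector_mult_0)
    then obtain w0 where w0: "k * dot r w0 \<noteq> 0" "s \<noteq> 0" using rk by (auto simp: s_def)
    \<comment> \<open>Normalised to be a preimage of \<open>s\<close> under
      \<open>X\<close>.\<close>
    define w where "w = (1 / (k * dot r w0)) *s w0"
    have rw: "k * dot r w = 1" using w0 by (simp add: w_def)
    have sw: "x = 0 \<and> y = 0" if e: "x *s s + y *s w = 0" for x y
    proof -
      have "y * (k * dot r w) = k * dot r (x *s s + y *s w)" by (simp add: rs mult_ac)
      then have "y * (k * dot r w) = 0" unfolding e by simp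
      then have "y = 0" using rw by simp
      then show ?thesis using e w0(2) by simp
    qed
    obtain y z where yz: "indep4 s w y z" using indep4_extend[OF sw] by blast
    define p where "p y = y - (k * dot r y) *s w" for y
    have "indep4 s w (p y) (p z)"
      unfolding indep4_def
    proof (intro allI impI)
      fix c1 c2 c3 c4 assume "c1 *s s + c2 *s w + c3 *s p y + c4 *s p z = 0"
      then have "c1 *s s + (c2 - c3 * (k * dot r y) - c4 * (k * dot r z)) *s w + c3 *s y + c4 *s z = 0"
        by (simp add: p_def vec_eq_iff algebra_simps)
      then have "c1 = 0 \<and> c2 - c3 * (k * dot r y) - c4 * (k * dot r z) = 0 \<and> c3 = 0 \<and> c4 = 0"
        using yz unfolding indep4_def by blast
      then show "c1 = 0 \<and> c2 = 0 \<and> c3 = 0 \<and> c4 = 0" by auto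
    qed
    moreover have "X *v s = 0" "X *v w = s" by (simp_all add: rk rs rw s_def[symmetric])
    moreover have "X *v p y = 0" for y
    proof -
      have "k * dot r (p y) = k * dot r y - (k * dot r y) * (k * dot r w)" by (simp add: p_def algebra_simps)
      then have "k * dot r (p y) = 0" using rw by simp
      then show ?thesis by (simp add: rk)
    qed
    ultimately have i4: "indep4 s w (p y) (p z)" and XX: "X *v s = 0" "X *v w = s" "\<And>y. X *v p y = 0"
      by blast+
    have "X ** cols4 s w (p y) (p z) = cols4 s w (p y) (p z) ** (\<chi> i j. if i = 1 \<and> j = 2 then 1 else 0)"
      unfolding mult_cols4 XX by (simp add: vec_eq_iff forall_4 cols4_def matrix_matrix_mult_def sum_4)
    note indep4_centralizer_dim[OF X i4 this]
    then have "cmat.dim (centralizer_in sp4 X)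
        = cmat.dim (stabilizer_forms (\<chi> i j. if i = 1 \<and> j = 2 then 1 else 0 :: complex^4^4))"
      .
    then show ?thesis using stabilizer_dim_nilpotent_rank1 by simp
  qed
qed

text \<open>If all two by two minors vanished, \<open>Y\<close> would have rank one, and its square
  would be its trace times \<open>Y\<close>, against the assumption on the trace.\<close>

lemma two_independent_columns:
  fixes Y :: "complex^4^4"
  assumes sq: "Y ** Y = cmat_scale c Y" and tr: "Y $ 1 $ 1 + Y $ 2 $ 2 + Y $ 3 $ 3 + Y $ 4 $ 4 \<noteq> c" and "Y \<noteq> 0"
  obtains x y where "\<And>p q. p *s (Y *v x) + q *s (Y *v y) = 0 \<Longrightarrow> p = 0 \<and> q = 0"
proof -
  have "\<exists>i j k l. Y $ i $ k * Y $ j $ l \<noteq> Y $ i $ l * Y $ j $ k"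
  proof (rule ccontr)
    assume "\<not> ?thesis"
    then have z: "Y $ i $ k * Y $ j $ l = Y $ i $ l * Y $ j $ k" for i j k l by blast
    obtain i j where ij: "Y $ i $ j \<noteq> 0" using assms(3) by (auto simp: vec_eq_iff)
    have "c * Y $ i $ j = (Y ** Y) $ i $ j" by (simp add: sq)
    also have "\<dots> = (Y $ 1 $ 1 + Y $ 2 $ 2 + Y $ 3 $ 3 + Y $ 4 $ 4) * Y $ i $ j"
      unfolding matrix_matrix_mult_def using z[of i 1 1 j] z[of i 2 2 j] z[of i 3 3 j] z[of i 4 4 j]
      by (simp add: sum_4 algebra_simps)
    finally show False using tr ij by simp
  qed
  then obtain i j k l where m: "Y $ i $ k * Y $ j $ l - Y $ i $ l * Y $ j $ k \<noteq> 0" by fastforce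
  have col: "Y *v axis k 1 = (\<chi> i. Y $ i $ k)" for k
    by (simp add: vec_eq_iff matrix_vector_mult_def axis_def if_distrib cong: if_cong)
  show thesis
  proof (rule that[of "axis k 1" "axis l 1"])
    fix p q assume e: "p *s (Y *v axis k 1) + q *s (Y *v axis l 1) = 0"
    then have e': "p * Y $ n $ k + q * Y $ n $ l = 0" for n by (simp add: col vec_eq_iff)
    have "p * (Y $ i $ k * Y $ j $ l - Y $ i $ l * Y $ j $ k) = (p * Y $ i $ k + q * Y $ i $ l) * Y $ j $ l - (p * Y $ j $ k + q * Y $ j $ l) * Y $ i $ l"
      "q * (Y $ i $ k * Y $ j $ l - Y $ i $ l * Y $ j $ k) = (p * Y $ j $ k + q * Y $ j $ l) * Y $ i $ k - (p * Y $ i $ k + q * Y $ i $ l) * Y $ j $ k"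
      by (simp_all add: algebra_simps)
    then show "p = 0 \<and> q = 0" using m by (simp add: e')
  qed
qed

text \<open>For each square root \<open>e\<close> of \<open>m\<close> the image of
  \<open>Y = X + mat e\<close> consists of eigenvectors for \<open>e\<close>. Here
  \<open>Y ** Y\<close> is \<open>2 * e\<close> times \<open>Y\<close> while the trace of
  \<open>Y\<close> is \<open>4 * e\<close>, so that image has dimension at least two. The two roots
  together give a basis of eigenvectors.\<close>

lemma sp4_scalar_square_centralizer_dim:
  assumes X: "X \<in> sp4" and sq: "X ** X = mat m" and m: "m \<noteq> 0"
  shows "cmat.dim (centralizer_in sp4 X) = 4"
proof -
  define a where "a = csqrt m"
  have aa: "a * a = m" by (simp add: a_def flip: power2_eq_square)
  then have a0: "a \<noteq> 0" using m by auto
  have eig: "\<exists>x y. X *v x = e *s x \<and> X *v y = e *s y \<and> (\<forall>p q. p *s x + q *s y = 0 \<longrightarrow> p = 0 \<and> q = 0)"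
    if e: "e * e = m" "e \<noteq> 0" for e
  proof -
    define Y where "Y = X + mat e"
    have YY: "Y ** Y = cmat_scale (2 * e) Y"
      unfolding Y_def matrix_mult_distribs mat_mult_left mat_mult_right sq
      by (simp add: vec_eq_iff mat_def e algebra_simps)
    have tr: "Y $ 1 $ 1 + Y $ 2 $ 2 + Y $ 3 $ 3 + Y $ 4 $ 4 = 4 * e"
      using X by (simp add: Y_def mat_def sp4_iff)
    then have tr': "Y $ 1 $ 1 + Y $ 2 $ 2 + Y $ 3 $ 3 + Y $ 4 $ 4 \<noteq> 2 * e" using e(2) by simp
    have "Y \<noteq> 0" using tr e(2) by auto
    then obtain x y where xy: "\<And>p q. p *s (Y *v x) + q *s (Y *v y) = 0 \<Longrightarrow> p = 0 \<and> q = 0"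
      using two_independent_columns[OF YY tr'] by blast
    have XY: "X ** Y = cmat_scale e Y"
      unfolding Y_def matrix_mult_distribs mat_mult_right sq by (simp add: vec_eq_iff mat_def e(1) algebra_simps)
    have "X *v (Y *v x) = e *s (Y *v x)" for x
      by (simp add: matrix_vector_mul_assoc XY cmat_scale_vector_mult)
    then show ?thesis using xy by blast
  qed
  obtain w1 w2 where w12: "X *v w1 = a *s w1" "X *v w2 = a *s w2" "\<And>p q. p *s w1 + q *s w2 = 0 \<Longrightarrow> p = 0 \<and> q = 0"
    using eig[of a] aa a0 by blast
  obtain w3 w4 where w34: "X *v w3 = (- a) *s w3" "X *v w4 = (- a) *s w4" "\<And>p q. p *s w3 + q *s w4 = 0 \<Longrightarrow> p = 0 \<and> q = 0"
    using eig[of "- a"] aa a0 by auto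
  have "indep4 w1 w2 w3 w4"
    unfolding indep4_def
  proof (intro allI impI)
    fix x y z q assume e: "x *s w1 + y *s w2 + z *s w3 + q *s w4 = 0"
    have "X *v (x *s w1 + y *s w2 + z *s w3 + q *s w4) = a *s (x *s w1 + y *s w2) - a *s (z *s w3 + q *s w4)"
      by (simp add: matrix_vector_right_distrib vector_scalar_commute w12 w34 vec_eq_iff algebra_simps)
    then have "a *s (x *s w1 + y *s w2) = a *s (z *s w3 + q *s w4)" using e by simp
    then have AB: "x *s w1 + y *s w2 = z *s w3 + q *s w4" using a0 vector_mul_lcancel[of a] by blast
    from e have "(x *s w1 + y *s w2) + (z *s w3 + q *s w4) = 0" by (simp only: add.assoc)
    with AB have "(z *s w3 + q *s w4) + (z *s w3 + q *s w4) = 0" by simp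
    then have "(z *s w3 + q *s w4) $ i + (z *s w3 + q *s w4) $ i = 0" for i
      by (metis vector_add_component zero_index)
    then have "(z *s w3 + q *s w4) $ i = 0" for i by (metis mult_2 mult_eq_0_iff zero_neq_numeral)
    then have "z *s w3 + q *s w4 = 0" by (simp only: vec_eq_iff zero_index simp_thms)
    with AB have "z *s w3 + q *s w4 = 0" "x *s w1 + y *s w2 = 0" by simp_all
    then show "x = 0 \<and> y = 0 \<and> z = 0 \<and> q = 0" using w12 w34 by blast
  qed
  moreover have "X ** cols4 w1 w2 w3 w4 = cols4 w1 w2 w3 w4 ** (\<chi> i j. if i = j then if i = 1 \<or> i = 2 then a else - a else 0)"
    unfolding mult_cols4 w12 w34 by (simp add: vec_eq_iff forall_4 cols4_def matrix_matrix_mult_def sum_4)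
  ultimately show ?thesis
    using indep4_centralizer_dim[OF X] unfolding stabilizer_dim_semisimple_scalar[OF a0, symmetric] by blast
qed

lemma sym_prod_symplectic_act:
  "(- (symplectic_form ** sym_prod u v)) *v w = dot v w *s (- (symplectic_form *v u)) + dot u w *s (- (symplectic_form *v v))"
  by (simp add: vec_eq_iff forall_4 matrix_vector_mult_def matrix_matrix_mult_def sum_4 sym_prod_def symplectic_form_def dot_def algebra_simps)

lemma symplectic_inverse: "- (symplectic_form ** (symplectic_form ** X)) = X"
  by (simp add: matrix_mul_assoc symplectic_square matrix_mult_minus_left)

lemma symplectic_inverse': "symplectic_form ** - (symplectic_form ** X) = X"
  by (simp add: matrix_mult_minus_right symplectic_inverse)

lemma sp4_cubic_eq_0_iff:
  assumes "X \<noteq> 0"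
  shows "X \<in> sp4 \<and> sp4_cubic X = 0 \<longleftrightarrow> X \<in> (\<lambda>S. - (symplectic_form ** S)) ` sym_rank2"
proof
  assume X: "X \<in> sp4 \<and> sp4_cubic X = 0"
  have "symplectic_form ** X \<in> sym_rank2"
  proof (rule sym_rank2_if_minors)
    show "symplectic_form ** X \<noteq> 0" using assms symplectic_inverse[of X] by auto
  qed (use X sp4_sym minor3_zero in auto)
  then show "X \<in> (\<lambda>S. - (symplectic_form ** S)) ` sym_rank2"
    by (intro image_eqI[of _ _ "symplectic_form ** X"]) (simp_all add: symplectic_inverse)
next
  assume "X \<in> (\<lambda>S. - (symplectic_form ** S)) ` sym_rank2"
  then obtain u v where S: "X = - (symplectic_form ** sym_prod u v)" by (auto simp: sym_rank2_def)
  have X: "X \<in> sp4"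
    unfolding S sp4_iff by (simp add: symplectic_mult_nth) (simp add: sym_prod_def)
  have "minor3 (symplectic_form ** X) a b c i j k = 0" for a b c i j k
    unfolding S symplectic_inverse' by (rule minor3_sym_prod)
  then have "sp4_cubic X = 0"
    using minor3_adjugate[OF X] by (simp add: vec_eq_iff forall_4)
  with X show "X \<in> sp4 \<and> sp4_cubic X = 0" by simp
qed

text \<open>Dimensions 4 and 6 are impossible off the cones, where the dimension is at most 2, and
  at \<open>0\<close>, where it is 10. On the cones they come from the normal forms.\<close>

lemma sp4_strata:
  "sp4_stratum 6 \<union> sp4_stratum 4 = {X \<in> sp4. X \<noteq> 0 \<and> (sp4_nil X = 0 \<or> sp4_cubic X = 0)}"
proof -
  have "cmat.dim (centralizer_in sp4 X) = 4 \<or> cmat.dim (centralizer_in sp4 X) = 6 \<longleftrightarrow>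
    X \<noteq> 0 \<and> (sp4_nil X = 0 \<or> sp4_cubic X = 0)" if X: "X \<in> sp4" for X
  proof
    assume d: "cmat.dim (centralizer_in sp4 X) = 4 \<or> cmat.dim (centralizer_in sp4 X) = 6"
    have "cmat.dim (centralizer_in sp4 0) = 10"
      using centralizer_dim_eq_stabilizer_dim[of 0 "mat 1" "mat 1" 0] stabilizer_dim_zero by (simp add: sp4_iff)
    then have "X \<noteq> 0" using d by auto
    then show "X \<noteq> 0 \<and> (sp4_nil X = 0 \<or> sp4_cubic X = 0)" using sp4_regular_centralizer_dim[OF X] d
      by (cases "sp4_nil X = 0"; cases "sp4_cubic X = 0"; simp)
  next
    assume n: "X \<noteq> 0 \<and> (sp4_nil X = 0 \<or> sp4_cubic X = 0)"
    have cubic: "cmat.dim (centralizer_in sp4 X) = 4 \<or> cmat.dim (centralizer_in sp4 X) = 6" if c0: "sp4_cubic X = 0"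
    proof -
      obtain u v where S: "X = - (symplectic_form ** sym_prod u v)"
        using sp4_cubic_eq_0_iff[of X] c0 n X by (auto simp: sym_rank2_def)
      show ?thesis
        by (rule sp4_rank2_centralizer_dim[OF X _ refl refl]) (use n in \<open>auto simp: S sym_prod_symplectic_act\<close>)
    qed
    show "cmat.dim (centralizer_in sp4 X) = 4 \<or> cmat.dim (centralizer_in sp4 X) = 6"
    proof (cases "sp4_cubic X = 0")
      case False
      then have N: "sp4_nil X = 0" using n by simp
      then have "X ** X = mat (sp4_mean X)" using square_eq_mean_nil[of X] by simp
      \<comment> \<open>With \<open>sp4_nil X = 0\<close> the matrix \<open>sp4_cubic X\<close> is
        the negative of \<open>sp4_mean X\<close> times \<open>X\<close>.\<close>
      moreover have "sp4_mean X \<noteq> 0" using False N by (auto simp: sp4_cubic_def)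
      ultimately show ?thesis using sp4_scalar_square_centralizer_dim[OF X] by blast
    qed (rule cubic)
  qed
  then show ?thesis by (auto simp: sp4_stratum_def)
qed

section \<open>Bivectors of \<open>\<complex>\<^sup>5\<close>\<close>

lemma exhaust_5:
  fixes x :: 5
  shows "x = 1 \<or> x = 2 \<or> x = 3 \<or> x = 4 \<or> x = 5"
proof (induct x)
  case (of_int z)
  then have "z = 0 \<or> z = 1 \<or> z = 2 \<or> z = 3 \<or> z = 4" by fastforce
  then show ?case by auto
qed

lemma forall_5: "(\<forall>i::5. P i) \<longleftrightarrow> P 1 \<and> P 2 \<and> P 3 \<and> P 4 \<and> P 5"
  by (metis exhaust_5)

definition plucker :: "complex^'n^'n \<Rightarrow> 'n \<Rightarrow> 'n \<Rightarrow> 'n \<Rightarrow> 'n \<Rightarrow> complex" where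
  "plucker P i j k l = P $ i $ j * P $ k $ l - P $ i $ k * P $ j $ l + P $ i $ l * P $ j $ k"

lemma plucker_wedge_prod: "plucker (wedge_prod u v) i j k l = 0"
  by (simp add: plucker_def wedge_prod_def algebra_simps)

text \<open>The relation for \<open>i\<close>, \<open>j\<close>, \<open>k\<close>, \<open>l\<close>
  with \<open>P $ i $ j\<close> nonzero writes each entry through rows \<open>i\<close> and
  \<open>j\<close>.\<close>

lemma wedge_cone_if_plucker:
  assumes alt: "\<And>i j. P $ j $ i = - P $ i $ j" and "P \<noteq> 0" and pl: "\<And>i j k l. plucker P i j k l = 0"
  shows "P \<in> wedge_cone"
proof -
  obtain i j where ij: "P $ i $ j \<noteq> 0" using assms(2) by (auto simp: vec_eq_iff)
  have "P $ k $ l = (P $ i $ k * P $ j $ l - P $ j $ k * P $ i $ l) / P $ i $ j" for k l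
    using pl[of i j k l] ij by (simp add: plucker_def field_simps)
  moreover have "wedge_prod ((1 / P $ i $ j) *s (P $ i)) (P $ j) $ k $ l = (P $ i $ k * P $ j $ l - P $ j $ k * P $ i $ l) / P $ i $ j" for k l
    by (simp add: wedge_prod_def diff_divide_distrib)
  ultimately have "P = wedge_prod ((1 / P $ i $ j) *s (P $ i)) (P $ j)" by (metis vec_eq_iff)
  then show ?thesis using assms(2) unfolding wedge_cone_def by blast
qed

lemma plucker_swap:
  assumes "\<And>i j. P $ j $ i = - P $ i $ j"
  shows "plucker P j i k l = - plucker P i j k l" "plucker P i k j l = - plucker P i j k l" "plucker P i j l k = - plucker P i j k l"
  using assms[of i j] assms[of k j] assms[of l k] by (simp_all add: plucker_def)

lemma plucker_eq:
  assumes "\<And>i j. P $ j $ i = - P $ i $ j"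
  shows "plucker P i i k l = 0" "plucker P i j j l = 0" "plucker P i j k k = 0"
    "plucker P i j i l = 0" "plucker P i j k j = 0" "plucker P i j k i = 0"
proof -
  have dbl: "z = - z \<longleftrightarrow> z = 0" for z :: complex by (metis equation_minus_iff neg_equal_iff_equal eq_neg_iff_add_eq_0 mult_2 mult_eq_0_iff zero_neq_numeral add.inverse_neutral)
  show 1: "plucker P i i k l = 0" "plucker P i j j l = 0" "plucker P i j k k = 0" for i j k l
    using plucker_swap(1)[OF assms, of i i k l] plucker_swap(2)[OF assms, of i j j l] plucker_swap(3)[OF assms, of i j k k]
    by (simp_all add: dbl)
  show 2: "plucker P i j i l = 0" "plucker P i j k j = 0" for i j k l
    using plucker_swap(2)[OF assms, of i i j l] plucker_swap(3)[OF assms, of i j j k] by (simp_all add: 1)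
  show "plucker P i j k i = 0"
    using plucker_swap(3)[OF assms, of i j i k] by (simp add: 2)
qed

text \<open>For alternating \<open>P\<close> the expression is alternating in its four indices, so
  it vanishes on repetitions and the five increasing quadruples decide.\<close>

lemma plucker_zero_5:
  fixes P :: "complex^5^5"
  assumes alt: "\<And>i j. P $ j $ i = - P $ i $ j"
    and z: "plucker P 1 2 3 4 = 0" "plucker P 1 2 3 5 = 0" "plucker P 1 2 4 5 = 0" "plucker P 1 3 4 5 = 0" "plucker P 2 3 4 5 = 0"
  shows "plucker P i j k l = 0"
proof -
  note s1 = plucker_swap(1)[OF alt] and s2 = plucker_swap(2)[OF alt] and s3 = plucker_swap(3)[OF alt]
  note sort =
    s1[where i = 1 and j = 2] s1[where i = 1 and j = 3] s1[where i = 1 and j = 4] s1[where i = 1 and j = 5] s1[where i = 2 and j = 3] s1[where i = 2 and j = 4] s1[where i = 2 and j = 5] s1[where i = 3 and j = 4] s1[where i = 3 and j = 5] s1[where i = 4 and j = 5]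
    s2[where j = 1 and k = 2] s2[where j = 1 and k = 3] s2[where j = 1 and k = 4] s2[where j = 1 and k = 5] s2[where j = 2 and k = 3] s2[where j = 2 and k = 4] s2[where j = 2 and k = 5] s2[where j = 3 and k = 4] s2[where j = 3 and k = 5] s2[where j = 4 and k = 5]
    s3[where k = 1 and l = 2] s3[where k = 1 and l = 3] s3[where k = 1 and l = 4] s3[where k = 1 and l = 5] s3[where k = 2 and l = 3] s3[where k = 2 and l = 4] s3[where k = 2 and l = 5] s3[where k = 3 and l = 4] s3[where k = 3 and l = 5] s3[where k = 4 and l = 5]
  note e = plucker_eq[OF alt]
  have p12: "plucker P i j 1 2 = 0" for i j
    using exhaust_5[of i] exhaust_5[of j] by (elim disjE) (simp_all only: sort e z minus_zero)
  have p13: "plucker P i j 1 3 = 0" for i j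
    using exhaust_5[of i] exhaust_5[of j] by (elim disjE) (simp_all only: sort e z minus_zero)
  have p14: "plucker P i j 1 4 = 0" for i j
    using exhaust_5[of i] exhaust_5[of j] by (elim disjE) (simp_all only: sort e z minus_zero)
  have p15: "plucker P i j 1 5 = 0" for i j
    using exhaust_5[of i] exhaust_5[of j] by (elim disjE) (simp_all only: sort e z minus_zero)
  have p23: "plucker P i j 2 3 = 0" for i j
    using exhaust_5[of i] exhaust_5[of j] by (elim disjE) (simp_all only: sort e z minus_zero)
  have p24: "plucker P i j 2 4 = 0" for i j
    using exhaust_5[of i] exhaust_5[of j] by (elim disjE) (simp_all only: sort e z minus_zero)
  have p25: "plucker P i j 2 5 = 0" for i j
    using exhaust_5[of i] exhaust_5[of j] by (elim disjE) (simp_all only: sort e z minus_zero)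
  have p34: "plucker P i j 3 4 = 0" for i j
    using exhaust_5[of i] exhaust_5[of j] by (elim disjE) (simp_all only: sort e z minus_zero)
  have p35: "plucker P i j 3 5 = 0" for i j
    using exhaust_5[of i] exhaust_5[of j] by (elim disjE) (simp_all only: sort e z minus_zero)
  have p45: "plucker P i j 4 5 = 0" for i j
    using exhaust_5[of i] exhaust_5[of j] by (elim disjE) (simp_all only: sort e z minus_zero)
  show ?thesis
    using exhaust_5[of k] exhaust_5[of l]
    by (elim disjE) (simp_all only: sort e minus_zero p12 p13 p14 p15 p23 p24 p25 p34 p35 p45)
qed

text \<open>Coordinates in which the entries of \<open>sp4_nil X\<close> become the Plucker relations of a bivector of \<open>\<complex>\<^sup>5\<close>:
  they realise the isomorphism of \<open>sp\<^sub>4\<close> with \<open>so\<^sub>5\<close>.\<close>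

definition sp4_of_bivector :: "complex^5^5 \<Rightarrow> complex^4^4" where
  "sp4_of_bivector P = (\<chi> i j.
     if i = 1 then if j = 1 then (P $ 1 $ 2 - P $ 4 $ 5) / 2 else if j = 2 then P $ 3 $ 4 else if j = 3 then P $ 1 $ 4 else - P $ 1 $ 3
     else if i = 2 then if j = 1 then P $ 3 $ 5 else if j = 2 then (P $ 1 $ 2 + P $ 4 $ 5) / 2 else if j = 3 then - P $ 1 $ 3 else P $ 1 $ 5
     else if i = 3 then if j = 1 then P $ 2 $ 5 else if j = 2 then P $ 2 $ 3 else if j = 3 then (P $ 4 $ 5 - P $ 1 $ 2) / 2 else - P $ 3 $ 5
     else if j = 1 then P $ 2 $ 3 else if j = 2 then P $ 2 $ 4 else if j = 3 then - P $ 3 $ 4 else - (P $ 1 $ 2 + P $ 4 $ 5) / 2)"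

definition bivector_of_sp4 :: "complex^4^4 \<Rightarrow> complex^5^5" where
  "bivector_of_sp4 X = (let m = (\<lambda>i j.
     if i = 1 then if j = 2 then X $ 1 $ 1 + X $ 2 $ 2 else if j = 3 then - X $ 2 $ 3 else if j = 4 then X $ 1 $ 3 else if j = 5 then X $ 2 $ 4 else 0
     else if i = 2 then if j = 3 then X $ 4 $ 1 else if j = 4 then X $ 4 $ 2 else if j = 5 then X $ 3 $ 1 else 0
     else if i = 3 then if j = 4 then X $ 1 $ 2 else if j = 5 then X $ 2 $ 1 else 0
     else if i = 4 then if j = 5 then X $ 2 $ 2 - X $ 1 $ 1 else 0 else 0)
   in \<chi> i j. m i j - m j i)"

lemma sp4_of_bivector_nth:
  "sp4_of_bivector P $ 1 $ 1 = (P $ 1 $ 2 - P $ 4 $ 5) / 2" "sp4_of_bivector P $ 1 $ 2 = P $ 3 $ 4"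
  "sp4_of_bivector P $ 1 $ 3 = P $ 1 $ 4" "sp4_of_bivector P $ 1 $ 4 = - P $ 1 $ 3"
  "sp4_of_bivector P $ 2 $ 1 = P $ 3 $ 5" "sp4_of_bivector P $ 2 $ 2 = (P $ 1 $ 2 + P $ 4 $ 5) / 2"
  "sp4_of_bivector P $ 2 $ 3 = - P $ 1 $ 3" "sp4_of_bivector P $ 2 $ 4 = P $ 1 $ 5"
  "sp4_of_bivector P $ 3 $ 1 = P $ 2 $ 5" "sp4_of_bivector P $ 3 $ 2 = P $ 2 $ 3"
  "sp4_of_bivector P $ 3 $ 3 = (P $ 4 $ 5 - P $ 1 $ 2) / 2" "sp4_of_bivector P $ 3 $ 4 = - P $ 3 $ 5"
  "sp4_of_bivector P $ 4 $ 1 = P $ 2 $ 3" "sp4_of_bivector P $ 4 $ 2 = P $ 2 $ 4"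
  "sp4_of_bivector P $ 4 $ 3 = - P $ 3 $ 4" "sp4_of_bivector P $ 4 $ 4 = - (P $ 1 $ 2 + P $ 4 $ 5) / 2"
  by (simp_all add: sp4_of_bivector_def)

lemma bivector_of_sp4_alt: "bivector_of_sp4 X $ j $ i = - bivector_of_sp4 X $ i $ j"
  by (simp add: bivector_of_sp4_def Let_def)

lemma bivector_of_sp4_nth:
  "bivector_of_sp4 X $ 1 $ 2 = X $ 1 $ 1 + X $ 2 $ 2" "bivector_of_sp4 X $ 1 $ 3 = - X $ 2 $ 3"
  "bivector_of_sp4 X $ 1 $ 4 = X $ 1 $ 3" "bivector_of_sp4 X $ 1 $ 5 = X $ 2 $ 4"
  "bivector_of_sp4 X $ 2 $ 3 = X $ 4 $ 1" "bivector_of_sp4 X $ 2 $ 4 = X $ 4 $ 2" "bivector_of_sp4 X $ 2 $ 5 = X $ 3 $ 1"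
  "bivector_of_sp4 X $ 3 $ 4 = X $ 1 $ 2" "bivector_of_sp4 X $ 3 $ 5 = X $ 2 $ 1"
  "bivector_of_sp4 X $ 4 $ 5 = X $ 2 $ 2 - X $ 1 $ 1"
  by (simp_all add: bivector_of_sp4_def)

lemma sp4_of_bivector_mem: "sp4_of_bivector P \<in> sp4"
  unfolding sp4_iff by (simp add: sp4_of_bivector_nth field_simps)

lemma sp4_of_bivector_of_sp4:
  assumes "X \<in> sp4"
  shows "sp4_of_bivector (bivector_of_sp4 X) = X"
  using assms unfolding sp4_iff
  by (simp add: vec_eq_iff forall_4 sp4_of_bivector_nth bivector_of_sp4_nth)

lemma bivector_of_sp4_of_bivector:
  assumes alt: "\<And>i j. P $ j $ i = - P $ i $ j"
  shows "bivector_of_sp4 (sp4_of_bivector P) = P"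
proof -
  let ?Q = "bivector_of_sp4 (sp4_of_bivector P)"
  have d: "P $ i $ i = 0" "?Q $ i $ i = 0" for i
    using alt[of i i] bivector_of_sp4_alt[of _ i i] by (metis add.left_inverse mult_2 mult_eq_0_iff zero_neq_numeral)+
  have u: "?Q $ 1 $ 2 = P $ 1 $ 2" "?Q $ 1 $ 3 = P $ 1 $ 3" "?Q $ 1 $ 4 = P $ 1 $ 4" "?Q $ 1 $ 5 = P $ 1 $ 5"
    "?Q $ 2 $ 3 = P $ 2 $ 3" "?Q $ 2 $ 4 = P $ 2 $ 4" "?Q $ 2 $ 5 = P $ 2 $ 5" "?Q $ 3 $ 4 = P $ 3 $ 4" "?Q $ 3 $ 5 = P $ 3 $ 5"
    "?Q $ 4 $ 5 = P $ 4 $ 5"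
    by (simp_all add: bivector_of_sp4_nth sp4_of_bivector_nth field_simps)
  have l: "?Q $ j $ i = P $ j $ i" if "?Q $ i $ j = P $ i $ j" for i j
    using that alt[of i j] bivector_of_sp4_alt[of "sp4_of_bivector P" i j] by simp
  show ?thesis
    unfolding vec_eq_iff forall_5 by (simp only: u u[THEN l] d simp_thms)
qed

text \<open>The right-hand sides are, up to sign, the Pfaffians of the five principal four by four
  blocks of the bivector.\<close>

lemma sp4_nil_plucker:
  assumes "X \<in> sp4"
  shows "sp4_nil X $ 1 $ 2 = plucker (bivector_of_sp4 X) 1 2 3 4" "sp4_nil X $ 2 $ 1 = plucker (bivector_of_sp4 X) 1 2 3 5"
    "2 * sp4_nil X $ 1 $ 1 = - plucker (bivector_of_sp4 X) 1 2 4 5" "sp4_nil X $ 1 $ 4 = plucker (bivector_of_sp4 X) 1 3 4 5"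
    "sp4_nil X $ 3 $ 2 = plucker (bivector_of_sp4 X) 2 3 4 5"
  using assms unfolding sp4_iff plucker_def bivector_of_sp4_nth
  by (simp_all add: sp4_nil_def sp4_mean_def mat_def matrix_matrix_mult_def sum_4 field_simps)

lemma sp4_nil_eq_0_iff:
  assumes "X \<noteq> 0"
  shows "X \<in> sp4 \<and> sp4_nil X = 0 \<longleftrightarrow> X \<in> sp4_of_bivector ` wedge_cone"
proof
  assume X: "X \<in> sp4 \<and> sp4_nil X = 0"
  note inv = sp4_of_bivector_of_sp4[OF conjunct1[OF X]]
  have "bivector_of_sp4 X \<in> wedge_cone"
  proof (rule wedge_cone_if_plucker[OF bivector_of_sp4_alt])
    have "sp4_of_bivector 0 = 0" by (simp add: vec_eq_iff forall_4 sp4_of_bivector_nth)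
    then show "bivector_of_sp4 X \<noteq> 0" using assms inv by auto
    show "plucker (bivector_of_sp4 X) i j k l = 0" for i j k l
      by (rule plucker_zero_5[OF bivector_of_sp4_alt]) (use X sp4_nil_plucker[of X] in auto)
  qed
  then show "X \<in> sp4_of_bivector ` wedge_cone" using inv by (metis imageI)
next
  assume "X \<in> sp4_of_bivector ` wedge_cone"
  then obtain u v where X: "X = sp4_of_bivector (wedge_prod u v)" by (auto simp: wedge_cone_def)
  have X4: "X \<in> sp4" unfolding X by (rule sp4_of_bivector_mem)
  have inv: "bivector_of_sp4 X = wedge_prod u v"
    unfolding X by (rule bivector_of_sp4_of_bivector) (simp add: wedge_prod_def)
  note n = sp4_nil_plucker[OF X4, unfolded inv plucker_wedge_prod]
  show "X \<in> sp4 \<and> sp4_nil X = 0"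
    using X4 n by (simp add: vec_eq_iff forall_4 sp4_nil_nth[OF X4])
qed

section \<open>The two components\<close>

lemma polynomial_functions_compose:
  assumes "f \<in> polynomial_functions" "\<And>i j. (\<lambda>x. L x $ i $ j) \<in> polynomial_functions"
  shows "(\<lambda>x. f (L x)) \<in> polynomial_functions"
  using assms(1) by induction (auto intro: polynomial_functions.intros assms(2))

lemma continuous_on_polynomial_functions: "f \<in> polynomial_functions \<Longrightarrow> continuous_on S f"
  by (induction rule: polynomial_functions.induct) (auto intro!: continuous_intros)

lemma continuous_on_polynomial_map:
  assumes "\<And>i j. (\<lambda>x. L x $ i $ j) \<in> polynomial_functions"
  shows "continuous_on S L"
proof -
  have "continuous_on S (\<lambda>x. \<chi> i j. L x $ i $ j)"
    by (intro continuous_on_vec_lambda continuous_on_polynomial_functions assms)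
  then show ?thesis by simp
qed

lemma zariski_prime_image:
  assumes X: "zariski_prime X" and L: "\<And>i j. (\<lambda>x. L x $ i $ j) \<in> polynomial_functions"
  shows "zariski_prime (L ` X)"
  unfolding zariski_prime_def
proof (intro conjI ballI impI)
  show "L ` X \<noteq> {}" using X by (auto simp: zariski_prime_def)
  fix f g
  assume f: "f \<in> polynomial_functions" and g: "g \<in> polynomial_functions" and fg: "\<forall>x\<in>L ` X. f x * g x = 0"
  show "(\<forall>x\<in>L ` X. f x = 0) \<or> (\<forall>x\<in>L ` X. g x = 0)"
    using zariski_primeD[OF X polynomial_functions_compose[OF f L] polynomial_functions_compose[OF g L]] fg by auto
qed

text \<open>Along the curve \<open>f\<close> is a polynomial in \<open>t\<close> with infinitely
  many zeros. It carries vanishing from the general points of a parametrized cone to the special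
  ones.\<close>

lemma polynomial_functions_curve_limit:
  assumes f: "f \<in> polynomial_functions" and \<gamma>: "\<And>i j. \<exists>p. \<forall>t. \<gamma> t $ i $ j = poly p t"
    and fin: "finite F" and z: "\<And>t. t \<notin> F \<Longrightarrow> f (\<gamma> t) = 0"
  shows "f (\<gamma> t) = 0"
proof -
  obtain p where p: "\<And>t. f (\<gamma> t) = poly p t" using polynomial_functions_on_curve[OF f \<gamma>] by blast
  have "p = 0"
  proof (rule ccontr)
    assume "p \<noteq> 0"
    then have "finite {t. poly p t = 0}" by (rule poly_roots_finite)
    moreover have "UNIV \<subseteq> F \<union> {t. poly p t = 0}" using z p by auto
    ultimately have "finite (UNIV :: complex set)" using fin finite_subset by blast
    then show False using infinite_UNIV_char_0 by blast
  qed
  then show ?thesis by (simp add: p)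
qed

text \<open>\<open>L\<close> has a polynomial inverse on its image, so it transports the chain, the
  parametrization and the local homology at once. The chain and the parametrization give Krull
  dimension \<open>d\<close> from below and above, matching the degree \<open>2 * d\<close> of the
  local homology.\<close>

lemma rational_homology_manifold_image:
  fixes X :: "(complex^'n^'m) set" and L :: "complex^'n^'m \<Rightarrow> complex^'k^'l"
  assumes L: "\<And>i j. (\<lambda>x. L x $ i $ j) \<in> polynomial_functions" and M: "\<And>i j. (\<lambda>x. M x $ i $ j) \<in> polynomial_functions"
    and leftinv: "\<And>x. x \<in> X \<Longrightarrow> M (L x) = x"
    and closed: "locally_closedin zariski (L ` X)"
    and chain: "\<And>i. i \<le> d \<Longrightarrow> zariski_prime (W i)" "\<And>i. i < d \<Longrightarrow> W i \<subseteq> W (Suc i)" "W d = X"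
      "\<And>i. i < d \<Longrightarrow> \<exists>f\<in>polynomial_functions. (\<forall>x\<in>W i. f x = 0) \<and> (\<exists>x\<in>W (Suc i). f x \<noteq> 0)"
    and \<Phi>: "\<And>i j. \<exists>D. (\<lambda>w. \<Phi> w $ i $ j) \<in> box_polys xs D" "length xs = d"
    and dense: "\<And>f. f \<in> polynomial_functions \<Longrightarrow> \<forall>w. f (\<Phi> w) = 0 \<Longrightarrow> \<forall>x\<in>X. f x = 0"
    and rank: "\<And>x. x \<in> X \<Longrightarrow> local_rank X x (2 * d)"
  shows "rational_homology_manifold (L ` X)"
proof -
  have WX: "W i \<subseteq> X" if "i \<le> d" for i
    using that unfolding chain(3)[symmetric]
    by (induction rule: inc_induct) (use chain(2) in auto)
  have "krull_dim (subtopology zariski (L ` X)) \<le> enat (length xs)"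
  proof (rule krull_dim_le[where \<Phi> = "\<lambda>w. L (\<Phi> w)"])
    show "\<exists>D. (\<lambda>w. L (\<Phi> w) $ i $ j) \<in> box_polys xs D" for i j
      by (rule polynomial_functions_box[OF L \<Phi>(1)])
    show "\<forall>x\<in>L ` X. f x = 0" if "f \<in> polynomial_functions" "\<forall>w. f (L (\<Phi> w)) = 0" for f
      using dense[OF polynomial_functions_compose[OF that(1) L]] that(2) by auto
  qed
  moreover have "enat d \<le> krull_dim (subtopology zariski (L ` X))"
  proof (rule krull_dim_ge[where W = "\<lambda>i. L ` W i"])
    show "zariski_prime (L ` W i)" if "i \<le> d" for i using zariski_prime_image[OF chain(1)[OF that] L] .
    show "L ` W i \<subseteq> L ` X" if "i \<le> d" for i using WX[OF that] by blast
    fix i assume i: "i < d"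
    show "L ` W i \<subseteq> L ` W (Suc i)" using chain(2)[OF i] by blast
    obtain f where f: "f \<in> polynomial_functions" "\<forall>x\<in>W i. f x = 0" "\<exists>x\<in>W (Suc i). f x \<noteq> 0" using chain(4)[OF i] by blast
    have "M (L x) = x" if "x \<in> W i \<or> x \<in> W (Suc i)" for x using that WX[of i] WX[of "Suc i"] leftinv i by auto
    then show "\<exists>f\<in>polynomial_functions. (\<forall>x\<in>L ` W i. f x = 0) \<and> (\<exists>x\<in>L ` W (Suc i). f x \<noteq> 0)"
      using f by (intro bexI[OF _ polynomial_functions_compose[OF f(1) M]]) auto
  qed
  ultimately have dim: "krull_dim (subtopology zariski (L ` X)) = enat d" using \<Phi>(2) by (simp add: antisym)
  have hom: "homeomorphism X (L ` X) L M"
    by (rule homeomorphismI') (use leftinv continuous_on_polynomial_map L M in auto)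
  have zp: "zariski_prime (L ` X)" using zariski_prime_image[OF chain(1)[of d] L] chain(3) by simp
  have H: "if i = 2 * d then rat_relative_homology_group i (top_of_set (L ` X)) (L ` X - {y}) \<cong> rat_additive_group
      else trivial_group (rat_relative_homology_group i (top_of_set (L ` X)) (L ` X - {y}))" if "y \<in> L ` X" for y i
  proof -
    have "local_rank (L ` X) y (2 * d)" using that rank hom local_rank_homeomorphism by blast
    then have "if i = 2 * d then rank_one_group (relative_homology_group (int i) (top_of_set (L ` X)) (L ` X - {y}))
      else torsion_group (relative_homology_group (int i) (top_of_set (L ` X)) (L ` X - {y}))"
      unfolding local_rank_def by blast
    then show ?thesis
      by (cases "i = 2 * d") (simp_all only: if_True if_False simp_thms rat_homology_rank_one rat_homology_trivial)
  qed
  show ?thesis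
    unfolding rational_homology_manifold_def irreducible_space_iff_zariski_prime
    by (intro conjI closed zp exI[of _ d] dim ballI allI) (rule H)
qed

section \<open>Chains and parametrizations of the cones\<close>

text \<open>The sign \<open>\<epsilon>\<close> treats symmetric (\<open>1\<close>) and alternating
  (\<open>- 1\<close>) products together.\<close>

definition rank2_prod :: "complex \<Rightarrow> complex^'n \<Rightarrow> complex^'n \<Rightarrow> complex^'n^'n" where
  "rank2_prod \<epsilon> u v = (\<chi> i j. u $ i * v $ j + \<epsilon> * (v $ i * u $ j))"

definition rank2_products :: "complex \<Rightarrow> (complex^'n) set \<Rightarrow> (complex^'n) set \<Rightarrow> (complex^'n^'n) set" where
  "rank2_products \<epsilon> U V = {S. S \<noteq> 0 \<and> (\<exists>u\<in>U. \<exists>v\<in>V. S = rank2_prod \<epsilon> u v)}"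

lemma rank2_prod_nth [simp]: "rank2_prod \<epsilon> u v $ i $ j = u $ i * v $ j + \<epsilon> * (v $ i * u $ j)"
  by (simp add: rank2_prod_def)

lemma sym_rank2_eq: "(sym_rank2 :: (complex^'n^'n) set) = rank2_products 1 UNIV UNIV"
proof -
  have "sym_prod u v = rank2_prod 1 u v" for u v :: "complex^'n" by (simp add: vec_eq_iff sym_prod_def)
  then show ?thesis by (simp add: sym_rank2_def rank2_products_def)
qed

lemma wedge_cone_eq: "(wedge_cone :: (complex^'n^'n) set) = rank2_products (- 1) UNIV UNIV"
proof -
  have "wedge_prod u v = rank2_prod (- 1) u v" for u v :: "complex^'n" by (simp add: vec_eq_iff wedge_prod_def)
  then show ?thesis by (simp add: wedge_cone_def rank2_products_def)
qed

lemma rank2_products_mono: "U \<subseteq> U' \<Longrightarrow> V \<subseteq> V' \<Longrightarrow> rank2_products \<epsilon> U V \<subseteq> rank2_products \<epsilon> U' V'"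
  by (auto simp: rank2_products_def)

lemma rank2_prod_line:
  "\<exists>p. \<forall>t. rank2_prod \<epsilon> (u + t *s u') (v + t *s v') $ i $ j = poly p t"
  by (rule exI[of _ "[:u $ i, u' $ i:] * [:v $ j, v' $ j:] + [:\<epsilon>:] * ([:v $ i, v' $ i:] * [:u $ j, u' $ j:])"])
    (simp add: algebra_simps)

definition line_closed :: "(complex^'n) set \<Rightarrow> bool" where
  "line_closed U \<longleftrightarrow> (\<forall>u\<in>U. \<forall>u'\<in>U. \<forall>t. u + t *s (u' - u) \<in> U)"

text \<open>Moving both factors along lines joins two products by a curve whose entries are at most
  quadratic in \<open>t\<close>. An entry that is nonzero at the start has finitely many zeros, so
  the curve meets \<open>0\<close> only finitely often.\<close>

lemma zariski_prime_rank2_products: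
  assumes "rank2_products \<epsilon> U V \<noteq> {}"
    and U: "line_closed U" and V: "line_closed V"
  shows "zariski_prime (rank2_products \<epsilon> U V)"
proof (rule zariski_prime_rational_curves[OF assms(1)])
  fix x y assume x: "x \<in> rank2_products \<epsilon> U V" and y: "y \<in> rank2_products \<epsilon> U V"
  obtain u v where uv: "u \<in> U" "v \<in> V" "x = rank2_prod \<epsilon> u v" using x by (auto simp: rank2_products_def)
  obtain u' v' where uv': "u' \<in> U" "v' \<in> V" "y = rank2_prod \<epsilon> u' v'" using y by (auto simp: rank2_products_def)
  define \<gamma> where "\<gamma> t = rank2_prod \<epsilon> (u + t *s (u' - u)) (v + t *s (v' - v))" for t
  have p: "\<exists>p. \<forall>t. \<gamma> t $ i $ j = poly p t" for i j unfolding \<gamma>_def by (rule rank2_prod_line)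
  have g0: "\<gamma> 0 = x" "\<gamma> 1 = y" by (simp_all add: \<gamma>_def uv uv')
  have "x \<noteq> 0" using x by (simp add: rank2_products_def)
  then obtain i j where "\<gamma> 0 $ i $ j \<noteq> 0" unfolding g0 by (auto simp: vec_eq_iff)
  moreover obtain q where q: "\<And>t. \<gamma> t $ i $ j = poly q t" using p by blast
  ultimately have "q \<noteq> 0" by auto
  then have "finite {t. \<gamma> t $ i $ j = 0}" unfolding q by (rule poly_roots_finite)
  moreover have "{t. \<gamma> t \<notin> rank2_products \<epsilon> U V} \<subseteq> {t. \<gamma> t $ i $ j = 0}"
  proof clarsimp
    fix t assume n: "\<gamma> t \<notin> rank2_products \<epsilon> U V"
    have "\<gamma> t = 0"
      using n U V uv uv' unfolding line_closed_def rank2_products_def \<gamma>_def by blast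
    then show "\<gamma> t $ i $ j = 0" by simp
  qed
  ultimately have "finite {t. \<gamma> t \<notin> rank2_products \<epsilon> U V}" by (rule finite_subset[rotated])
  with p g0 show "\<exists>\<gamma> a b. (\<forall>i j. \<exists>p. \<forall>t. \<gamma> t $ i $ j = poly p t) \<and> \<gamma> a = x \<and> \<gamma> b = y \<and> finite {t. \<gamma> t \<notin> rank2_products \<epsilon> U V}"
    by blast
qed

lemma line_closed_simps [simp]: "line_closed (coord_space I)" "line_closed {a :: complex^'n}" "line_closed UNIV"
  by (simp_all add: line_closed_def coord_space_def)

lemma coord_space_mono: "I \<subseteq> K \<Longrightarrow> coord_space I \<subseteq> coord_space K"
  by (auto simp: coord_space_def)

lemma axis_in_coord_space: "axis k c \<in> coord_space I \<longleftrightarrow> c = 0 \<or> k \<in> I"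
  by (auto simp: coord_space_def axis_def)

lemma rank2_prod_axis_mem:
  assumes "axis k c \<in> U" "axis l 1 \<in> V" "c \<noteq> 0" "k \<noteq> l \<or> \<epsilon> \<noteq> - 1"
  shows "rank2_prod \<epsilon> (axis k c) (axis l 1) \<in> rank2_products \<epsilon> U V"
proof -
  have "rank2_prod \<epsilon> (axis k c) (axis l 1) $ k $ l = (if k = l then (1 + \<epsilon>) * c else c)"
    by (simp add: axis_def algebra_simps)
  also have "\<dots> \<noteq> 0" using assms(3,4) by (auto simp: add_eq_0_iff)
  finally have "rank2_prod \<epsilon> (axis k c) (axis l 1) \<noteq> 0" by (metis zero_index)
  then show ?thesis using assms(1,2) unfolding rank2_products_def by blast
qed

lemma polynomial_functions_entry_diff: "(\<lambda>S. S $ i $ j - c) \<in> polynomial_functions"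
  using polynomial_functions.add[OF polynomial_functions.entry[of i j] polynomial_functions.const[of "- c"]] by simp

lemma rank2_products_separated:
  assumes "f \<in> polynomial_functions" "\<And>u v. u \<in> U \<Longrightarrow> v \<in> V \<Longrightarrow> f (rank2_prod \<epsilon> u v) = 0"
    and "axis k c \<in> U'" "axis l 1 \<in> V'" "c \<noteq> 0" "k \<noteq> l \<or> \<epsilon> \<noteq> - 1"
    and "f (rank2_prod \<epsilon> (axis k c) (axis l 1)) \<noteq> 0"
  shows "\<exists>f\<in>polynomial_functions. (\<forall>x\<in>rank2_products \<epsilon> U V. f x = 0) \<and> (\<exists>x\<in>rank2_products \<epsilon> U' V'. f x \<noteq> 0)"
proof (intro bexI[OF _ assms(1)] conjI)
  show "\<forall>x\<in>rank2_products \<epsilon> U V. f x = 0" using assms(2) by (auto simp: rank2_products_def)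
  show "\<exists>x\<in>rank2_products \<epsilon> U' V'. f x \<noteq> 0" using assms(7) rank2_prod_axis_mem[OF assms(3-6)] by blast
qed

lemma rank2_prod_scale: "c \<noteq> 0 \<Longrightarrow> rank2_prod \<epsilon> (c *s u) ((1 / c) *s v) = rank2_prod \<epsilon> u v"
  by (simp add: vec_eq_iff)

lemma box_coord: "k < n \<Longrightarrow> \<exists>D. (\<lambda>w. w k) \<in> box_polys (map (\<lambda>k w. w k) [0..<n]) D"
  by (rule exI[of _ 1], rule box_polys_coordinate) auto

lemma box_ex_const: "\<exists>D. (\<lambda>w. c) \<in> box_polys xs D"
  using box_polys_const by blast

lemma box_ex_mult: "\<exists>D. F \<in> box_polys xs D \<Longrightarrow> \<exists>D. G \<in> box_polys xs D \<Longrightarrow> \<exists>D. (\<lambda>w. F w * G w) \<in> box_polys xs D"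
  using box_polys_mult by blast

lemma box_ex_add: "\<exists>D. F \<in> box_polys xs D \<Longrightarrow> \<exists>D. G \<in> box_polys xs D \<Longrightarrow> \<exists>D. (\<lambda>w. F w + G w) \<in> box_polys xs D"
proof (elim exE)
  fix D E assume "F \<in> box_polys xs D" "G \<in> box_polys xs E"
  then have "(\<lambda>w. F w + G w) \<in> box_polys xs (D + E)"
    by (intro box_polys_add) (auto elim: box_polys_mono)
  then show ?thesis by blast
qed

lemma rank2_prod_box:
  assumes "\<And>i. \<exists>D. (\<lambda>w. u w $ i) \<in> box_polys xs D" "\<And>i. \<exists>D. (\<lambda>w. v w $ i) \<in> box_polys xs D"
  shows "\<exists>D. (\<lambda>w. rank2_prod \<epsilon> (u w) (v w) $ i $ j) \<in> box_polys xs D"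
  unfolding rank2_prod_nth by (intro box_ex_add box_ex_mult box_ex_const assms)

lemma sym_rank2_manifold:
  fixes L :: "complex^4^4 \<Rightarrow> complex^'k^'l"
  assumes L: "\<And>i j. (\<lambda>x. L x $ i $ j) \<in> polynomial_functions" and M: "\<And>i j. (\<lambda>x. M x $ i $ j) \<in> polynomial_functions"
    and inv: "\<And>x. x \<in> sym_rank2 \<Longrightarrow> M (L x) = x"
    and closed: "locally_closedin zariski (L ` sym_rank2)"
  shows "rational_homology_manifold (L ` sym_rank2)"
proof -
  \<comment> \<open>The products with factors in \<open>U i\<close> and \<open>V i\<close> have
    dimension \<open>i\<close>: a point, its line, then the second factor is freed, then the first.
    Scalars pass between the factors, so linear factor spaces of dimensions \<open>r\<close> and
    \<open>s\<close> give \<open>r + s - 1\<close>.\<close>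
  define U :: "nat \<Rightarrow> (complex^4) set" where "U i = [{axis 1 1}, coord_space {1}, coord_space {1}, coord_space {1}, coord_space {1},
    coord_space {1, 2}, coord_space {1, 2, 3}, UNIV] ! i" for i
  define V :: "nat \<Rightarrow> (complex^4) set" where "V i = [{axis 1 1}, {axis 1 1}, coord_space {1, 2}, coord_space {1, 2, 3}, UNIV, UNIV, UNIV, UNIV] ! i" for i
  define W where "W i = rank2_products 1 (U i) (V i)" for i
  \<comment> \<open>Scaling the first coordinate of the second factor to 1 leaves 4 + 3
    parameters.\<close>
  define a :: "(nat \<Rightarrow> complex) \<Rightarrow> complex^4" where
    "a w = (\<chi> i. if i = 1 then w 0 else if i = 2 then w 1 else if i = 3 then w 2 else w 3)" for w
  define b :: "(nat \<Rightarrow> complex) \<Rightarrow> complex^4" where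
    "b w = (\<chi> i. if i = 1 then 1 else if i = 2 then w 4 else if i = 3 then w 5 else w 6)" for w
  have le7: "i = 0 \<or> i = 1 \<or> i = 2 \<or> i = 3 \<or> i = 4 \<or> i = 5 \<or> i = 6 \<or> i = 7" if "i \<le> 7" for i :: nat using that by arith
  have lt7: "i = 0 \<or> i = 1 \<or> i = 2 \<or> i = 3 \<or> i = 4 \<or> i = 5 \<or> i = 6" if "i < 7" for i :: nat using that by arith
  have UV: "line_closed (U i) \<and> line_closed (V i) \<and> axis 1 1 \<in> U i \<and> axis 1 1 \<in> V i" if "i \<le> 7" for i
    using le7[OF that] by (elim disjE) (simp_all add: U_def V_def axis_in_coord_space)
  show ?thesis
  proof (rule rational_homology_manifold_image[OF L M inv closed, where d = 7 and W = W
      and \<Phi> = "\<lambda>w. rank2_prod 1 (a w) (b w)" and xs = "map (\<lambda>k w. w k) [0..<7]"])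
    show "zariski_prime (W i)" if "i \<le> 7" for i
      unfolding W_def
      using zariski_prime_rank2_products[of 1 "U i" "V i"] UV[OF that] rank2_prod_axis_mem[of 1 1 "U i" 1 "V i" 1] by auto
    show "W i \<subseteq> W (Suc i)" if "i < 7" for i
      unfolding W_def using lt7[OF that]
      by (intro rank2_products_mono; elim disjE) (simp_all add: U_def V_def coord_space_mono axis_in_coord_space)
    show "W 7 = sym_rank2" by (simp add: W_def U_def V_def sym_rank2_eq)
    show "\<exists>f\<in>polynomial_functions. (\<forall>x\<in>W i. f x = 0) \<and> (\<exists>x\<in>W (Suc i). f x \<noteq> 0)" if i: "i < 7" for i
    proof -
      note [simp] = axis_in_coord_space
      consider "i = 0" | "i = 1" | "i = 2" | "i = 3" | "i = 4" | "i = 5" | "i = 6" using lt7[OF i] by blast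
      then show ?thesis
      proof cases
        case 1
        \<comment> \<open>The symmetric product of \<open>axis 1 1\<close> with itself has the entry
          2, hence the constant; the witness with twice that first factor has the entry 4. In the
          later cases a single entry is separated by the coordinate that becomes free.\<close>
        show ?thesis
          unfolding W_def 1
          by (rule rank2_products_separated[of "\<lambda>S. S $ 1 $ 1 - 2" _ _ _ 1 2 _ 1])
            (auto simp: U_def V_def axis_def coord_space_def intro!: polynomial_functions.entry polynomial_functions_entry_diff)
      next
        case 2
        show ?thesis
          unfolding W_def 2
          by (rule rank2_products_separated[of "\<lambda>S. S $ 1 $ 2" _ _ _ 1 1 _ 2])
            (auto simp: U_def V_def axis_def coord_space_def intro!: polynomial_functions.entry polynomial_functions_entry_diff)
      next
        case 3
        show ?thesis
          unfolding W_def 3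
          by (rule rank2_products_separated[of "\<lambda>S. S $ 1 $ 3" _ _ _ 1 1 _ 3])
            (auto simp: U_def V_def axis_def coord_space_def intro!: polynomial_functions.entry polynomial_functions_entry_diff)
      next
        case 4
        show ?thesis
          unfolding W_def 4
          by (rule rank2_products_separated[of "\<lambda>S. S $ 1 $ 4" _ _ _ 1 1 _ 4])
            (auto simp: U_def V_def axis_def coord_space_def intro!: polynomial_functions.entry polynomial_functions_entry_diff)
      next
        case 5
        show ?thesis
          unfolding W_def 5
          by (rule rank2_products_separated[of "\<lambda>S. S $ 2 $ 2" _ _ _ 2 1 _ 2])
            (auto simp: U_def V_def axis_def coord_space_def intro!: polynomial_functions.entry polynomial_functions_entry_diff)
      next
        case 6
        show ?thesis
          unfolding W_def 6
          by (rule rank2_products_separated[of "\<lambda>S. S $ 3 $ 3" _ _ _ 3 1 _ 3])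
            (auto simp: U_def V_def axis_def coord_space_def intro!: polynomial_functions.entry polynomial_functions_entry_diff)
      next
        case 7
        show ?thesis
          unfolding W_def 7
          by (rule rank2_products_separated[of "\<lambda>S. S $ 4 $ 4" _ _ _ 4 1 _ 4])
            (auto simp: U_def V_def axis_def coord_space_def intro!: polynomial_functions.entry polynomial_functions_entry_diff)
      qed
    qed
    have "\<exists>D. (\<lambda>w. a w $ i) \<in> box_polys (map (\<lambda>k w. w k) [0..<7]) D" "\<exists>D. (\<lambda>w. b w $ i) \<in> box_polys (map (\<lambda>k w. w k) [0..<7]) D" for i
      using exhaust_4[of i] by (elim disjE; simp add: a_def b_def box_coord box_ex_const del: upt_rec_numeral)+
    then show "\<exists>D. (\<lambda>w. rank2_prod 1 (a w) (b w) $ i $ j) \<in> box_polys (map (\<lambda>k w. w k) [0..<7]) D" for i j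
      by (rule rank2_prod_box)
    show "local_rank sym_rank2 x (2 * 7)" if "x \<in> sym_rank2" for x :: "complex^4^4"
      using local_rank_sym_rank2[OF that] by simp
    show "\<forall>x\<in>sym_rank2. f x = 0" if f: "f \<in> polynomial_functions" and z: "\<forall>w. f (rank2_prod 1 (a w) (b w)) = 0" for f
    proof
      fix x :: "complex^4^4" assume "x \<in> sym_rank2"
      then obtain u v where x: "x = rank2_prod 1 u v" by (auto simp: sym_rank2_eq rank2_products_def)
      \<comment> \<open>Shifting \<open>v\<close> along the first axis makes its first coordinate
        nonzero for all \<open>t\<close> but one, and there the product is in the parametrized
        set.\<close>
      have "f (rank2_prod 1 (u + t *s 0) (v + t *s axis 1 1)) = 0" for t
      proof (rule polynomial_functions_curve_limit[OF f, where \<gamma> = "\<lambda>t. rank2_prod 1 (u + t *s 0) (v + t *s axis 1 1)"])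
        show "\<exists>p. \<forall>t. rank2_prod 1 (u + t *s 0) (v + t *s axis 1 1) $ i $ j = poly p t" for i j
          by (rule rank2_prod_line)
        show "finite {- v $ 1}" by simp
        fix t assume t: "t \<notin> {- v $ 1}"
        define c where "c = v $ 1 + t"
        have vt: "v $ 1 + t = c" by (simp add: c_def)
        have c: "c \<noteq> 0" using t by (auto simp: c_def add_eq_0_iff)
        then have c1: "v $ 1 / c + t / c = 1" by (simp add: vt flip: add_divide_distrib)
        define w where "w k = [c * u $ 1, c * u $ 2, c * u $ 3, c * u $ 4, v $ 2 / c, v $ 3 / c, v $ 4 / c] ! k" for k
        have "a w = c *s u" "b w = (1 / c) *s (v + t *s axis 1 1)"
          using c by (simp_all add: vec_eq_iff forall_4 a_def b_def w_def axis_def c1 add_divide_distrib)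
        then have "rank2_prod 1 (a w) (b w) = rank2_prod 1 u (v + t *s axis 1 1)"
          by (simp only: rank2_prod_scale[OF c])
        then show "f (rank2_prod 1 (u + t *s 0) (v + t *s axis 1 1)) = 0" using z[rule_format, of w] by (simp add: vec.scale_zero_right)
      qed
      from this[of 0] show "f x = 0" by (simp add: x)
    qed
  qed simp_all
qed

lemma wedge_cone_manifold:
  fixes L :: "complex^5^5 \<Rightarrow> complex^'k^'l"
  assumes L: "\<And>i j. (\<lambda>x. L x $ i $ j) \<in> polynomial_functions" and M: "\<And>i j. (\<lambda>x. M x $ i $ j) \<in> polynomial_functions"
    and inv: "\<And>x. x \<in> wedge_cone \<Longrightarrow> M (L x) = x"
    and closed: "locally_closedin zariski (L ` wedge_cone)"
  shows "rational_homology_manifold (L ` wedge_cone)"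
proof -
  \<comment> \<open>Again dimension \<open>i\<close> at stage \<open>i\<close>. The last step, from
    three coordinates to all five, raises the dimension only by one, since every plane already meets
    a hyperplane.\<close>
  define U :: "nat \<Rightarrow> (complex^5) set" where "U i = [{axis 1 1}, coord_space {1}, coord_space {1}, coord_space {1}, coord_space {1},
    coord_space {1, 2}, coord_space {1, 2, 3}, UNIV] ! i" for i
  define V :: "nat \<Rightarrow> (complex^5) set" where "V i = [{axis 2 1}, {axis 2 1}, coord_space {2, 3}, coord_space {2, 3, 4}, UNIV, UNIV, UNIV, UNIV] ! i" for i
  define W where "W i = rank2_products (- 1) (U i) (V i)" for i
  \<comment> \<open>A reduced basis of a plane with nonzero entry \<open>(1, 2)\<close>: one factor
    has no second coordinate, the other has first coordinate 0 and second coordinate 1. Seven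
    parameters remain, the first being that entry.\<close>
  define a :: "(nat \<Rightarrow> complex) \<Rightarrow> complex^5" where
    "a w = (\<chi> i. if i = 1 then w 0 else if i = 2 then 0 else if i = 3 then w 1 else if i = 4 then w 2 else w 3)" for w
  define b :: "(nat \<Rightarrow> complex) \<Rightarrow> complex^5" where
    "b w = (\<chi> i. if i = 1 then 0 else if i = 2 then 1 else if i = 3 then w 4 else if i = 4 then w 5 else w 6)" for w
  have le7: "i = 0 \<or> i = 1 \<or> i = 2 \<or> i = 3 \<or> i = 4 \<or> i = 5 \<or> i = 6 \<or> i = 7" if "i \<le> 7" for i :: nat using that by arith
  have lt7: "i = 0 \<or> i = 1 \<or> i = 2 \<or> i = 3 \<or> i = 4 \<or> i = 5 \<or> i = 6" if "i < 7" for i :: nat using that by arith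
  have UV: "line_closed (U i) \<and> line_closed (V i) \<and> axis 1 1 \<in> U i \<and> axis 2 1 \<in> V i" if "i \<le> 7" for i
    using le7[OF that] by (elim disjE) (simp_all add: U_def V_def axis_in_coord_space)
  show ?thesis
  proof (rule rational_homology_manifold_image[OF L M inv closed, where d = 7 and W = W
      and \<Phi> = "\<lambda>w. rank2_prod (- 1) (a w) (b w)" and xs = "map (\<lambda>k w. w k) [0..<7]"])
    show "zariski_prime (W i)" if "i \<le> 7" for i
      unfolding W_def
      using zariski_prime_rank2_products[of "- 1" "U i" "V i"] UV[OF that] rank2_prod_axis_mem[of 1 1 "U i" 2 "V i" "- 1"] by auto
    show "W i \<subseteq> W (Suc i)" if "i < 7" for i
      unfolding W_def using lt7[OF that]
      by (intro rank2_products_mono; elim disjE) (simp_all add: U_def V_def coord_space_mono axis_in_coord_space)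
    show "W 7 = wedge_cone" by (simp add: W_def U_def V_def wedge_cone_eq)
    show "\<exists>f\<in>polynomial_functions. (\<forall>x\<in>W i. f x = 0) \<and> (\<exists>x\<in>W (Suc i). f x \<noteq> 0)" if i: "i < 7" for i
    proof -
      note [simp] = axis_in_coord_space
      consider "i = 0" | "i = 1" | "i = 2" | "i = 3" | "i = 4" | "i = 5" | "i = 6" using lt7[OF i] by blast
      then show ?thesis
      proof cases
        case 1
        show ?thesis
          unfolding W_def 1
          by (rule rank2_products_separated[of "\<lambda>S. S $ 1 $ 2 - 1" _ _ _ 1 2 _ 2])
            (auto simp: U_def V_def axis_def coord_space_def intro!: polynomial_functions.entry polynomial_functions_entry_diff)
      next
        case 2
        show ?thesis
          unfolding W_def 2
          by (rule rank2_products_separated[of "\<lambda>S. S $ 1 $ 3" _ _ _ 1 1 _ 3])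
            (auto simp: U_def V_def axis_def coord_space_def intro!: polynomial_functions.entry polynomial_functions_entry_diff)
      next
        case 3
        show ?thesis
          unfolding W_def 3
          by (rule rank2_products_separated[of "\<lambda>S. S $ 1 $ 4" _ _ _ 1 1 _ 4])
            (auto simp: U_def V_def axis_def coord_space_def intro!: polynomial_functions.entry polynomial_functions_entry_diff)
      next
        case 4
        show ?thesis
          unfolding W_def 4
          by (rule rank2_products_separated[of "\<lambda>S. S $ 1 $ 5" _ _ _ 1 1 _ 5])
            (auto simp: U_def V_def axis_def coord_space_def intro!: polynomial_functions.entry polynomial_functions_entry_diff)
      next
        case 5
        show ?thesis
          unfolding W_def 5
          by (rule rank2_products_separated[of "\<lambda>S. S $ 2 $ 3" _ _ _ 2 1 _ 3])
            (auto simp: U_def V_def axis_def coord_space_def intro!: polynomial_functions.entry polynomial_functions_entry_diff)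
      next
        case 6
        show ?thesis
          unfolding W_def 6
          by (rule rank2_products_separated[of "\<lambda>S. S $ 3 $ 4" _ _ _ 3 1 _ 4])
            (auto simp: U_def V_def axis_def coord_space_def intro!: polynomial_functions.entry polynomial_functions_entry_diff)
      next
        case 7
        show ?thesis
          unfolding W_def 7
          by (rule rank2_products_separated[of "\<lambda>S. S $ 4 $ 5" _ _ _ 4 1 _ 5])
            (auto simp: U_def V_def axis_def coord_space_def intro!: polynomial_functions.entry polynomial_functions_entry_diff)
      qed
    qed
    have "\<exists>D. (\<lambda>w. a w $ i) \<in> box_polys (map (\<lambda>k w. w k) [0..<7]) D" "\<exists>D. (\<lambda>w. b w $ i) \<in> box_polys (map (\<lambda>k w. w k) [0..<7]) D" for i
      using exhaust_5[of i] by (elim disjE; simp add: a_def b_def box_coord box_ex_const del: upt_rec_numeral)+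
    then show "\<exists>D. (\<lambda>w. rank2_prod (- 1) (a w) (b w) $ i $ j) \<in> box_polys (map (\<lambda>k w. w k) [0..<7]) D" for i j
      by (rule rank2_prod_box)
    show "local_rank wedge_cone x (2 * 7)" if "x \<in> wedge_cone" for x :: "complex^5^5"
      using local_rank_wedge_cone[OF that] by simp
    show "\<forall>x\<in>wedge_cone. f x = 0" if f: "f \<in> polynomial_functions" and z: "\<forall>w. f (rank2_prod (- 1) (a w) (b w)) = 0" for f
    proof
      fix x :: "complex^5^5" assume "x \<in> wedge_cone"
      then obtain u v where x: "x = rank2_prod (- 1) u v" by (auto simp: wedge_cone_eq rank2_products_def)
      \<comment> \<open>Both factors are shifted so that the entry \<open>(1, 2)\<close> becomes a
        monic quadratic in \<open>t\<close>, nonzero for all but finitely many \<open>t\<close>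
        whatever \<open>u\<close> and \<open>v\<close> are.\<close>
      have "f (rank2_prod (- 1) (u + t *s axis 1 1) (v + t *s axis 2 1)) = 0" for t
      proof (rule polynomial_functions_curve_limit[OF f, where \<gamma> = "\<lambda>t. rank2_prod (- 1) (u + t *s axis 1 1) (v + t *s axis 2 1)"])
        show "\<exists>p. \<forall>t. rank2_prod (- 1) (u + t *s axis 1 1) (v + t *s axis 2 1) $ i $ j = poly p t" for i j
          by (rule rank2_prod_line)
        have "{t. (u $ 1 + t) * (v $ 2 + t) - v $ 1 * u $ 2 = 0} = {t. poly [:u $ 1 * v $ 2 - v $ 1 * u $ 2, u $ 1 + v $ 2, 1:] t = 0}"
          by (simp add: algebra_simps)
        then show "finite {t. (u $ 1 + t) * (v $ 2 + t) - v $ 1 * u $ 2 = 0}" by (simp only: poly_roots_finite[of "[:u $ 1 * v $ 2 - v $ 1 * u $ 2, u $ 1 + v $ 2, 1:]"] pCons_eq_0_iff one_neq_zero simp_thms)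
        fix t assume t: "t \<notin> {t. (u $ 1 + t) * (v $ 2 + t) - v $ 1 * u $ 2 = 0}"
        define P where "P = rank2_prod (- 1) (u + t *s axis 1 1) (v + t *s axis 2 1)"
        have P12: "P $ 1 $ 2 \<noteq> 0" using t by (simp add: P_def axis_def)
        have P0: "P $ i $ i = 0" for i by (simp add: P_def)
        define w where "w k = [P $ 1 $ 2, P $ 3 $ 2, P $ 4 $ 2, P $ 5 $ 2, P $ 1 $ 3 / P $ 1 $ 2, P $ 1 $ 4 / P $ 1 $ 2, P $ 1 $ 5 / P $ 1 $ 2] ! k" for k
        have ab: "a w $ i = P $ i $ 2" "b w $ i = P $ 1 $ i / P $ 1 $ 2" for i
          using exhaust_5[of i] P12 P0 by (auto simp: a_def b_def w_def)
        have "rank2_prod (- 1) (a w) (b w) $ i $ j * P $ 1 $ 2 = P $ i $ 2 * P $ 1 $ j - P $ 1 $ i * P $ j $ 2" for i j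
        proof -
          have "rank2_prod (- 1) (a w) (b w) $ i $ j * P $ 1 $ 2 = a w $ i * (b w $ j * P $ 1 $ 2) - (b w $ i * P $ 1 $ 2) * a w $ j"
            by (simp add: algebra_simps)
          with ab show ?thesis using P12 by simp
        qed
        \<comment> \<open>The Plucker relation for the indices 1, 2, \<open>i\<close>,
          \<open>j\<close>.\<close>
        also have "P $ i $ 2 * P $ 1 $ j - P $ 1 $ i * P $ j $ 2 = P $ i $ j * P $ 1 $ 2" for i j
          unfolding P_def rank2_prod_nth by (simp add: algebra_simps)
        finally have "rank2_prod (- 1) (a w) (b w) = P" using P12 by (simp add: vec_eq_iff)
        then show "f (rank2_prod (- 1) (u + t *s axis 1 1) (v + t *s axis 2 1)) = 0" using z unfolding P_def by metis
      qed
      from this[of 0] show "f x = 0" by (simp add: x)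
    qed
  qed simp_all
qed

section \<open>The cones as locally closed sets\<close>

lemma polynomial_functions_uminus: "f \<in> polynomial_functions \<Longrightarrow> (\<lambda>x. - f x) \<in> polynomial_functions"
  using polynomial_functions.mult[OF polynomial_functions.const[of "- 1"]] by simp

lemma polynomial_functions_diff:
  "f \<in> polynomial_functions \<Longrightarrow> g \<in> polynomial_functions \<Longrightarrow> (\<lambda>x. f x - g x) \<in> polynomial_functions"
  using polynomial_functions.add[OF _ polynomial_functions_uminus] by simp

lemma polynomial_functions_divide: "f \<in> polynomial_functions \<Longrightarrow> (\<lambda>x. f x / c) \<in> polynomial_functions"
  using polynomial_functions.mult[OF polynomial_functions.const[of "1 / c"]] by simp

lemmas polynomial_functions_intros = polynomial_functions.intros polynomial_functions_uminus polynomial_functions_diff polynomial_functions_divide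

lemma polynomial_functions_matrix_mult:
  assumes "\<And>i j. (\<lambda>x. F x $ i $ j) \<in> polynomial_functions" "\<And>i j. (\<lambda>x. G x $ i $ j) \<in> polynomial_functions"
  shows "(\<lambda>x. (F x ** G x) $ i $ j) \<in> polynomial_functions"
  unfolding matrix_matrix_mult_def vec_lambda_beta
  by (intro polynomial_functions_sum polynomial_functions.mult assms)

lemma closedin_zariski_zero_set:
  assumes "\<And>i j. (\<lambda>x. F x $ i $ j) \<in> polynomial_functions"
  shows "closedin zariski {x. F x = 0}"
proof -
  have "{x. F x = 0} = zero_locus (range (\<lambda>(i, j) x. F x $ i $ j))"
    by (auto simp: zero_locus_def vec_eq_iff)
  then show ?thesis
    using assms unfolding closedin_zariski by (intro exI[of _ "range (\<lambda>(i, j) x. F x $ i $ j)"]) auto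
qed

lemma polynomial_functions_sp4_mean: "sp4_mean \<in> polynomial_functions"
  using polynomial_functions_divide[OF polynomial_functions.add[OF polynomial_functions_matrix_mult[OF polynomial_functions.entry polynomial_functions.entry]
    polynomial_functions_matrix_mult[OF polynomial_functions.entry polynomial_functions.entry]]]
  by (simp add: sp4_mean_def[abs_def])

lemma polynomial_functions_sp4_nil: "(\<lambda>X. sp4_nil X $ i $ j) \<in> polynomial_functions"
  unfolding sp4_nil_def vector_minus_component
  by (intro polynomial_functions_diff polynomial_functions_matrix_mult polynomial_functions.entry)
    (cases "i = j"; simp add: mat_def polynomial_functions_sp4_mean polynomial_functions.const)

lemma polynomial_functions_sp4_cubic: "(\<lambda>X. sp4_cubic X $ i $ j) \<in> polynomial_functions"
  unfolding sp4_cubic_def vector_minus_component cmat_scale_nth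
  by (intro polynomial_functions_diff polynomial_functions_matrix_mult polynomial_functions_sp4_nil polynomial_functions.entry
    polynomial_functions.mult polynomial_functions_sp4_mean)

lemma closedin_zariski_sp4: "closedin zariski sp4"
  unfolding sp4_eq transpose_def
  by (intro closedin_zariski_zero_set)
    (simp only: vector_add_component, intro polynomial_functions.add polynomial_functions_matrix_mult, simp_all add: polynomial_functions.intros)

lemma openin_zariski_nonzero: "openin zariski {X :: complex^'n^'m. X \<noteq> 0}"
  using closedin_zariski_zero_set[of "\<lambda>X :: complex^'n^'m. X"]
  by (simp add: polynomial_functions.entry closedin_def Collect_neg_eq Compl_eq_Diff_UNIV)

lemma sp4_rank2_eq: "(\<lambda>S. - (symplectic_form ** S)) ` sym_rank2 = {X. X \<noteq> 0} \<inter> (sp4 \<inter> {X. sp4_cubic X = 0})"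
proof -
  have "0 \<notin> (\<lambda>S. - (symplectic_form ** S)) ` sym_rank2"
  proof
    assume "0 \<in> (\<lambda>S. - (symplectic_form ** S)) ` sym_rank2"
    then obtain S where S: "0 = - (symplectic_form ** S)" "S \<in> sym_rank2" by (rule imageE)
    show False using symplectic_inverse'[of S] S(2) unfolding S(1)[symmetric] by (simp add: sym_rank2_def)
  qed
  then have "X \<in> (\<lambda>S. - (symplectic_form ** S)) ` sym_rank2 \<longleftrightarrow> X \<noteq> 0 \<and> X \<in> sp4 \<and> sp4_cubic X = 0" for X
    using sp4_cubic_eq_0_iff[of X] by metis
  then show ?thesis by (simp only: set_eq_iff Int_iff mem_Collect_eq simp_thms)
qed

lemma sp4_bivector_eq: "sp4_of_bivector ` wedge_cone = {X. X \<noteq> 0} \<inter> (sp4 \<inter> {X. sp4_nil X = 0})"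
proof -
  have "sp4_of_bivector P \<noteq> 0" if P: "P \<in> wedge_cone" for P
  proof
    assume "sp4_of_bivector P = 0"
    moreover have "bivector_of_sp4 (sp4_of_bivector P) = P"
      using P by (intro bivector_of_sp4_of_bivector) (auto simp: wedge_cone_def wedge_prod_def)
    moreover have "bivector_of_sp4 0 = 0" by (simp add: bivector_of_sp4_def vec_eq_iff)
    ultimately show False using P by (simp add: wedge_cone_def)
  qed
  then have "0 \<notin> sp4_of_bivector ` wedge_cone" by (metis imageE)
  then have "X \<in> sp4_of_bivector ` wedge_cone \<longleftrightarrow> X \<noteq> 0 \<and> X \<in> sp4 \<and> sp4_nil X = 0" for X
    using sp4_nil_eq_0_iff[of X] by metis
  then show ?thesis by (simp only: set_eq_iff Int_iff mem_Collect_eq simp_thms)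
qed

lemma rational_homology_manifold_rank2:
  "rational_homology_manifold ((\<lambda>S. - (symplectic_form ** S)) ` sym_rank2)"
proof (rule sym_rank2_manifold[where M = "\<lambda>X. symplectic_form ** X"])
  show "(\<lambda>S. (symplectic_form ** S) $ i $ j) \<in> polynomial_functions" for i j :: 4
    by (intro polynomial_functions_matrix_mult polynomial_functions.intros)
  then show "(\<lambda>S. (- (symplectic_form ** S)) $ i $ j) \<in> polynomial_functions" for i j :: 4
    unfolding vector_uminus_component by (rule polynomial_functions_uminus)
  show "locally_closedin zariski ((\<lambda>S. - (symplectic_form ** S)) ` sym_rank2)"
    unfolding locally_closedin_def sp4_rank2_eq
    using openin_zariski_nonzero closedin_Int[OF closedin_zariski_sp4 closedin_zariski_zero_set[OF polynomial_functions_sp4_cubic]] by blast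
qed (rule symplectic_inverse')

lemma rational_homology_manifold_bivector:
  "rational_homology_manifold (sp4_of_bivector ` wedge_cone)"
proof (rule wedge_cone_manifold[where M = bivector_of_sp4])
  show "(\<lambda>P. sp4_of_bivector P $ i $ j) \<in> polynomial_functions" for i j
    using exhaust_4[of i] exhaust_4[of j]
    by (elim disjE; simp only: sp4_of_bivector_nth; intro polynomial_functions_intros)
  show "(\<lambda>X. bivector_of_sp4 X $ i $ j) \<in> polynomial_functions" for i j
    unfolding bivector_of_sp4_def Let_def vec_lambda_beta
    using exhaust_5[of i] exhaust_5[of j]
    by (elim disjE; simp; intro polynomial_functions_intros)
  show "bivector_of_sp4 (sp4_of_bivector P) = P" if "P \<in> wedge_cone" for P
    using that by (intro bivector_of_sp4_of_bivector) (auto simp: wedge_cone_def wedge_prod_def)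
  show "locally_closedin zariski (sp4_of_bivector ` wedge_cone)"
    unfolding locally_closedin_def sp4_bivector_eq
    using openin_zariski_nonzero closedin_Int[OF closedin_zariski_sp4 closedin_zariski_zero_set[OF polynomial_functions_sp4_nil]] by blast
qed

text \<open>An irreducible \<open>C\<close> lies in one of the two closed sets, say in
  \<open>A\<close>; as \<open>S \<inter> A\<close> is irreducible, maximality of \<open>C\<close>
  gives equality.\<close>

lemma irreducible_components_of_Un:
  assumes AB: "closedin zariski A" "closedin zariski B" "S \<subseteq> A \<union> B"
    and irr: "irreducible_space (subtopology zariski (S \<inter> A))" "irreducible_space (subtopology zariski (S \<inter> B))"
    and C: "C \<in> irreducible_components_of (subtopology zariski S)"
  shows "C = S \<inter> A \<or> C = S \<inter> B"
proof -
  have sub: "subtopology (subtopology zariski S) D = subtopology zariski D" if "D \<subseteq> S" for D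
    using that by (simp add: subtopology_subtopology Int_absorb1)
  have C': "C \<subseteq> S" "irreducible_space (subtopology zariski C)"
    and max: "\<And>D. C \<subseteq> D \<Longrightarrow> D \<subseteq> S \<Longrightarrow> irreducible_space (subtopology zariski D) \<Longrightarrow> D = C"
    using C by (auto simp: irreducible_components_of_def sub)
  have "closedin (subtopology zariski C) (A \<inter> C)" "closedin (subtopology zariski C) (B \<inter> C)"
    using AB by (auto simp: closedin_subtopology)
  moreover have "A \<inter> C \<union> B \<inter> C = C" using AB C' by blast
  ultimately have "A \<inter> C = C \<or> B \<inter> C = C"
    using C'(2) unfolding irreducible_space_def by simp
  then show ?thesis
  proof
    assume "A \<inter> C = C"
    then show ?thesis using max[of "S \<inter> A"] irr C'(1) by blast
  next
    assume "B \<inter> C = C"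
    then show ?thesis using max[of "S \<inter> B"] irr C'(1) by blast
  qed
qed

theorem mainTheorem3:
  shows "locally_closedin (subtopology zariski sp4) (sp4_stratum 6 \<union> sp4_stratum 4) \<and>
    (\<forall>X \<in> irreducible_components_of (subtopology zariski (sp4_stratum 6 \<union> sp4_stratum 4)).
       rational_homology_manifold X)"
proof (intro conjI ballI)
  let ?S = "sp4_stratum 6 \<union> sp4_stratum 4" and ?A = "{X. sp4_cubic X = 0}" and ?B = "{X. sp4_nil X = 0}"
  have AB: "closedin zariski ?A" "closedin zariski ?B"
    by (intro closedin_zariski_zero_set polynomial_functions_sp4_cubic polynomial_functions_sp4_nil)+
  have "openin (subtopology zariski sp4) ({X. X \<noteq> 0} \<inter> sp4)" "closedin (subtopology zariski sp4) ((?A \<union> ?B) \<inter> sp4)"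
    using openin_zariski_nonzero closedin_Un[OF AB] by (auto simp: openin_subtopology closedin_subtopology)
  moreover have "?S = ({X. X \<noteq> 0} \<inter> sp4) \<inter> ((?A \<union> ?B) \<inter> sp4)" unfolding sp4_strata by blast
  ultimately show "locally_closedin (subtopology zariski sp4) ?S" unfolding locally_closedin_def by blast
  have SA: "?S \<inter> ?A = (\<lambda>S. - (symplectic_form ** S)) ` sym_rank2" and SB: "?S \<inter> ?B = sp4_of_bivector ` wedge_cone"
    unfolding sp4_strata sp4_rank2_eq sp4_bivector_eq by blast+
  have m: "rational_homology_manifold (?S \<inter> ?A)" "rational_homology_manifold (?S \<inter> ?B)"
    unfolding SA SB by (rule rational_homology_manifold_rank2 rational_homology_manifold_bivector)+
  fix X assume "X \<in> irreducible_components_of (subtopology zariski ?S)"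
  moreover have "?S \<subseteq> ?A \<union> ?B" unfolding sp4_strata by blast
  ultimately have "X = ?S \<inter> ?A \<or> X = ?S \<inter> ?B"
    using irreducible_components_of_Un[OF AB] m unfolding rational_homology_manifold_def by blast
  then show "rational_homology_manifold X" using m by blast
qed

end
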